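(* Let $N\ge 2$. Every pair $(\alpha,\beta)\in\mathbb R_+^2$ defines a central generating functional $L_{\alpha\beta}$ on $U_N^+$ through the formula $$L_{\alpha\beta}:\chi_w\longmapsto-\Big(\ell(w)\alpha+\big(p(w)-q(w)\big)^2\beta\Big)N^{\ell(w)-1},\qquad w \text{ a word over }\{\lozenge,\bullet\}.$$ Moreover: (i) the functionals $L_{\alpha\beta}$, $(\alpha,\beta)\in\mathbb R_+^2$, are exactly the real centralized Gaussian generating functionals on $U_N^+$, i.e. the functionals of the form $L\circ\mathbb E$ with $L$ a Gaussian generating functional on $U_N^+$, that take real values on all the elements $\chi_w$; (ii) the centralized pulled-back Brownian motion from the classical group $U_N$, namely $L\circ\pi\circ\mathbb E$ where $L$ is the Laplace–Beltrami functional on $U_N$, is of the form $L_{\alpha\beta}$ for some $(\alpha,\beta)\in\mathbb R_+^2$.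
   Context: $\mathcal O(U_N^+)$ is the universal unital $*$-algebra generated by $u_{ij}$, $1\le i,j\le N$, with $\sum_k u_{ik}u_{jk}^*=\delta_{ij}=\sum_k u_{ki}^*u_{kj}$ and $\sum_k u_{ik}^*u_{jk}=\delta_{ij}=\sum_k u_{ki}u_{kj}^*$; coproduct $\Delta(u_{ij})=\sum_k u_{ik}\otimes u_{kj}$, counit the $*$-homomorphism with $\varepsilon(u_{ij})=\delta_{ij}$; $h$ is the Haar state. For a word $w=w_1\cdots w_n$ over $\{\lozenge,\bullet\}$, $\chi_w=\chi_{w_1}\cdots\chi_{w_n}$ with $\chi_\lozenge=\sum_i u_{ii}$, $\chi_\bullet=\sum_i u_{ii}^*$ (and $\chi_\emptyset=1$); $\ell(w)=n$, and $p(w)$, $q(w)$ are the numbers of occurrences of $\lozenge$, $\bullet$ in $w$. The central algebra $\mathcal O(U_N^+)_0$ is the algebra generated by the characters of finite-dimensional representations of $U_N^+$; it is the linear span of the $\chi_w$'s (which are linearly independent for $N\ge2$). $\mathbb E:\mathcal O(U_N^+)\to\mathcal O(U_N^+)_0$ is the conditional expectation preserving $h$ (the orthogonal projection for $\langle x,y\rangle=h(xy^* )$). A generating functional on $U_N^+$ is a hermitian linear functional $L:\mathcal O(U_N^+)\to\mathbb C$ with $L(1)=0$ and $L(x^*x)\ge0$ for all $x\in\ker\varepsilon$. It is central if $L=L\circ\mathbb E$; so a central functional is determined by its values on the $\chi_w$. For a generating functional $L$, the functional $L\circ\mathbb E$ is called its centralization. A generating functional is Gaussian if for all $x,y,z$,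 $L(xyz)=L(xy)\varepsilon(z)+L(xz)\varepsilon(y)+L(yz)\varepsilon(x)-\varepsilon(xy)L(z)-\varepsilon(xz)L(y)-\varepsilon(yz)L(x)$. $\pi:\mathcal O(U_N^+)\to\mathcal O(U_N)$ is the quotient map onto the algebra of regular functions on the classical unitary group, sending $u_{ij}$ to the $(i,j)$ coordinate function. The Laplace–Beltrami functional is $L(f)=\sum_{i=1}^{N^2}(X_i^2f)(e)$, where $Xf(x)=\frac{d}{dt}f(x\exp(tX))|_{t=0}$ and $(X_i)$ is an orthonormal basis of the Lie algebra $\mathfrak u_N$ of skew-Hermitian matrices for $\langle X,Y\rangle=-\mathrm{Tr}(XY)$, consisting of an orthonormal basis of $\mathfrak{su}_N$ and $X_{N^2}=\mathrm iI_N/\sqrt N$. *)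

theory Defs
  imports "HOL-Analysis.Analysis" "HOL-Library.Multiset"
begin

section \<open>Unital complex \<open>*\<close>-algebras\<close>

text \<open>The zero algebra is allowed, hence \<^class>\<open>ring\<close> and \<^class>\<open>monoid_mult\<close> rather than
  \<^class>\<open>ring_1\<close>.\<close>

class complex_star_algebra = ring + monoid_mult +
  fixes scaleC :: "complex \<Rightarrow> 'a \<Rightarrow> 'a" (infixr "*\<^sub>C" 75)
    and star :: "'a \<Rightarrow> 'a"
  assumes scaleC_add_right: "c *\<^sub>C (x + y) = c *\<^sub>C x + c *\<^sub>C y"
    and scaleC_add_left: "(c + d) *\<^sub>C x = c *\<^sub>C x + d *\<^sub>C x"
    and scaleC_scaleC: "c *\<^sub>C d *\<^sub>C x = (c * d) *\<^sub>C x"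
    and scaleC_one: "1 *\<^sub>C x = x"
    and mult_scaleC_left: "(c *\<^sub>C x) * y = c *\<^sub>C (x * y)"
    and mult_scaleC_right: "x * (c *\<^sub>C y) = c *\<^sub>C (x * y)"
    and star_add: "star (x + y) = star x + star y"
    and star_scaleC: "star (c *\<^sub>C x) = cnj c *\<^sub>C star x"
    and star_mult: "star (x * y) = star y * star x"
    and star_star: "star (star x) = x"

interpretation cvec: vector_space "scaleC :: complex \<Rightarrow> 'a::complex_star_algebra \<Rightarrow> 'a"
  by unfold_locales (simp_all add: scaleC_add_right scaleC_add_left scaleC_scaleC scaleC_one)

abbreviation clinear :: "('a::complex_star_algebra \<Rightarrow> 'b::complex_star_algebra) \<Rightarrow> bool" where
  "clinear \<equiv> Vector_Spaces.linear scaleC scaleC"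

instantiation complex :: complex_star_algebra
begin
definition scaleC_complex :: "complex \<Rightarrow> complex \<Rightarrow> complex" where "scaleC_complex c x = c * x"
definition star_complex :: "complex \<Rightarrow> complex" where "star_complex = cnj"
instance by standard (simp_all add: scaleC_complex_def star_complex_def algebra_simps)
end

lemma star_one: "star (1 :: 'a::complex_star_algebra) = 1"
  by (metis mult.left_neutral mult.right_neutral star_mult star_star)

definition star_hom :: "('a::complex_star_algebra \<Rightarrow> 'b::complex_star_algebra) \<Rightarrow> bool" where
  "star_hom \<phi> \<longleftrightarrow> clinear \<phi> \<and> \<phi> 1 = 1 \<and> (\<forall>x y. \<phi> (x * y) = \<phi> x * \<phi> y) \<and>
    (\<forall>x. \<phi> (star x) = star (\<phi> x))"

section \<open>Algebraic tensor products\<close>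

text \<open>Finite formal sums of pairs modulo the smallest congruence that makes \<open>(a, b)\<close> bilinear.\<close>

inductive tensor_eq ::
  "('a::complex_star_algebra \<times> 'b::complex_star_algebra) multiset \<Rightarrow> ('a \<times> 'b) multiset \<Rightarrow> bool" where
  refl: "tensor_eq s s"
| sym: "tensor_eq s t \<Longrightarrow> tensor_eq t s"
| trans: "tensor_eq r s \<Longrightarrow> tensor_eq s t \<Longrightarrow> tensor_eq r t"
| add: "tensor_eq s t \<Longrightarrow> tensor_eq (s + r) (t + r)"
| add_left: "tensor_eq {#(a + a', b)#} {#(a, b), (a', b)#}"
| add_right: "tensor_eq {#(a, b + b')#} {#(a, b), (a, b')#}"
| scale: "tensor_eq {#(c *\<^sub>C a, b)#} {#(a, c *\<^sub>C b)#}"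
| zero: "tensor_eq {#(0, b)#} {#}"

lemma tensor_eq_add2: "tensor_eq s s' \<Longrightarrow> tensor_eq t t' \<Longrightarrow> tensor_eq (s + t) (s' + t')"
  by (metis add.commute tensor_eq.add tensor_eq.trans)

quotient_type (overloaded) ('a, 'b) tensor =
  "('a::complex_star_algebra \<times> 'b::complex_star_algebra) multiset" / tensor_eq
  by (intro equivpI reflpI sympI transpI) (blast intro: tensor_eq.intros)+

lift_definition pure_tensor ::
  "'a::complex_star_algebra \<Rightarrow> 'b::complex_star_algebra \<Rightarrow> ('a, 'b) tensor" (infixr "\<otimes>" 70)
  is "\<lambda>a b. {#(a, b)#}" .

definition tmult :: "('a::complex_star_algebra \<times> 'b::complex_star_algebra) multiset
    \<Rightarrow> ('a \<times> 'b) multiset \<Rightarrow> ('a \<times> 'b) multiset" where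
  "tmult s t = (\<Sum>(a, b)\<in>#s. image_mset (\<lambda>(a', b'). (a * a', b * b')) t)"

lemma tmult_simps [simp]:
  "tmult {#} t = {#}" "tmult (s + s') t = tmult s t + tmult s' t"
  "tmult (add_mset p s) t = image_mset (\<lambda>(a', b'). (fst p * a', snd p * b')) t + tmult s t"
  "tmult s {#} = {#}" "tmult s (t + t') = tmult s t + tmult s t'"
  by (simp_all add: tmult_def case_prod_unfold sum_mset.distrib)

lemma tmult_add_mset_right [simp]:
  "tmult s (add_mset q t) = image_mset (\<lambda>(a, b). (a * fst q, b * snd q)) s + tmult s t"
  by (induction s) (simp_all add: case_prod_unfold ac_simps)

lemma tensor_eq_image:
  assumes "tensor_eq s t"
    and "\<And>a a'. f (a + a') = f a + f a'" "\<And>b b'. g (b + b') = g b + g b'"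
    and "\<And>c. \<exists>d. \<forall>a b. f (c *\<^sub>C a) = d *\<^sub>C f a \<and> g (c *\<^sub>C b) = d *\<^sub>C g b"
  shows "tensor_eq (image_mset (\<lambda>(a, b). (f a, g b)) s) (image_mset (\<lambda>(a, b). (f a, g b)) t)"
  using assms(1)
proof induction
  case (scale c a b)
  then show ?case using assms(4)[of c] by (auto intro: tensor_eq.scale)
next
  case (zero b)
  have "f 0 = 0" using assms(2)[of 0 0] by simp
  then show ?case by (auto intro: tensor_eq.zero)
qed (auto simp: assms(2,3) intro: tensor_eq.intros)

lemma tensor_eq_tmult_right: "tensor_eq t t' \<Longrightarrow> tensor_eq (tmult s t) (tmult s t')"
proof (induction s)
  case empty
  show ?case by (auto intro: tensor_eq.refl)
next
  case (add p s)
  then show ?case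
    by (auto intro!: tensor_eq_add2 tensor_eq_image simp: distrib_left mult_scaleC_right)
qed

lemma tensor_eq_tmult_left: "tensor_eq s s' \<Longrightarrow> tensor_eq (tmult s t) (tmult s' t)"
proof (induction t)
  case empty
  show ?case by (auto intro: tensor_eq.refl)
next
  case (add p t)
  then show ?case
    by (auto intro!: tensor_eq_add2 tensor_eq_image simp: distrib_right mult_scaleC_left)
qed

lemma tmult_image_left:
  "tmult (image_mset (\<lambda>(a, b). (c *\<^sub>C a, b)) s) t = image_mset (\<lambda>(a, b). (c *\<^sub>C a, b)) (tmult s t)"
  by (induction s) (auto simp: multiset.map_comp o_def case_prod_unfold mult_scaleC_left)

lemma tmult_image_right:
  "tmult s (image_mset (\<lambda>(a, b). (c *\<^sub>C a, b)) t) = image_mset (\<lambda>(a, b). (c *\<^sub>C a, b)) (tmult s t)"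
  by (induction s) (auto simp: multiset.map_comp o_def case_prod_unfold mult_scaleC_right)

lemma tmult_assoc: "tmult (tmult r s) t = tmult r (tmult s t)"
proof (induction r)
  case (add p r)
  have "tmult (image_mset (\<lambda>(a', b'). (fst p * a', snd p * b')) s) t =
      image_mset (\<lambda>(a', b'). (fst p * a', snd p * b')) (tmult s t)"
    by (induction s) (auto simp: multiset.map_comp o_def case_prod_unfold mult.assoc)
  with add show ?case by simp
qed simp

lemma tmult_star:
  "image_mset (\<lambda>(a, b). (star a, star b)) (tmult s t) =
    tmult (image_mset (\<lambda>(a, b). (star a, star b)) t) (image_mset (\<lambda>(a, b). (star a, star b)) s)"
  by (induction s) (auto simp: multiset.map_comp o_def case_prod_unfold star_mult)

lemma tensor_eq_neg: "tensor_eq (image_mset (\<lambda>(a, b). ((- 1) *\<^sub>C a, b)) s + s) {#}"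
proof (induction s)
  case empty
  show ?case by (auto intro: tensor_eq.refl)
next
  case (add p s)
  have "tensor_eq {#((- 1) *\<^sub>C fst p, snd p), (fst p, snd p)#} {#((- 1) *\<^sub>C fst p + fst p, snd p)#}"
    by (rule tensor_eq.sym, rule tensor_eq.add_left)
  moreover have "(- 1) *\<^sub>C fst p + fst p = 0"
    using scaleC_add_left[of "- 1" 1 "fst p"] by (simp add: scaleC_one)
  ultimately have "tensor_eq {#((- 1) *\<^sub>C fst p, snd p), p#} {#}"
    by (auto intro: tensor_eq.trans tensor_eq.zero)
  from tensor_eq_add2[OF this add] show ?case by (simp add: case_prod_unfold add_mset_commute)
qed

lemma tensor_eq_scale_add:
  "tensor_eq (image_mset (\<lambda>(a, b). ((c + d) *\<^sub>C a, b)) s)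
    (image_mset (\<lambda>(a, b). (c *\<^sub>C a, b)) s + image_mset (\<lambda>(a, b). (d *\<^sub>C a, b)) s)"
proof (induction s)
  case empty
  show ?case by (auto intro: tensor_eq.refl)
next
  case (add p s)
  have "tensor_eq {#((c + d) *\<^sub>C fst p, snd p)#} {#(c *\<^sub>C fst p, snd p), (d *\<^sub>C fst p, snd p)#}"
    by (simp add: scaleC_add_left tensor_eq.add_left)
  from tensor_eq_add2[OF this add] show ?case by (simp add: case_prod_unfold add_mset_commute)
qed

instantiation tensor :: (complex_star_algebra, complex_star_algebra) complex_star_algebra
begin

lift_definition zero_tensor :: "('a, 'b) tensor" is "{#}" .

lift_definition one_tensor :: "('a, 'b) tensor" is "{#(1, 1)#}" .

lift_definition plus_tensor :: "('a, 'b) tensor \<Rightarrow> ('a, 'b) tensor \<Rightarrow> ('a, 'b) tensor"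
  is "(+)" by (rule tensor_eq_add2)

lift_definition times_tensor :: "('a, 'b) tensor \<Rightarrow> ('a, 'b) tensor \<Rightarrow> ('a, 'b) tensor"
  is tmult by (meson tensor_eq.trans tensor_eq_tmult_left tensor_eq_tmult_right)

lift_definition scaleC_tensor :: "complex \<Rightarrow> ('a, 'b) tensor \<Rightarrow> ('a, 'b) tensor"
  is "\<lambda>c. image_mset (\<lambda>(a, b). (c *\<^sub>C a, b))"
proof -
  fix c and s t :: "('a \<times> 'b) multiset"
  assume "tensor_eq s t"
  then show "tensor_eq (image_mset (\<lambda>(a, b). (c *\<^sub>C a, b)) s) (image_mset (\<lambda>(a, b). (c *\<^sub>C a, b)) t)"
  proof induction
    case (scale d a b)
    show ?case using tensor_eq.scale[of d "c *\<^sub>C a" b]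
      by (simp add: scaleC_scaleC mult.commute)
  next
    case (add_left a a' b)
    then show ?case by (simp add: scaleC_add_right tensor_eq.add_left)
  next
    case (zero b)
    then show ?case by (simp add: tensor_eq.zero)
  qed (auto intro: tensor_eq.intros)
qed

lift_definition star_tensor :: "('a, 'b) tensor \<Rightarrow> ('a, 'b) tensor"
  is "image_mset (\<lambda>(a, b). (star a, star b))"
  by (erule tensor_eq_image) (auto simp: star_add star_scaleC)

definition uminus_tensor :: "('a, 'b) tensor \<Rightarrow> ('a, 'b) tensor" where
  "uminus_tensor x = (- 1) *\<^sub>C x"

definition minus_tensor :: "('a, 'b) tensor \<Rightarrow> ('a, 'b) tensor \<Rightarrow> ('a, 'b) tensor" where
  "minus_tensor x y = x + (- y)"

instance
proof
  fix x y z :: "('a, 'b) tensor" and c d :: complex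
  show "x + y + z = x + (y + z)" by transfer (simp add: add.assoc tensor_eq.refl)
  show "x + y = y + x" by transfer (simp add: add.commute tensor_eq.refl)
  show "0 + x = x" by transfer (simp add: tensor_eq.refl)
  show "- x + x = 0" unfolding uminus_tensor_def by transfer (rule tensor_eq_neg)
  show "x - y = x + - y" by (simp add: minus_tensor_def)
  show "x * y * z = x * (y * z)" by transfer (simp add: tmult_assoc tensor_eq.refl)
  show "(x + y) * z = x * z + y * z" by transfer (simp add: tensor_eq.refl)
  show "x * (y + z) = x * y + x * z" by transfer (simp add: tensor_eq.refl)
  show "1 * x = x" by transfer (simp add: tensor_eq.refl)
  show "x * 1 = x" by transfer (simp add: tensor_eq.refl)
  show "c *\<^sub>C (x + y) = c *\<^sub>C x + c *\<^sub>C y" by transfer (simp add: tensor_eq.refl)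
  show "(c + d) *\<^sub>C x = c *\<^sub>C x + d *\<^sub>C x" by transfer (rule tensor_eq_scale_add)
  show "c *\<^sub>C d *\<^sub>C x = (c * d) *\<^sub>C x"
    by transfer (simp add: multiset.map_comp o_def case_prod_unfold scaleC_scaleC tensor_eq.refl)
  show "1 *\<^sub>C x = x" by transfer (simp add: scaleC_one tensor_eq.refl)
  show "(c *\<^sub>C x) * y = c *\<^sub>C (x * y)" by transfer (simp add: tmult_image_left tensor_eq.refl)
  show "x * (c *\<^sub>C y) = c *\<^sub>C (x * y)" by transfer (simp add: tmult_image_right tensor_eq.refl)
  show "star (x + y) = star x + star y" by transfer (simp add: tensor_eq.refl)
  show "star (x * y) = star y * star x" by transfer (simp add: tmult_star tensor_eq.refl)
  show "star (star x) = x"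
    by transfer (simp add: multiset.map_comp o_def case_prod_unfold star_star tensor_eq.refl)
  show "star (c *\<^sub>C x) = cnj c *\<^sub>C star x"
    by transfer (simp add: multiset.map_comp o_def case_prod_unfold star_scaleC tensor_eq.refl)
qed

end

lemma pure_tensor_add_left: "(a + a') \<otimes> b = a \<otimes> b + a' \<otimes> b"
  by transfer (use tensor_eq.add_left in \<open>simp add: add_mset_commute\<close>)

lemma pure_tensor_add_right: "a \<otimes> (b + b') = a \<otimes> b + a \<otimes> b'"
  by transfer (use tensor_eq.add_right in \<open>simp add: add_mset_commute\<close>)

lemma pure_tensor_scaleC_left: "(c *\<^sub>C a) \<otimes> b = c *\<^sub>C (a \<otimes> b)"
  by transfer (simp add: tensor_eq.refl)

lemma pure_tensor_scaleC_right: "a \<otimes> (c *\<^sub>C b) = c *\<^sub>C (a \<otimes> b)"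
  by transfer (simp add: tensor_eq.scale tensor_eq.sym)

lemma pure_tensor_mult: "(a \<otimes> b) * (a' \<otimes> b') = (a * a') \<otimes> (b * b')"
  by transfer (simp add: tensor_eq.refl)

lemma star_pure_tensor: "star (a \<otimes> b) = star a \<otimes> star b"
  by transfer (simp add: tensor_eq.refl)

lemma pure_tensor_one: "1 \<otimes> 1 = 1"
  by transfer (simp add: tensor_eq.refl)

lemma pure_tensor_zero_left [simp]: "0 \<otimes> b = 0"
  using pure_tensor_add_left[of 0 0 b] by simp

lemma pure_tensor_zero_right [simp]: "a \<otimes> 0 = 0"
  using pure_tensor_add_right[of a 0 0] by simp

lemma tensor_sum_left: "(\<Sum>i\<in>I. f i) \<otimes> b = (\<Sum>i\<in>I. f i \<otimes> b)"
  by (induction I rule: infinite_finite_induct) (simp_all add: pure_tensor_add_left)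

lemma tensor_sum_right: "a \<otimes> (\<Sum>i\<in>I. f i) = (\<Sum>i\<in>I. a \<otimes> f i)"
  by (induction I rule: infinite_finite_induct) (simp_all add: pure_tensor_add_right)

text \<open>The slice maps \<open>id \<otimes> f\<close> and \<open>f \<otimes> id\<close>; they are given by the formulas of the two lemmas
  below when \<open>f\<close> is linear.\<close>

definition slice_right :: "('b::complex_star_algebra \<Rightarrow> complex) \<Rightarrow>
    ('a::complex_star_algebra, 'b) tensor \<Rightarrow> 'a" where
  "slice_right f t = (\<Sum>(a, b)\<in>#rep_tensor t. f b *\<^sub>C a)"

definition slice_left :: "('a::complex_star_algebra \<Rightarrow> complex) \<Rightarrow>
    ('a, 'b::complex_star_algebra) tensor \<Rightarrow> 'b" where
  "slice_left f t = (\<Sum>(a, b)\<in>#rep_tensor t. f a *\<^sub>C b)"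

lemma slice_right_sum:
  assumes "clinear f"
  shows "slice_right f (\<Sum>i\<in>I. a i \<otimes> b i) = (\<Sum>i\<in>I. f (b i) *\<^sub>C a i)"
proof -
  interpret f: Vector_Spaces.linear scaleC scaleC f by fact
  have eq: "(\<Sum>(a, b)\<in>#s. f b *\<^sub>C a) = (\<Sum>(a, b)\<in>#t. f b *\<^sub>C a)" if "tensor_eq s t" for s t
    using that by induction (simp_all add: f.add f.scale scaleC_add_left scaleC_add_right
        scaleC_scaleC scaleC_complex_def mult.commute)
  have abs: "slice_right f (abs_tensor s) = (\<Sum>(a, b)\<in>#s. f b *\<^sub>C a)" for s
    unfolding slice_right_def
    by (rule eq) (metis Quotient3_rep_abs Quotient3_tensor tensor_eq.refl)
  have add: "slice_right f (s + t) = slice_right f s + slice_right f t" for s t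
    by (induction s; induction t) (simp add: plus_tensor.abs_eq abs)
  have zero: "slice_right f 0 = 0" by (simp add: zero_tensor_def abs)
  have pure: "slice_right f (a \<otimes> b) = f b *\<^sub>C a" for a b by (simp add: pure_tensor.abs_eq abs)
  show ?thesis
    by (induction I rule: infinite_finite_induct) (simp_all add: zero add pure)
qed

lemma slice_left_sum:
  assumes "clinear f"
  shows "slice_left f (\<Sum>i\<in>I. a i \<otimes> b i) = (\<Sum>i\<in>I. f (a i) *\<^sub>C b i)"
proof -
  interpret f: Vector_Spaces.linear scaleC scaleC f by fact
  have f0: "f 0 = 0" by (rule f.zero)
  have eq: "(\<Sum>(a, b)\<in>#s. f a *\<^sub>C b) = (\<Sum>(a, b)\<in>#t. f a *\<^sub>C b)" if "tensor_eq s t" for s t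
    using that by induction (simp_all add: f.add f.scale f0 scaleC_add_left scaleC_add_right
        scaleC_scaleC scaleC_complex_def mult.commute)
  have abs: "slice_left f (abs_tensor s) = (\<Sum>(a, b)\<in>#s. f a *\<^sub>C b)" for s
    unfolding slice_left_def
    by (rule eq) (metis Quotient3_rep_abs Quotient3_tensor tensor_eq.refl)
  have add: "slice_left f (s + t) = slice_left f s + slice_left f t" for s t
    by (induction s; induction t) (simp add: plus_tensor.abs_eq abs)
  have zero: "slice_left f 0 = 0" by (simp add: zero_tensor_def abs)
  have pure: "slice_left f (a \<otimes> b) = f a *\<^sub>C b" for a b by (simp add: pure_tensor.abs_eq abs)
  show ?thesis
    by (induction I rule: infinite_finite_induct) (simp_all add: zero add pure)
qed

section \<open>The universal \<open>*\<close>-algebra \<open>\<O>(U\<^sub>N\<^sup>+)\<close>\<close>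

text \<open>The dimension is \<open>N = CARD('n)\<close>. The algebra is the algebra of terms in the generators
  modulo the smallest congruence that contains the axioms of unital \<open>*\<close>-algebras and the defining
  relations. As terms cannot be summed over an index type, a sum over \<open>k\<close> is written along an
  arbitrary enumeration \<open>ks\<close> of \<open>'n\<close>. The universal property is proved below.\<close>

datatype 'n uterm =
    Gen 'n 'n | Zero | One | Add "'n uterm" "'n uterm" | Mul "'n uterm" "'n uterm"
  | Scale complex "'n uterm" | Star "'n uterm"

definition enumerates :: "'n list \<Rightarrow> bool" where
  "enumerates ks \<longleftrightarrow> distinct ks \<and> set ks = UNIV"

definition Sum :: "'n list \<Rightarrow> ('n \<Rightarrow> 'n uterm) \<Rightarrow> 'n uterm" where
  "Sum ks t = foldr (\<lambda>k. Add (t k)) ks Zero"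

definition Delta :: "'n \<Rightarrow> 'n \<Rightarrow> 'n uterm" where
  "Delta i j = (if i = j then One else Zero)"

inductive uterm_eq :: "'n uterm \<Rightarrow> 'n uterm \<Rightarrow> bool" where
  refl: "uterm_eq s s"
| sym: "uterm_eq s t \<Longrightarrow> uterm_eq t s"
| trans: "uterm_eq r s \<Longrightarrow> uterm_eq s t \<Longrightarrow> uterm_eq r t"
| cong_Add: "uterm_eq s s' \<Longrightarrow> uterm_eq t t' \<Longrightarrow> uterm_eq (Add s t) (Add s' t')"
| cong_Mul: "uterm_eq s s' \<Longrightarrow> uterm_eq t t' \<Longrightarrow> uterm_eq (Mul s t) (Mul s' t')"
| cong_Scale: "uterm_eq s s' \<Longrightarrow> uterm_eq (Scale c s) (Scale c s')"
| cong_Star: "uterm_eq s s' \<Longrightarrow> uterm_eq (Star s) (Star s')"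
| Add_assoc: "uterm_eq (Add (Add r s) t) (Add r (Add s t))"
| Add_comm: "uterm_eq (Add s t) (Add t s)"
| Add_Zero: "uterm_eq (Add Zero s) s"
| Scale_zero: "uterm_eq (Scale 0 s) Zero"
| Scale_one: "uterm_eq (Scale 1 s) s"
| Scale_Scale: "uterm_eq (Scale c (Scale d s)) (Scale (c * d) s)"
| Scale_add: "uterm_eq (Scale (c + d) s) (Add (Scale c s) (Scale d s))"
| Scale_Add: "uterm_eq (Scale c (Add s t)) (Add (Scale c s) (Scale c t))"
| Mul_assoc: "uterm_eq (Mul (Mul r s) t) (Mul r (Mul s t))"
| Mul_One_left: "uterm_eq (Mul One s) s"
| Mul_One_right: "uterm_eq (Mul s One) s"
| Mul_Add_left: "uterm_eq (Mul (Add r s) t) (Add (Mul r t) (Mul s t))"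
| Mul_Add_right: "uterm_eq (Mul r (Add s t)) (Add (Mul r s) (Mul r t))"
| Mul_Scale_left: "uterm_eq (Mul (Scale c s) t) (Scale c (Mul s t))"
| Mul_Scale_right: "uterm_eq (Mul s (Scale c t)) (Scale c (Mul s t))"
| Star_Add: "uterm_eq (Star (Add s t)) (Add (Star s) (Star t))"
| Star_Scale: "uterm_eq (Star (Scale c s)) (Scale (cnj c) (Star s))"
| Star_Mul: "uterm_eq (Star (Mul s t)) (Mul (Star t) (Star s))"
| Star_Star: "uterm_eq (Star (Star s)) s"
| rel1: "enumerates ks \<Longrightarrow> uterm_eq (Sum ks (\<lambda>k. Mul (Gen i k) (Star (Gen j k)))) (Delta i j)"
| rel2: "enumerates ks \<Longrightarrow> uterm_eq (Sum ks (\<lambda>k. Mul (Star (Gen k i)) (Gen k j))) (Delta i j)"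
| rel3: "enumerates ks \<Longrightarrow> uterm_eq (Sum ks (\<lambda>k. Mul (Star (Gen i k)) (Gen j k))) (Delta i j)"
| rel4: "enumerates ks \<Longrightarrow> uterm_eq (Sum ks (\<lambda>k. Mul (Gen k i) (Star (Gen k j)))) (Delta i j)"

quotient_type 'n free_unitary = "'n uterm" / uterm_eq
  by (intro equivpI reflpI sympI transpI) (blast intro: uterm_eq.refl uterm_eq.sym uterm_eq.trans)+

lift_definition ugen :: "'n \<Rightarrow> 'n \<Rightarrow> 'n free_unitary" is Gen .

instantiation free_unitary :: (type) complex_star_algebra
begin

lift_definition zero_free_unitary :: "'a free_unitary" is Zero .

lift_definition one_free_unitary :: "'a free_unitary" is One .

lift_definition plus_free_unitary :: "'a free_unitary \<Rightarrow> 'a free_unitary \<Rightarrow> 'a free_unitary"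
  is Add by (rule uterm_eq.cong_Add)

lift_definition times_free_unitary :: "'a free_unitary \<Rightarrow> 'a free_unitary \<Rightarrow> 'a free_unitary"
  is Mul by (rule uterm_eq.cong_Mul)

lift_definition scaleC_free_unitary :: "complex \<Rightarrow> 'a free_unitary \<Rightarrow> 'a free_unitary"
  is Scale by (rule uterm_eq.cong_Scale)

lift_definition star_free_unitary :: "'a free_unitary \<Rightarrow> 'a free_unitary"
  is Star by (rule uterm_eq.cong_Star)

definition uminus_free_unitary :: "'a free_unitary \<Rightarrow> 'a free_unitary" where
  "uminus_free_unitary x = (- 1) *\<^sub>C x"

definition minus_free_unitary :: "'a free_unitary \<Rightarrow> 'a free_unitary \<Rightarrow> 'a free_unitary" where
  "minus_free_unitary x y = x + (- y)"

instance
proof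
  fix x y z :: "'a free_unitary" and c d :: complex
  show "x + y + z = x + (y + z)" by transfer (rule uterm_eq.Add_assoc)
  show "x + y = y + x" by transfer (rule uterm_eq.Add_comm)
  show "0 + x = x" by transfer (rule uterm_eq.Add_Zero)
  have one: "1 *\<^sub>C x = x" by transfer (rule uterm_eq.Scale_one)
  have add: "(c + d) *\<^sub>C x = c *\<^sub>C x + d *\<^sub>C x" for c d by transfer (rule uterm_eq.Scale_add)
  have "0 *\<^sub>C x = 0" by transfer (rule uterm_eq.Scale_zero)
  with add[of "- 1" 1] one show "- x + x = 0" by (simp add: uminus_free_unitary_def)
  show "x - y = x + - y" by (simp add: minus_free_unitary_def)
  show "x * y * z = x * (y * z)" by transfer (rule uterm_eq.Mul_assoc)
  show "(x + y) * z = x * z + y * z" by transfer (rule uterm_eq.Mul_Add_left)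
  show "x * (y + z) = x * y + x * z" by transfer (rule uterm_eq.Mul_Add_right)
  show "1 * x = x" by transfer (rule uterm_eq.Mul_One_left)
  show "x * 1 = x" by transfer (rule uterm_eq.Mul_One_right)
  show "c *\<^sub>C (x + y) = c *\<^sub>C x + c *\<^sub>C y" by transfer (rule uterm_eq.Scale_Add)
  show "(c + d) *\<^sub>C x = c *\<^sub>C x + d *\<^sub>C x" by (rule add)
  show "c *\<^sub>C d *\<^sub>C x = (c * d) *\<^sub>C x" by transfer (rule uterm_eq.Scale_Scale)
  show "1 *\<^sub>C x = x" by (rule one)
  show "(c *\<^sub>C x) * y = c *\<^sub>C (x * y)" by transfer (rule uterm_eq.Mul_Scale_left)
  show "x * (c *\<^sub>C y) = c *\<^sub>C (x * y)" by transfer (rule uterm_eq.Mul_Scale_right)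
  show "star (x + y) = star x + star y" by transfer (rule uterm_eq.Star_Add)
  show "star (x * y) = star y * star x" by transfer (rule uterm_eq.Star_Mul)
  show "star (star x) = x" by transfer (rule uterm_eq.Star_Star)
  show "star (c *\<^sub>C x) = cnj c *\<^sub>C star x" by transfer (rule uterm_eq.Star_Scale)
qed

end

definition biunitary :: "('n::finite \<Rightarrow> 'n \<Rightarrow> 'a::complex_star_algebra) \<Rightarrow> bool" where
  "biunitary v \<longleftrightarrow> (\<forall>i j.
      (\<Sum>k\<in>UNIV. v i k * star (v j k)) = (if i = j then 1 else 0) \<and>
      (\<Sum>k\<in>UNIV. star (v k i) * v k j) = (if i = j then 1 else 0) \<and>
      (\<Sum>k\<in>UNIV. star (v i k) * v j k) = (if i = j then 1 else 0) \<and>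
      (\<Sum>k\<in>UNIV. v k i * star (v k j)) = (if i = j then 1 else 0))"

primrec uterm_eval :: "('n \<Rightarrow> 'n \<Rightarrow> 'a::complex_star_algebra) \<Rightarrow> 'n uterm \<Rightarrow> 'a" where
  "uterm_eval v (Gen i j) = v i j"
| "uterm_eval v Zero = 0"
| "uterm_eval v One = 1"
| "uterm_eval v (Add s t) = uterm_eval v s + uterm_eval v t"
| "uterm_eval v (Mul s t) = uterm_eval v s * uterm_eval v t"
| "uterm_eval v (Scale c s) = c *\<^sub>C uterm_eval v s"
| "uterm_eval v (Star s) = star (uterm_eval v s)"

text \<open>For a biunitary family \<open>v\<close>, \<open>ulift v\<close> is the unique unital \<open>*\<close>-homomorphism that maps
  \<open>ugen i j\<close> to \<open>v i j\<close>.\<close>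

definition ulift :: "('n \<Rightarrow> 'n \<Rightarrow> 'a::complex_star_algebra) \<Rightarrow> 'n free_unitary \<Rightarrow> 'a" where
  "ulift v x = uterm_eval v (rep_free_unitary x)"

lemma uterm_eval_Sum:
  assumes "enumerates ks"
  shows "uterm_eval v (Sum ks t) = (\<Sum>k\<in>UNIV. uterm_eval v (t k))"
proof -
  have "uterm_eval v (Sum ks t) = (\<Sum>k\<leftarrow>ks. uterm_eval v (t k))"
    unfolding Sum_def by (induction ks) auto
  with assms show ?thesis by (simp add: enumerates_def sum_list_distinct_conv_sum_set)
qed

lemma uterm_eval_eq:
  assumes "uterm_eq s t" "biunitary v"
  shows "uterm_eval v s = uterm_eval v t"
  using assms
  by induction (auto simp: uterm_eval_Sum Delta_def biunitary_def algebra_simps scaleC_add_left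
      scaleC_add_right scaleC_scaleC scaleC_one mult_scaleC_left mult_scaleC_right star_add star_mult
      star_scaleC star_star)

lemma abs_Sum:
  assumes "enumerates ks"
  shows "abs_free_unitary (Sum ks t) = (\<Sum>k\<in>UNIV. abs_free_unitary (t k))"
proof -
  have "abs_free_unitary (Sum ks t) = (\<Sum>k\<leftarrow>ks. abs_free_unitary (t k))"
    unfolding Sum_def
    by (induction ks) (simp_all add: zero_free_unitary_def plus_free_unitary.abs_eq[symmetric])
  with assms show ?thesis by (simp add: enumerates_def sum_list_distinct_conv_sum_set)
qed

lemma biunitary_ugen: "biunitary (ugen :: 'n::finite \<Rightarrow> 'n \<Rightarrow> 'n free_unitary)"
proof -
  obtain ks :: "'n list" where ks: "enumerates ks"
    unfolding enumerates_def using finite_distinct_list[OF finite[of "UNIV :: 'n set"]] by auto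
  have D: "abs_free_unitary (Delta i j) = (if i = j then 1 else 0)" for i j :: 'n
    by (simp add: Delta_def one_free_unitary_def zero_free_unitary_def)
  note ops = ugen.abs_eq star_free_unitary.abs_eq times_free_unitary.abs_eq
  note rels = uterm_eq.rel1[OF ks] uterm_eq.rel2[OF ks] uterm_eq.rel3[OF ks] uterm_eq.rel4[OF ks]
  have "abs_free_unitary s = abs_free_unitary t" if "uterm_eq s t" for s t :: "'n uterm"
    using that by (simp add: free_unitary.abs_eq_iff)
  note rels' = rels[THEN this, unfolded abs_Sum[OF ks] D]
  show ?thesis unfolding biunitary_def ops using rels' by simp
qed

lemma ulift_abs:
  assumes "biunitary v"
  shows "ulift v (abs_free_unitary s) = uterm_eval v s"
  unfolding ulift_def
  by (rule uterm_eval_eq[OF _ assms]) (metis Quotient3_rep_abs Quotient3_free_unitary uterm_eq.refl)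

lemma ulift_ugen:
  assumes "biunitary v"
  shows "ulift v (ugen i j) = v i j"
  by (simp add: ugen.abs_eq ulift_abs[OF assms])

lemma star_hom_ulift:
  assumes "biunitary v"
  shows "star_hom (ulift v)"
proof -
  note L = ulift_abs[OF assms]
  have "ulift v (x + y) = ulift v x + ulift v y" "ulift v (x * y) = ulift v x * ulift v y"
    "ulift v (c *\<^sub>C x) = c *\<^sub>C ulift v x" "ulift v (star x) = star (ulift v x)" for x y c
    by (induction x; induction y; simp add: L plus_free_unitary.abs_eq times_free_unitary.abs_eq
        scaleC_free_unitary.abs_eq star_free_unitary.abs_eq)+
  moreover have "ulift v 1 = 1" by (simp add: one_free_unitary_def L)
  ultimately show ?thesis
    by (auto simp: star_hom_def intro!: Vector_Spaces.linear.intro module_hom.intro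
        module_hom_axioms.intro cvec.vector_space_axioms
        cvec.module_axioms)
qed

lemma star_hom_unique:
  fixes \<phi> \<psi> :: "'n free_unitary \<Rightarrow> 'a::complex_star_algebra"
  assumes "star_hom \<phi>" "star_hom \<psi>" "\<And>i j. \<phi> (ugen i j) = \<psi> (ugen i j)"
  shows "\<phi> = \<psi>"
proof
  interpret f: Vector_Spaces.linear scaleC scaleC \<phi> using assms by (simp add: star_hom_def)
  interpret g: Vector_Spaces.linear scaleC scaleC \<psi> using assms by (simp add: star_hom_def)
  fix x :: "'n free_unitary"
  obtain s where x: "x = abs_free_unitary s" by (induction x) auto
  have "\<phi> (abs_free_unitary s) = \<psi> (abs_free_unitary s)"
  proof (induction s)
    case (Gen i j)
    show ?case using assms(3)[of i j] by (simp add: ugen.abs_eq)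
  next
    case Zero
    show ?case using f.zero g.zero by (simp add: zero_free_unitary_def)
  next
    case One
    show ?case using assms by (simp add: star_hom_def one_free_unitary_def)
  next
    case (Add s t)
    then show ?case by (simp add: plus_free_unitary.abs_eq[symmetric] f.add g.add)
  next
    case (Mul s t)
    then show ?case using assms by (simp add: star_hom_def times_free_unitary.abs_eq[symmetric])
  next
    case (Scale c s)
    then show ?case by (simp add: scaleC_free_unitary.abs_eq[symmetric] f.scale g.scale)
  next
    case (Star s)
    then show ?case using assms by (simp add: star_hom_def star_free_unitary.abs_eq[symmetric])
  qed
  then show "\<phi> x = \<psi> x" by (simp add: x)
qed

section \<open>Quantum group structure, Haar state and central algebra\<close>

definition counit :: "'n::finite free_unitary \<Rightarrow> complex" where
  "counit = ulift (\<lambda>i j. if i = j then 1 else 0)"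

definition coproduct :: "'n::finite free_unitary \<Rightarrow> ('n free_unitary, 'n free_unitary) tensor" where
  "coproduct = ulift (\<lambda>i j. \<Sum>k\<in>UNIV. ugen i k \<otimes> ugen k j)"

lemma biunitary_delta: "biunitary (\<lambda>i j :: 'n::finite. if i = j then 1 else 0 :: complex)"
  by (auto simp: biunitary_def star_complex_def if_distrib[of cnj] if_distrib[of "\<lambda>x. x * _"]
      cong: if_cong)

lemma star_zero [simp]: "star (0 :: 'a::complex_star_algebra) = 0"
  using star_add[of "0::'a" 0] by simp

lemma star_sum: "star (\<Sum>i\<in>I. f i) = (\<Sum>i\<in>I. star (f i))" for f :: "'i \<Rightarrow> 'a::complex_star_algebra"
  by (induction I rule: infinite_finite_induct) (simp_all add: star_add)

lemma biunitary_coproduct: "biunitary (\<lambda>i j :: 'n::finite. \<Sum>k\<in>UNIV. ugen i k \<otimes> ugen k j)"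
proof -
  note B = biunitary_ugen[where 'n = 'n, unfolded biunitary_def, rule_format]
  have contract: "(\<Sum>k\<in>UNIV. \<Sum>l\<in>UNIV. \<Sum>m\<in>UNIV. p l m \<otimes> q k l m) = (if a then 1 else 0)"
    if "\<And>l m. (\<Sum>k\<in>UNIV. q k l m) = (if l = m then 1 else 0)"
      and "(\<Sum>l\<in>UNIV. p l l) = (if a then 1 else 0)"
    for p :: "'n \<Rightarrow> 'n \<Rightarrow> 'n free_unitary" and q :: "'n \<Rightarrow> 'n \<Rightarrow> 'n \<Rightarrow> 'n free_unitary" and a
  proof -
    have "(\<Sum>k\<in>UNIV. \<Sum>l\<in>UNIV. \<Sum>m\<in>UNIV. p l m \<otimes> q k l m) =
        (\<Sum>l\<in>UNIV. \<Sum>m\<in>UNIV. p l m \<otimes> (\<Sum>k\<in>UNIV. q k l m))"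
      by (subst sum.swap, rule sum.cong, simp, subst sum.swap) (simp add: tensor_sum_right)
    also have "\<dots> = (\<Sum>l\<in>UNIV. p l l) \<otimes> 1"
      by (simp add: that(1) if_distrib[of "\<lambda>x. _ \<otimes> x"] tensor_sum_left cong: if_cong)
    finally show ?thesis by (simp add: that(2) pure_tensor_one)
  qed
  have contract': "(\<Sum>k\<in>UNIV. \<Sum>l\<in>UNIV. \<Sum>m\<in>UNIV. q k l m \<otimes> p l m) = (if a then 1 else 0)"
    if "\<And>l m. (\<Sum>k\<in>UNIV. q k l m) = (if l = m then 1 else 0)"
      and "(\<Sum>l\<in>UNIV. p l l) = (if a then 1 else 0)"
    for p :: "'n \<Rightarrow> 'n \<Rightarrow> 'n free_unitary" and q :: "'n \<Rightarrow> 'n \<Rightarrow> 'n \<Rightarrow> 'n free_unitary" and a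
  proof -
    have "(\<Sum>k\<in>UNIV. \<Sum>l\<in>UNIV. \<Sum>m\<in>UNIV. q k l m \<otimes> p l m) =
        (\<Sum>l\<in>UNIV. \<Sum>m\<in>UNIV. (\<Sum>k\<in>UNIV. q k l m) \<otimes> p l m)"
      by (subst sum.swap, rule sum.cong, simp, subst sum.swap) (simp add: tensor_sum_left)
    also have "\<dots> = 1 \<otimes> (\<Sum>l\<in>UNIV. p l l)"
      by (simp add: that(1) if_distrib[of "\<lambda>x. x \<otimes> _"] tensor_sum_right cong: if_cong)
    finally show ?thesis by (simp add: that(2) pure_tensor_one)
  qed
  show ?thesis
    unfolding biunitary_def
    by (intro allI conjI; simp only: star_sum sum_product star_pure_tensor pure_tensor_mult;
        (rule contract contract'; simp add: B))
qed

lemma star_hom_counit: "star_hom counit" and counit_ugen: "counit (ugen i j) = (if i = j then 1 else 0)"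
  unfolding counit_def by (simp_all add: star_hom_ulift ulift_ugen biunitary_delta)

lemma star_hom_coproduct: "star_hom coproduct"
  and coproduct_ugen: "coproduct (ugen i j) = (\<Sum>k\<in>UNIV. ugen i k \<otimes> ugen k j)"
  unfolding coproduct_def by (simp_all add: star_hom_ulift ulift_ugen biunitary_coproduct)

text \<open>A state that is left and right invariant. The Haar state exists and is unique.\<close>

definition haar_state :: "('n::finite free_unitary \<Rightarrow> complex) \<Rightarrow> bool" where
  "haar_state h \<longleftrightarrow> clinear h \<and> h 1 = 1 \<and> (\<forall>x. h (star x * x) \<ge> 0) \<and>
    (\<forall>x. slice_right h (coproduct x) = h x *\<^sub>C 1) \<and>
    (\<forall>x. slice_left h (coproduct x) = h x *\<^sub>C 1)"

definition representation :: "nat \<Rightarrow> (nat \<Rightarrow> nat \<Rightarrow> 'n::finite free_unitary) \<Rightarrow> bool" where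
  "representation d v \<longleftrightarrow> (\<forall>i<d. \<forall>j<d.
      coproduct (v i j) = (\<Sum>k<d. v i k \<otimes> v k j) \<and> counit (v i j) = (if i = j then 1 else 0))"

inductive_set central_algebra :: "'n::finite free_unitary set" where
  character: "representation d v \<Longrightarrow> (\<Sum>i<d. v i i) \<in> central_algebra"
| add: "x \<in> central_algebra \<Longrightarrow> y \<in> central_algebra \<Longrightarrow> x + y \<in> central_algebra"
| scaleC: "x \<in> central_algebra \<Longrightarrow> c *\<^sub>C x \<in> central_algebra"
| mult: "x \<in> central_algebra \<Longrightarrow> y \<in> central_algebra \<Longrightarrow> x * y \<in> central_algebra"

text \<open>The orthogonal projection onto the central algebra for \<open>\<langle>x, y\<rangle> = h (x y\<^sup>*)\<close>.\<close>

definition central_expectation ::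
    "('n::finite free_unitary \<Rightarrow> complex) \<Rightarrow> ('n free_unitary \<Rightarrow> 'n free_unitary) \<Rightarrow> bool" where
  "central_expectation h E \<longleftrightarrow> clinear E \<and> range E \<subseteq> central_algebra \<and>
    (\<forall>x\<in>central_algebra. E x = x) \<and>
    (\<forall>x. \<forall>y\<in>central_algebra. h ((x - E x) * star y) = 0)"

datatype letter = Lozenge | Bullet

fun chi_letter :: "letter \<Rightarrow> 'n::finite free_unitary" where
  "chi_letter Lozenge = (\<Sum>i\<in>UNIV. ugen i i)"
| "chi_letter Bullet = (\<Sum>i\<in>UNIV. star (ugen i i))"

definition chi :: "letter list \<Rightarrow> 'n::finite free_unitary" where
  "chi w = prod_list (map chi_letter w)"

section \<open>Generating functionals\<close>

definition generating_functional :: "('n::finite free_unitary \<Rightarrow> complex) \<Rightarrow> bool" where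
  "generating_functional L \<longleftrightarrow> clinear L \<and> (\<forall>x. L (star x) = cnj (L x)) \<and> L 1 = 0 \<and>
    (\<forall>x. counit x = 0 \<longrightarrow> L (star x * x) \<ge> 0)"

definition central_functional ::
    "('n free_unitary \<Rightarrow> 'n free_unitary) \<Rightarrow> ('n free_unitary \<Rightarrow> complex) \<Rightarrow> bool" where
  "central_functional E L \<longleftrightarrow> L = L \<circ> E"

definition gaussian :: "('n::finite free_unitary \<Rightarrow> complex) \<Rightarrow> bool" where
  "gaussian L \<longleftrightarrow> generating_functional L \<and> (\<forall>x y z.
     L (x * y * z) = L (x * y) * counit z + L (x * z) * counit y + L (y * z) * counit x
       - counit (x * y) * L z - counit (x * z) * L y - counit (y * z) * L x)"

definition L_value :: "nat \<Rightarrow> real \<Rightarrow> real \<Rightarrow> letter list \<Rightarrow> real" where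
  "L_value N \<alpha> \<beta> w =
    - (real (length w) * \<alpha> + (real (count_list w Lozenge) - real (count_list w Bullet))\<^sup>2 * \<beta>)
      * real N powi (int (length w) - 1)"

text \<open>For the empty word the first factor of \<^const>\<open>L_value\<close> is \<open>0\<close>. \<open>L_functional E \<alpha> \<beta>\<close> is meaningful once there is exactly one functional as specified.\<close>

definition L_spec :: "('n::finite free_unitary \<Rightarrow> 'n free_unitary) \<Rightarrow> real \<Rightarrow> real
    \<Rightarrow> ('n free_unitary \<Rightarrow> complex) \<Rightarrow> bool" where
  "L_spec E \<alpha> \<beta> L \<longleftrightarrow> clinear L \<and> central_functional E L \<and>
    (\<forall>w. L (chi w) = complex_of_real (L_value CARD('n) \<alpha> \<beta> w))"

definition L_functional :: "('n::finite free_unitary \<Rightarrow> 'n free_unitary) \<Rightarrow> real \<Rightarrow> real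
    \<Rightarrow> 'n free_unitary \<Rightarrow> complex" where
  "L_functional E \<alpha> \<beta> = (THE L. L_spec E \<alpha> \<beta> L)"

section \<open>The classical unitary group\<close>

definition adjoint_matrix :: "complex^'n^'n \<Rightarrow> complex^'n^'n" where
  "adjoint_matrix A = (\<chi> i j. cnj (A $ j $ i))"

definition unitary_group :: "(complex^'n::finite^'n) set" where
  "unitary_group = {g. g ** adjoint_matrix g = mat 1 \<and> adjoint_matrix g ** g = mat 1}"

definition lie_u :: "(complex^'n::finite^'n) set" where
  "lie_u = {X. adjoint_matrix X = - X}"

definition lie_su :: "(complex^'n::finite^'n) set" where
  "lie_su = {X \<in> lie_u. trace X = 0}"

text \<open>Functions on the unitary group are extended by \<open>0\<close> to all matrices. On a unitary \<open>g\<close>, the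
  map \<open>x \<mapsto> restrict_classical x g\<close> is the character of the algebra given by the entries of \<open>g\<close>.\<close>

definition restrict_classical :: "'n::finite free_unitary \<Rightarrow> complex^'n^'n \<Rightarrow> complex" where
  "restrict_classical x = (\<lambda>g. if g \<in> unitary_group then ulift (\<lambda>i j. g $ i $ j) x else 0)"

lemma biunitary_unitary_group:
  assumes "g \<in> unitary_group"
  shows "biunitary (\<lambda>i j. g $ i $ j)"
proof -
  have 1: "(\<Sum>k\<in>UNIV. g $ i $ k * cnj (g $ j $ k)) = (if i = j then 1 else 0)"
    and 2: "(\<Sum>k\<in>UNIV. cnj (g $ k $ i) * g $ k $ j) = (if i = j then 1 else 0)" for i j
    using assms
    by (auto simp: unitary_group_def matrix_matrix_mult_def adjoint_matrix_def mat_def vec_eq_iff)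
  have 3: "(\<Sum>k\<in>UNIV. cnj (g $ i $ k) * g $ j $ k) = (if i = j then 1 else 0)"
    and 4: "(\<Sum>k\<in>UNIV. g $ k $ i * cnj (g $ k $ j)) = (if i = j then 1 else 0)" for i j
    using 1[of j i] 2[of j i] by (simp_all add: mult.commute eq_commute)
  show ?thesis unfolding biunitary_def star_complex_def using 1 2 3 4 by blast
qed

lemma restrict_classical_ugen: "g \<in> unitary_group \<Longrightarrow> restrict_classical (ugen i j) g = g $ i $ j"
  by (simp add: restrict_classical_def ulift_ugen biunitary_unitary_group)

primrec matrix_power :: "complex^'n::finite^'n \<Rightarrow> nat \<Rightarrow> complex^'n^'n" where
  "matrix_power A 0 = mat 1"
| "matrix_power A (Suc k) = A ** matrix_power A k"

definition matrix_exp :: "complex^'n::finite^'n \<Rightarrow> complex^'n^'n" where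
  "matrix_exp A = (\<Sum>k. (1 / fact k) *\<^sub>R matrix_power A k)"

definition lie_derivative ::
    "complex^'n::finite^'n \<Rightarrow> (complex^'n^'n \<Rightarrow> complex) \<Rightarrow> complex^'n^'n \<Rightarrow> complex" where
  "lie_derivative X f x = vector_derivative (\<lambda>t. f (x ** matrix_exp (t *\<^sub>R X))) (at 0)"

definition lie_u_basis :: "(nat \<Rightarrow> complex^'n::finite^'n) \<Rightarrow> bool" where
  "lie_u_basis X \<longleftrightarrow>
    (\<forall>i\<in>{1..CARD('n)\<^sup>2}. \<forall>j\<in>{1..CARD('n)\<^sup>2}. - trace (X i ** X j) = (if i = j then 1 else 0)) \<and>
    span (X ` {1..CARD('n)\<^sup>2}) = lie_u \<and>
    span (X ` {1..<CARD('n)\<^sup>2}) = lie_su \<and>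
    X (CARD('n)\<^sup>2) = mat (\<i> / complex_of_real (sqrt (real CARD('n))))"

definition laplace_beltrami ::
    "(nat \<Rightarrow> complex^'n::finite^'n) \<Rightarrow> (complex^'n^'n \<Rightarrow> complex) \<Rightarrow> complex" where
  "laplace_beltrami X f =
    (\<Sum>i=1..CARD('n)\<^sup>2. lie_derivative (X i) (lie_derivative (X i) f) (mat 1))"

end

(* The orthogonal projections K_w onto the spans NC(w) of the noncrossing pairings of words w
   are compatible with the defining relations, because inserting a pair of neighbouring letters
   and its adjoint preserve these spans. Hence u^w |-> K_w extends to a linear functional, and
   comparing it with the Haar state h gives h(u^w_IJ) = K_w(I, J), without Tannaka-Krein duality.
   It follows that h is a faithful trace, that averaging over the adjoint action maps into the
   span of the chi_w, and so that this span is the central algebra and that the average is E.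
   For a character phi the traciality of h gives phi(E(x* x)) = h(t* t) >= 0 with
   t = x_1 phi(x_2) S(x_3). Along a one-parameter subgroup of U_N the nonnegative function
   t |-> phi_t(E(x* x)) vanishes at 0 if eps(x) = 0, so that its second derivative there is
   nonnegative: L o E is a generating functional for L = X^2, X in u_N. Conversely a Gaussian
   functional kills products of three elements of ker(eps), and u + u* - 2 is a sum of products of two;
   this leaves two parameters for the values L(chi_w). *)
theory Submission
  imports Defs
begin

section \<open>Monomials in the generators\<close>

text \<open>\<open>h\<close> and \<open>E\<close> are known only through their axioms, so the values
  of \<open>h\<close> on monomials must be computed before anything can be said about
  \<open>E\<close>. The obstacle is the positivity of L o E: \<open>E\<close> is not multiplicative,
  and L controls x* x only for x in the kernel of the counit. Characters of U_N enter because each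
  of them stays positive after \<open>E\<close>, and a curve of characters through the counit turns
  this into a statement about second derivatives. A single diagonal X in u_N per pair (alpha, beta)
  is enough; X^2 o E then also shows that values prescribed on the possibly dependent-looking family
  chi_w do come from a functional. The constants of the converse arise as follows. Writing each
  letter as N + x gives L(chi_w) = n a N^(n-1) - c N^(n-2) S, where S is the sum of s_i s_j over i <
  j, that is ((p-q)^2 - n)/2. Hence beta = c/(2N) and alpha = -a - c/(2N); alpha is nonnegative by a
  variance inequality for the diagonal entries.\<close>

fun flip :: "letter \<Rightarrow> letter" where
  "flip Lozenge = Bullet"
| "flip Bullet = Lozenge"

lemma flip_flip [simp]: "flip (flip c) = c"
  by (cases c) auto

fun ug :: "letter \<Rightarrow> 'n::finite \<Rightarrow> 'n \<Rightarrow> 'n free_unitary" where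
  "ug Lozenge i j = ugen i j"
| "ug Bullet i j = star (ugen i j)"

lemma star_ug: "star (ug c i j) = ug (flip c) i j"
  by (cases c) (auto simp: star_star)

text \<open>With a letter and its flip treated alike, the four defining relations become two: this
  one covers \<open>rel1\<close> and \<open>rel3\<close>, and \<open>ug_rows\<close> covers
  \<open>rel2\<close> and \<open>rel4\<close>.\<close>

lemma ug_cols: "(\<Sum>k\<in>UNIV. ug c i k * ug (flip c) j k) = (if i = j then 1 else 0)"
  using biunitary_ugen[unfolded biunitary_def, rule_format, of i j] by (cases c) auto

lemma ug_rows: "(\<Sum>k\<in>UNIV. ug c k i * ug (flip c) k j) = (if i = j then 1 else 0)"
  using biunitary_ugen[unfolded biunitary_def, rule_format, of i j] by (cases c) auto

text \<open>Multi-indices are lists, so that cutting a word in two cuts the sum over its indices by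
  append.\<close>

definition idx :: "nat \<Rightarrow> 'n list set" where
  "idx n = {I. length I = n}"

lemma idx_0 [simp]: "idx 0 = {[]}"
  by (auto simp: idx_def)

lemma in_idx [simp]: "I \<in> idx n \<longleftrightarrow> length I = n"
  by (auto simp: idx_def)

lemma finite_idx [simp]: "finite (idx n :: 'n::finite list set)"
  using finite_lists_length_eq[of "UNIV :: 'n set" n] by (simp add: idx_def)

lemma sum_idx_Suc:
  "(\<Sum>I\<in>idx (Suc n). f I) = (\<Sum>i\<in>UNIV. \<Sum>I\<in>idx n. f (i # I))"
  for f :: "'n::finite list \<Rightarrow> 'b::comm_monoid_add"
proof -
  have "(\<Sum>i\<in>UNIV. \<Sum>I\<in>idx n. f (i # I)) = (\<Sum>(i, I)\<in>UNIV \<times> idx n. f (i # I))"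
    by (rule sum.cartesian_product)
  also have "\<dots> = (\<Sum>I\<in>idx (Suc n). f I)"
    by (rule sum.reindex_bij_witness[of _ "\<lambda>I. (hd I, tl I)" "\<lambda>(i, I). i # I"])
      (auto simp: length_Suc_conv)
  finally show ?thesis by simp
qed

lemma sum_idx_add:
  "(\<Sum>I\<in>idx (m + n). f I) = (\<Sum>K\<in>idx m. \<Sum>L\<in>idx n. f (K @ L))"
  for f :: "'n::finite list \<Rightarrow> 'b::comm_monoid_add"
  by (induction m arbitrary: f) (simp_all add: sum_idx_Suc)

lemma sum_idx_snoc:
  "(\<Sum>I\<in>idx (length (w @ [c])). f I) = (\<Sum>I\<in>idx (length w). \<Sum>i\<in>UNIV. f (I @ [i]))"
  for f :: "'n::finite list \<Rightarrow> 'b::comm_monoid_add"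
  using sum_idx_add[where f = f and m = "length w" and n = "Suc 0"] by (simp add: sum_idx_Suc[of _ 0])

lemma sum_idx_rev: "(\<Sum>I\<in>idx n. f (rev I)) = (\<Sum>I\<in>idx n. f I)"
  by (rule sum.reindex_bij_witness[of _ rev rev]) auto

definition gmon :: "(letter \<times> 'n \<times> 'n) list \<Rightarrow> 'n::finite free_unitary" where
  "gmon m = prod_list (map (\<lambda>(c, i, j). ug c i j) m)"

lemma gmon_simps [simp]:
  "gmon [] = 1" "gmon ((c, i, j) # m) = ug c i j * gmon m" "gmon (m @ m') = gmon m * gmon m'"
  by (simp_all add: gmon_def)

text \<open>The matrix coefficient at (I, J) of the tensor product of copies of u and of its
  conjugate prescribed by \<open>w\<close>.\<close>

definition um :: "letter list \<Rightarrow> 'n list \<Rightarrow> 'n list \<Rightarrow> 'n::finite free_unitary" where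
  "um w I J = gmon (zip w (zip I J))"

lemma um_simps [simp]:
  "um [] I J = 1" "um (c # w) (i # I) (j # J) = ug c i j * um w I J"
  by (simp_all add: um_def)

lemma um_append:
  "length I = length w \<Longrightarrow> length J = length w \<Longrightarrow>
    um (w @ w') (I @ I') (J @ J') = um w I J * um w' I' J'"
  by (simp add: um_def)

lemma length_induct3 [consumes 2, case_names Nil Cons]:
  assumes "length I = length w" "length J = length w" "P [] [] []"
    and "\<And>c w i I j J. length I = length w \<Longrightarrow> length J = length w \<Longrightarrow> P w I J \<Longrightarrow>
      P (c # w) (i # I) (j # J)"
  shows "P w I J"
  using assms(1,2)
proof (induction w arbitrary: I J)
  case Nil
  then show ?case using assms(3) by simp
next
  case (Cons c w)
  then show ?case using assms(4) by (auto simp: length_Suc_conv)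
qed

lemma gmon_eq_um: "gmon m = um (map fst m) (map (fst \<circ> snd) m) (map (snd \<circ> snd) m)"
  by (induction m) auto

definition bar :: "letter list \<Rightarrow> letter list" where
  "bar w = rev (map flip w)"

lemma bar_simps [simp]:
  "bar [] = []" "bar (c # w) = bar w @ [flip c]" "bar (w @ w') = bar w' @ bar w"
  "length (bar w) = length w" "bar (bar w) = w"
  by (simp_all add: bar_def rev_map comp_def)

lemma star_um:
  assumes "length I = length w" "length J = length w"
  shows "star (um w I J) = um (bar w) (rev I) (rev J)"
  using assms
  by (induction rule: length_induct3) (simp_all add: star_one star_mult um_append star_ug)

text \<open>The star reverses the factors, so the product over \<open>w\<close> stands innermost;
  the induction hypothesis makes it a scalar before \<open>ug_cols\<close> is applied to the outer
  letter.\<close>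

lemma um_cols:
  assumes "length I = length w" "length J = length w"
  shows "(\<Sum>K\<in>idx (length w). um w I K * star (um w J K)) = (if I = J then 1 else 0)"
  using assms
proof (induction rule: length_induct3)
  case (Cons c w i I j J)
  have "(\<Sum>K\<in>idx (length (c # w)). um (c # w) (i # I) K * star (um (c # w) (j # J) K)) =
     (\<Sum>k\<in>UNIV. ug c i k * (\<Sum>K\<in>idx (length w). um w I K * star (um w J K)) * ug (flip c) j k)"
    by (simp add: sum_idx_Suc star_mult star_ug mult.assoc sum_distrib_left sum_distrib_right)
  also have "\<dots> = (if i # I = j # J then 1 else 0)"
    by (simp add: Cons ug_cols)
  finally show ?case .
qed (simp add: star_one)

lemma um_rows:
  assumes "length I = length w" "length J = length w"
  shows "(\<Sum>K\<in>idx (length w). um w K I * star (um w K J)) = (if I = J then 1 else 0)"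
  using assms
proof (induction rule: length_induct3)
  case (Cons c w i I j J)
  have "(\<Sum>K\<in>idx (length (c # w)). um (c # w) K (i # I) * star (um (c # w) K (j # J))) =
     (\<Sum>k\<in>UNIV. ug c k i * (\<Sum>K\<in>idx (length w). um w K I * star (um w K J)) * ug (flip c) k j)"
    by (simp add: sum_idx_Suc star_mult star_ug mult.assoc sum_distrib_left sum_distrib_right)
  also have "\<dots> = (if i # I = j # J then 1 else 0)"
    by (simp add: Cons ug_rows)
  finally show ?case .
qed (simp add: star_one)

section \<open>Linear maps, star-homomorphisms, and the coalgebra maps on monomials\<close>

lemma star_hom_linear: "star_hom \<phi> \<Longrightarrow> clinear \<phi>"
  by (simp add: star_hom_def)

lemma clinear_sum: "clinear f \<Longrightarrow> f (\<Sum>i\<in>A. g i) = (\<Sum>i\<in>A. f (g i))"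
  by (metis Vector_Spaces.linear.axioms(3) module_hom.sum)

lemma clinear_simps:
  assumes "clinear f"
  shows "f (x + y) = f x + f y" "f (x - y) = f x - f y" "f 0 = 0" "f (- x) = - f x"
    "f (c *\<^sub>C x) = c *\<^sub>C f x"
proof -
  interpret Vector_Spaces.linear scaleC scaleC f by fact
  show "f (x + y) = f x + f y" "f (x - y) = f x - f y" "f 0 = 0" "f (- x) = - f x"
    "f (c *\<^sub>C x) = c *\<^sub>C f x"
    by (simp_all add: add diff neg scale)
qed

lemma clinearI:
  fixes f :: "'a::complex_star_algebra \<Rightarrow> 'b::complex_star_algebra"
  assumes "\<And>x y. f (x + y) = f x + f y" "\<And>c x. f (c *\<^sub>C x) = c *\<^sub>C f x"
  shows "clinear f"
  using assms by (auto intro!: Vector_Spaces.linear.intro module_hom.intro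
        module_hom_axioms.intro cvec.vector_space_axioms cvec.module_axioms)

lemma star_diff: "star (x - y) = star x - star y" for x y :: "'a::complex_star_algebra"
  using star_add[of "x - y" y] by (simp add: algebra_simps)

lemma star_hom_simps:
  assumes "star_hom \<phi>"
  shows "\<phi> 1 = 1" "\<phi> (x * y) = \<phi> x * \<phi> y" "\<phi> (star x) = star (\<phi> x)"
  using assms by (auto simp: star_hom_def)

lemma coproduct_ug: "coproduct (ug c i j) = (\<Sum>k\<in>UNIV. ug c i k \<otimes> ug c k j)"
  by (cases c) (simp_all add: coproduct_ugen star_hom_simps[OF star_hom_coproduct] star_sum
      star_pure_tensor)

lemma coproduct_um:
  assumes "length I = length w" "length J = length w"
  shows "coproduct (um w I J) = (\<Sum>K\<in>idx (length w). um w I K \<otimes> um w K J)"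
  using assms
proof (induction rule: length_induct3)
  case Nil
  show ?case by (simp add: star_hom_simps[OF star_hom_coproduct] pure_tensor_one)
next
  case (Cons c w i I j J)
  then show ?case
    by (simp add: star_hom_simps[OF star_hom_coproduct] coproduct_ug sum_idx_Suc sum_product
        pure_tensor_mult)
qed

lemma counit_ug: "counit (ug c i j) = (if i = j then 1 else 0)"
  by (cases c) (simp_all add: counit_ugen star_hom_simps[OF star_hom_counit] star_complex_def)

lemma counit_um:
  assumes "length I = length w" "length J = length w"
  shows "counit (um w I J) = (if I = J then 1 else 0)"
  using assms
  by (induction rule: length_induct3)
    (simp_all add: star_hom_simps[OF star_hom_counit] counit_ug)

text \<open>The span of the monomials is closed under products and the star and contains the
  generators, hence the class of every term. Linear statements are thereby reduced to the elements
  \<open>um w I J\<close>.\<close>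

lemma free_unitary_induct [case_names um add scaleC]:
  fixes x :: "'n::finite free_unitary"
  assumes um: "\<And>w I J. length I = length w \<Longrightarrow> length J = length w \<Longrightarrow> P (um w I J)"
    and add: "\<And>x y. P x \<Longrightarrow> P y \<Longrightarrow> P (x + y)"
    and scaleC: "\<And>c x. P x \<Longrightarrow> P (c *\<^sub>C x)"
  shows "P x"
proof -
  have gmon: "P (gmon m)" for m
    unfolding gmon_eq_um by (rule um) auto
  define S where "S = range (gmon :: _ \<Rightarrow> 'n free_unitary)"
  have span: "P x" if "x \<in> cvec.span S" for x
    using that
  proof (induction rule: cvec.span_induct_alt)
    case base
    show ?case using scaleC[OF um[of "[]" "[]" "[]"], of 0] by simp
  qed (auto simp: S_def intro: add scaleC gmon)
  have mult: "x * y \<in> cvec.span S" if "x \<in> cvec.span S" "y \<in> cvec.span S" for x y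
    using that(1)
  proof (induction rule: cvec.span_induct_alt)
    case base
    show ?case by (simp add: cvec.span_zero)
  next
    case (step c m x)
    then obtain m' where m': "m = gmon m'" by (auto simp: S_def)
    have "m * y \<in> cvec.span S"
      using that(2)
    proof (induction rule: cvec.span_induct_alt)
      case base
      show ?case by (simp add: cvec.span_zero)
    next
      case (step c n y)
      then obtain n' where n': "n = gmon n'" by (auto simp: S_def)
      have "m * n \<in> S" using rangeI[of gmon "m' @ n'"] by (simp add: S_def m' n')
      with step show ?case
        by (auto simp: distrib_left mult_scaleC_right intro: cvec.span_add cvec.span_scale cvec.span_base)
    qed
    with step show ?case
      by (auto simp: distrib_right mult_scaleC_left intro: cvec.span_add cvec.span_scale)
  qed
  have star: "star x \<in> cvec.span S" if "x \<in> cvec.span S" for x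
    using that
  proof (induction rule: cvec.span_induct_alt)
    case base
    show ?case by (simp add: cvec.span_zero)
  next
    case (step c m x)
    then obtain m' where m': "m = gmon m'" by (auto simp: S_def)
    have "star m \<in> S" unfolding m' gmon_eq_um[of m']
      by (subst star_um) (auto simp: um_def S_def)
    with step show ?case
      by (auto simp: star_add star_scaleC intro: cvec.span_add cvec.span_scale cvec.span_base)
  qed
  have "abs_free_unitary t \<in> cvec.span S" for t
  proof (induction t)
    case (Gen i j)
    have "ugen i j = gmon [(Lozenge, i, j)]" by simp
    then have "ugen i j \<in> S" unfolding S_def by blast
    then show ?case by (simp add: ugen.abs_eq cvec.span_base)
  next
    case Zero
    show ?case using cvec.span_zero[of S] by (simp add: zero_free_unitary_def)
  next
    case One
    have "1 = gmon []" by simp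
    then have "1 \<in> S" unfolding S_def by blast
    then show ?case by (simp add: one_free_unitary_def cvec.span_base)
  next
    case (Add s t)
    then show ?case by (simp add: plus_free_unitary.abs_eq[symmetric] cvec.span_add)
  next
    case (Mul s t)
    then show ?case by (simp add: times_free_unitary.abs_eq[symmetric] mult)
  next
    case (Scale c s)
    then show ?case by (simp add: scaleC_free_unitary.abs_eq[symmetric] cvec.span_scale)
  next
    case (Star s)
    then show ?case by (simp add: star_free_unitary.abs_eq[symmetric] star)
  qed
  then show ?thesis by (metis span free_unitary.abs_induct)
qed

lemma free_unitary_expansion:
  fixes x :: "'n::finite free_unitary"
  obtains n :: nat and c w I J where "x = (\<Sum>r<n. c r *\<^sub>C um (w r) (I r) (J r))"
    and "\<And>r. length (I r) = length (w r)" "\<And>r. length (J r) = length (w r)"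
proof -
  have "\<exists>ts. x = (\<Sum>(c, w, I, J)\<leftarrow>ts. c *\<^sub>C um w I J) \<and>
      (\<forall>(c, w, I, J)\<in>set ts. length I = length w \<and> length J = length w)"
  proof (induction x rule: free_unitary_induct)
    case (um w I J)
    then show ?case by (intro exI[of _ "[(1, w, I, J)]"]) (simp add: scaleC_one)
  next
    case (add x y)
    then obtain ts us where "x = (\<Sum>(c, w, I, J)\<leftarrow>ts. c *\<^sub>C um w I J)"
      "\<forall>(c, w, I, J)\<in>set ts. length I = length w \<and> length J = length w"
      "y = (\<Sum>(c, w, I, J)\<leftarrow>us. c *\<^sub>C um w I J)"
      "\<forall>(c, w, I, J)\<in>set us. length I = length w \<and> length J = length w"
      by auto
    then show ?case by (intro exI[of _ "ts @ us"]) auto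
  next
    case (scaleC d x)
    then obtain ts where ts: "x = (\<Sum>(c, w, I, J)\<leftarrow>ts. c *\<^sub>C um w I J)"
      "\<forall>(c, w, I, J)\<in>set ts. length I = length w \<and> length J = length w"
      by auto
    have "d *\<^sub>C (\<Sum>(c, w, I, J)\<leftarrow>ts. c *\<^sub>C um w I J) =
        (\<Sum>(c, w, I, J)\<leftarrow>map (\<lambda>(c, t). (d * c, t)) ts. c *\<^sub>C um w I J)"
      by (induction ts) (auto simp: scaleC_add_right scaleC_scaleC)
    then show ?case using ts by (intro exI[of _ "map (\<lambda>(c, t). (d * c, t)) ts"]) auto
  qed
  then obtain ts where ts: "x = (\<Sum>(c, w, I, J)\<leftarrow>ts. c *\<^sub>C um w I J)"
    "\<forall>(c, w, I, J)\<in>set ts. length I = length w \<and> length J = length w"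
    by blast
  \<comment> \<open>Beyond the end of the list stands a zero multiple of the empty monomial, so that
    the length conditions hold for every \<open>r\<close> without a bound.\<close>
  define t where "t r = (if r < length ts then ts ! r else (0, [], [], []))" for r
  have len: "length (fst (snd (snd (t r)))) = length (fst (snd (t r)))"
    "length (snd (snd (snd (t r)))) = length (fst (snd (t r)))" for r
    using ts(2) nth_mem[of r ts] by (fastforce simp: t_def case_prod_unfold)+
  have "x = (\<Sum>r<length ts. fst (t r) *\<^sub>C um (fst (snd (t r))) (fst (snd (snd (t r)))) (snd (snd (snd (t r)))))"
    unfolding ts(1) by (simp add: sum_list_sum_nth atLeast0LessThan t_def case_prod_unfold)
  from that[OF this len] show ?thesis .
qed

section \<open>Linear functionals given by their values on monomials\<close>

text \<open>The linear extension of a function on monomials to terms, in continuation-passing style; the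
  flag says whether the term is to be starred.\<close>

primrec sem :: "'n uterm \<Rightarrow> bool \<Rightarrow> ((letter \<times> 'n \<times> 'n) list \<Rightarrow> complex) \<Rightarrow> complex" where
  "sem (Gen i j) b g = g [(if b then Bullet else Lozenge, i, j)]"
| "sem Zero b g = 0"
| "sem One b g = g []"
| "sem (Add s t) b g = sem s b g + sem t b g"
| "sem (Mul s t) b g = (if b then sem t b (\<lambda>m. sem s b (\<lambda>m'. g (m @ m')))
    else sem s b (\<lambda>m. sem t b (\<lambda>m'. g (m @ m'))))"
| "sem (Scale c s) b g = (if b then cnj c else c) * sem s b g"
| "sem (Star s) b g = sem s (\<not> b) g"

lemma sem_zero [simp]: "sem t b (\<lambda>_. 0) = 0"
  by (induction t arbitrary: b) auto

lemma sem_plus: "sem t b (\<lambda>m. g m + g' m) = sem t b g + sem t b g'"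
  by (induction t arbitrary: b g g') (auto simp: algebra_simps)

lemma sem_scale: "sem t b (\<lambda>m. c * g m) = c * sem t b g"
  by (induction t arbitrary: b g) (auto simp: algebra_simps)

lemma sem_sum: "sem t b (\<lambda>m. \<Sum>k\<in>A. g k m) = (\<Sum>k\<in>A. sem t b (g k))"
  by (induction A rule: infinite_finite_induct) (simp_all add: sem_plus)

text \<open>Compatibility with the defining relations in every context: \<open>a\<close> and
  \<open>b\<close> are the monomials to the left and to the right of the relation.\<close>

definition admissible :: "((letter \<times> 'n \<times> 'n) list \<Rightarrow> complex) \<Rightarrow> bool" where
  "admissible g \<longleftrightarrow> (\<forall>c i j a b.
     (\<Sum>k\<in>UNIV. g (a @ (c, i, k) # (flip c, j, k) # b)) = (if i = j then g (a @ b) else 0) \<and>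
     (\<Sum>k\<in>UNIV. g (a @ (c, k, i) # (flip c, k, j) # b)) = (if i = j then g (a @ b) else 0))"

lemma admissible_cols:
  "admissible g \<Longrightarrow> (\<Sum>k\<in>UNIV. g (a @ (c, i, k) # (flip c, j, k) # b)) = (if i = j then g (a @ b) else 0)"
  and admissible_rows:
  "admissible g \<Longrightarrow> (\<Sum>k\<in>UNIV. g (a @ (c, k, i) # (flip c, k, j) # b)) = (if i = j then g (a @ b) else 0)"
  unfolding admissible_def by simp_all

lemma admissibleI:
  assumes "\<And>c i j a b.
     (\<Sum>k\<in>UNIV. g (a @ (c, i, k) # (flip c, j, k) # b)) = (if i = j then g (a @ b) else 0)"
    and "\<And>c i j a b.
     (\<Sum>k\<in>UNIV. g (a @ (c, k, i) # (flip c, k, j) # b)) = (if i = j then g (a @ b) else 0)"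
  shows "admissible g"
  using assms unfolding admissible_def by simp

lemma admissible_prefix:
  assumes "admissible g"
  shows "admissible (\<lambda>m. g (m' @ m))"
  using admissible_cols[OF assms, of "m' @ a" for a] admissible_rows[OF assms, of "m' @ a" for a]
  by (intro admissibleI) simp_all

lemma admissible_suffix:
  assumes "admissible g"
  shows "admissible (\<lambda>m. g (m @ m'))"
  using admissible_cols[OF assms, of _ _ _ _ "b @ m'" for b]
    admissible_rows[OF assms, of _ _ _ _ "b @ m'" for b]
  by (intro admissibleI) simp_all

text \<open>For the congruence of products: once one factor has been evaluated, the result must
  still be admissible as a function of the other.\<close>

lemma admissible_sem:
  assumes "\<And>m'. admissible (\<lambda>m. G m m')"
  shows "admissible (\<lambda>m. sem t b (G m))"
  using assms unfolding admissible_def by (simp add: sem_sum[symmetric])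

lemma sem_Sum:
  assumes "enumerates ks"
  shows "sem (Sum ks f) b g = (\<Sum>k\<in>UNIV. sem (f k) b g)"
proof -
  have "sem (Sum ks f) b g = (\<Sum>k\<leftarrow>ks. sem (f k) b g)"
    unfolding Sum_def by (induction ks) auto
  with assms show ?thesis by (simp add: enumerates_def sum_list_distinct_conv_sum_set)
qed

lemma sem_Delta: "sem (Delta i j) b g = (if i = j then g [] else 0)"
  by (simp add: Delta_def)

lemma admissibleD:
  assumes "admissible g"
  shows "(\<Sum>k\<in>UNIV. g [(Lozenge, i, k), (Bullet, j, k)]) = (if i = j then g [] else 0)"
    "(\<Sum>k\<in>UNIV. g [(Bullet, i, k), (Lozenge, j, k)]) = (if i = j then g [] else 0)"
    "(\<Sum>k\<in>UNIV. g [(Lozenge, k, i), (Bullet, k, j)]) = (if i = j then g [] else 0)"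
    "(\<Sum>k\<in>UNIV. g [(Bullet, k, i), (Lozenge, k, j)]) = (if i = j then g [] else 0)"
  using admissible_cols[OF assms, of "[]" Lozenge i j "[]"] admissible_rows[OF assms, of "[]" Lozenge i j "[]"]
    admissible_cols[OF assms, of "[]" Bullet i j "[]"] admissible_rows[OF assms, of "[]" Bullet i j "[]"]
  by simp_all

lemma sem_eq:
  assumes "uterm_eq s t" "admissible g"
  shows "sem s b g = sem t b g"
  using assms
proof (induction arbitrary: b g)
  case (cong_Mul s s' t t')
  have "sem s b (\<lambda>m. sem t b (\<lambda>m'. g (m @ m'))) = sem s' b (\<lambda>m. sem t' b (\<lambda>m'. g (m @ m')))"
    "sem t b (\<lambda>m. sem s b (\<lambda>m'. g (m @ m'))) = sem t' b (\<lambda>m. sem s' b (\<lambda>m'. g (m @ m')))" for b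
    using cong_Mul by (simp_all add: admissible_prefix admissible_suffix admissible_sem)
  then show ?case by simp
next
  \<comment> \<open>For a starred term (\<open>b\<close> true) each relation turns into its own
    version with \<open>i\<close> and \<open>j\<close> exchanged, hence the two instances.\<close>
  case (rel1 ks i j)
  then show ?case using admissibleD(1)[of g i j] admissibleD(1)[of g j i]
    by (cases b) (simp_all add: sem_Sum sem_Delta)
next
  case (rel2 ks i j)
  then show ?case using admissibleD(4)[of g i j] admissibleD(4)[of g j i]
    by (cases b) (simp_all add: sem_Sum sem_Delta)
next
  case (rel3 ks i j)
  then show ?case using admissibleD(2)[of g i j] admissibleD(2)[of g j i]
    by (cases b) (simp_all add: sem_Sum sem_Delta)
next
  case (rel4 ks i j)
  then show ?case using admissibleD(3)[of g i j] admissibleD(3)[of g j i]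
    by (cases b) (simp_all add: sem_Sum sem_Delta)
qed (auto simp: sem_plus sem_scale algebra_simps)

definition extend :: "((letter \<times> 'n \<times> 'n) list \<Rightarrow> complex) \<Rightarrow> 'n free_unitary \<Rightarrow> complex" where
  "extend g x = sem (rep_free_unitary x) False g"

lemma extend_abs: "admissible g \<Longrightarrow> extend g (abs_free_unitary s) = sem s False g"
  unfolding extend_def
  by (rule sem_eq) (metis Quotient3_rep_abs Quotient3_free_unitary uterm_eq.refl)

lemma clinear_extend:
  assumes "admissible g"
  shows "clinear (extend g)"
proof (rule clinearI)
  show "extend g (x + y) = extend g x + extend g y" for x y
    by (induction x; induction y) (simp add: plus_free_unitary.abs_eq extend_abs assms)
  show "extend g (c *\<^sub>C x) = c *\<^sub>C extend g x" for c x
    by (induction x) (simp add: scaleC_free_unitary.abs_eq extend_abs assms scaleC_complex_def)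
qed

lemma extend_gmon:
  assumes "admissible g"
  shows "extend g (gmon m) = g m"
proof -
  \<comment> \<open>The term must not depend on \<open>g\<close>: the inductive step evaluates it at
    \<open>g\<close> shifted by the first letter.\<close>
  have "\<exists>t. gmon m = abs_free_unitary t \<and> (\<forall>g. sem t False g = g m)"
  proof (induction m)
    case Nil
    show ?case by (intro exI[of _ One]) (simp add: one_free_unitary_def)
  next
    case (Cons x m)
    obtain c i j where x: "x = (c, i, j)" by (cases x)
    from Cons obtain t where t: "gmon m = abs_free_unitary t" "\<And>g. sem t False g = g m" by auto
    define s where "s = (case c of Lozenge \<Rightarrow> Gen i j | Bullet \<Rightarrow> Star (Gen i j))"
    have "ug c i j = abs_free_unitary s" "sem s False g = g [(c, i, j)]" for g
      by (cases c; simp add: s_def ugen.abs_eq star_free_unitary.abs_eq)+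
    with t show ?case
      by (intro exI[of _ "Mul s t"]) (simp add: x times_free_unitary.abs_eq)
  qed
  then show ?thesis by (metis extend_abs assms)
qed

section \<open>Noncrossing pairings\<close>

text \<open>Tensors are functions on multi-indices. This operator inserts the invariant vector, the
  sum of e_k (x) e_k, at positions n and n + 1; \<open>cap n\<close> is its adjoint.\<close>

definition ins :: "nat \<Rightarrow> ('n list \<Rightarrow> real) \<Rightarrow> 'n list \<Rightarrow> real" where
  "ins n \<xi> I = (if Suc n < length I \<and> I ! n = I ! Suc n
    then \<xi> (take n I @ drop (Suc (Suc n)) I) else 0)"

definition cap :: "nat \<Rightarrow> ('n::finite list \<Rightarrow> real) \<Rightarrow> 'n list \<Rightarrow> real" where
  "cap n \<xi> I = (\<Sum>k\<in>UNIV. \<xi> (take n I @ [k, k] @ drop n I))"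

lemma ins_append:
  "length I = n \<Longrightarrow> ins n \<xi> (I @ i # j # J) = (if i = j then \<xi> (I @ J) else 0)"
  by (auto simp: ins_def nth_append)

lemma cap_append: "length I = n \<Longrightarrow> cap n \<xi> (I @ J) = (\<Sum>k\<in>UNIV. \<xi> (I @ k # k # J))"
  by (simp add: cap_def)

lemma ins_linear: "ins n (\<lambda>x. f x + c * g x) = (\<lambda>x. ins n f x + c * ins n g x)"
  by (auto simp: ins_def)

lemma cap_linear: "cap n (\<lambda>x. f x + c * g x) = (\<lambda>x. cap n f x + c * cap n g x)"
  by (auto simp: cap_def sum.distrib sum_distrib_left)

lemma ins_zero [simp]: "ins n (\<lambda>_. 0) = (\<lambda>_. 0)"
  by (simp add: ins_def fun_eq_iff)

lemma cap_zero [simp]: "cap n (\<lambda>_. 0) = (\<lambda>_. 0)"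
  by (simp add: cap_def fun_eq_iff)

definition supported :: "nat \<Rightarrow> ('n list \<Rightarrow> real) \<Rightarrow> bool" where
  "supported n \<xi> \<longleftrightarrow> (\<forall>I. length I \<noteq> n \<longrightarrow> \<xi> I = 0)"

lemma supported_ins: "supported n \<xi> \<Longrightarrow> supported (n + 2) (ins p \<xi>)"
  by (auto simp: supported_def ins_def)

lemma supported_cap: "supported (n + 2) \<xi> \<Longrightarrow> supported n (cap p \<xi>)"
  by (auto simp: supported_def cap_def)

lemma supported_eqI:
  assumes "supported n \<xi>" "supported n \<eta>" "\<And>I. length I = n \<Longrightarrow> \<xi> I = \<eta> I"
  shows "\<xi> = \<eta>"
proof
  show "\<xi> I = \<eta> I" for I
    using assms by (cases "length I = n") (auto simp: supported_def)
qed

lemma length_split: "length I = p + q \<Longrightarrow> \<exists>K L. I = K @ L \<and> length K = p \<and> length L = q"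
  by (rule exI[of _ "take p I"], rule exI[of _ "drop p I"]) auto

lemma length_split_pair:
  assumes "p + q + 2 \<le> length I"
  shows "\<exists>K M i j L. I = K @ M @ i # j # L \<and> length K = p \<and> length M = q"
proof -
  from assms obtain r where "length I = p + (q + Suc (Suc r))"
    by (auto simp: le_iff_add)
  then obtain K I' where "I = K @ I'" "length K = p" "length I' = q + Suc (Suc r)"
    using length_split by blast
  moreover from this obtain M I'' where "I' = M @ I''" "length M = q" "length I'' = Suc (Suc r)"
    using length_split by blast
  moreover from this obtain i j L where "I'' = i # j # L"
    by (auto simp: length_Suc_conv)
  ultimately show ?thesis by blast
qed

lemma length_split_elem:
  assumes "n < length I"
  shows "\<exists>K i L. I = K @ i # L \<and> length K = n"
  using id_take_nth_drop[OF assms] assms by (intro exI[of _ "take n I"]) auto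

text \<open>First of the Temperley-Lieb relations: a closed loop contributes the factor N.\<close>

lemma cap_ins_same:
  assumes "supported m \<xi>" "n \<le> m"
  shows "cap n (ins n \<xi>) = (\<lambda>I :: 'n::finite list. real CARD('n) * \<xi> I)"
proof (rule supported_eqI[of m])
  fix I :: "'n list"
  assume "length I = m"
  then obtain K L where "I = K @ L" "length K = n" using length_split[of I n "m - n"] assms by auto
  then show "cap n (ins n \<xi>) I = real CARD('n) * \<xi> I" by (simp add: cap_append ins_append)
next
  show "supported m (\<lambda>I. real CARD('n) * \<xi> I)" using assms(1) by (simp add: supported_def)
qed (use assms supported_cap[OF supported_ins] in auto)

text \<open>Zigzag relation: a cap that shares one leg with the inserted pair straightens to the
  identity.\<close>

lemma cap_ins_right:
  assumes "supported m \<xi>" "Suc n \<le> m"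
  shows "cap n (ins (Suc n) \<xi>) = \<xi>"
proof (rule supported_eqI[of m])
  fix I :: "'a list"
  assume "length I = m"
  then obtain K i L where I: "I = K @ i # L" "length K = n"
    using length_split_elem[of n I] assms(2) by auto
  have "ins (Suc n) \<xi> (K @ k # k # i # L) = (if k = i then \<xi> (K @ i # L) else 0)" for k
    using ins_append[of "K @ [k]" "Suc n" \<xi> k i L] I by simp
  then show "cap n (ins (Suc n) \<xi>) I = \<xi> I" by (simp add: I cap_append)
qed (use assms supported_cap[OF supported_ins] in auto)

lemma cap_ins_left:
  assumes "supported m \<xi>" "Suc n \<le> m"
  shows "cap (Suc n) (ins n \<xi>) = \<xi>"
proof (rule supported_eqI[of m])
  fix I :: "'a list"
  assume "length I = m"
  then obtain K i L where I: "I = K @ i # L" "length K = n"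
    using length_split_elem[of n I] assms(2) by auto
  have "cap (Suc n) (ins n \<xi>) I = (\<Sum>k\<in>UNIV. ins n \<xi> (K @ i # k # k # L))"
    using cap_append[of "K @ [i]" "Suc n" "ins n \<xi>" L] I by simp
  then show "cap (Suc n) (ins n \<xi>) I = \<xi> I" by (simp add: I ins_append)
qed (use assms supported_cap[OF supported_ins] in auto)

text \<open>A cap and a pair without common legs commute, up to the shift of positions caused by the
  two removed letters.\<close>

lemma cap_ins_far_right:
  assumes "supported m \<xi>" "n + q + 2 \<le> m"
  shows "cap n (ins (n + q + 2) \<xi>) = ins (n + q) (cap n \<xi>)"
proof (rule supported_eqI[of m])
  fix I :: "'a list"
  assume "length I = m"
  then obtain K M i j L where I: "I = K @ M @ i # j # L" "length K = n" "length M = q"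
    using length_split_pair assms(2) by metis
  have "ins (n + q + 2) \<xi> (K @ k # k # M @ i # j # L) = (if i = j then \<xi> (K @ k # k # M @ L) else 0)"
    for k using ins_append[of "K @ k # k # M" "n + q + 2" \<xi> i j L] I by simp
  moreover have "ins (n + q) (cap n \<xi>) I = (if i = j then cap n \<xi> (K @ M @ L) else 0)"
    using ins_append[of "K @ M" "n + q" "cap n \<xi>" i j L] I by simp
  ultimately show "cap n (ins (n + q + 2) \<xi>) I = ins (n + q) (cap n \<xi>) I"
    by (simp add: I cap_append)
next
  have m: "m - 2 + 2 = m" using assms(2) by simp
  show "supported m (ins (n + q) (cap n \<xi>))"
    using supported_ins[OF supported_cap[of "m - 2" \<xi>]] assms(1) unfolding m by blast
qed (use assms supported_cap[OF supported_ins] in auto)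

lemma cap_ins_far_left:
  assumes "supported m \<xi>" "p + q + 2 \<le> m"
  shows "cap (p + q + 2) (ins p \<xi>) = ins p (cap (p + q) \<xi>)"
proof (rule supported_eqI[of m])
  fix I :: "'a list"
  assume "length I = m"
  then obtain K i j I' where "I = K @ i # j # I'" and K: "length K = p" and "q \<le> length I'"
    using length_split_pair[of p 0 I] assms(2) by fastforce
  moreover from this obtain M L where "I' = M @ L" "length M = q"
    using length_split[of I' q "length I' - q"] by auto
  ultimately have I: "I = K @ i # j # M @ L" "length K = p" "length M = q" by auto
  have "cap (p + q + 2) (ins p \<xi>) I = (\<Sum>k\<in>UNIV. ins p \<xi> (K @ i # j # M @ k # k # L))"
    using cap_append[of "K @ i # j # M" "p + q + 2" "ins p \<xi>" L] I by simp
  moreover have "cap (p + q) \<xi> (K @ M @ L) = (\<Sum>k\<in>UNIV. \<xi> (K @ M @ k # k # L))"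
    using cap_append[of "K @ M" "p + q" \<xi> L] I by simp
  ultimately show "cap (p + q + 2) (ins p \<xi>) I = ins p (cap (p + q) \<xi>) I"
    by (simp add: I ins_append)
next
  have m: "m - 2 + 2 = m" using assms(2) by simp
  show "supported m (ins p (cap (p + q) \<xi>))"
    using supported_ins[OF supported_cap[of "m - 2" \<xi>]] assms(1) unfolding m by blast
qed (use assms supported_cap[OF supported_ins] in auto)

text \<open>Every nonempty noncrossing pairing joins some two neighbours, so insertions of
  neighbouring pairs generate all of them. What is recorded is the tensor of the pairing, not the
  pairing itself.\<close>

inductive pairing :: "letter list \<Rightarrow> ('n list \<Rightarrow> real) \<Rightarrow> bool" where
  Nil: "pairing [] (\<lambda>I. if I = [] then 1 else 0)"
| ins: "pairing (a @ b) \<xi> \<Longrightarrow> pairing (a @ c # flip c # b) (ins (length a) \<xi>)"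

lemma supported_pairing: "pairing w \<xi> \<Longrightarrow> supported (length w) \<xi>"
proof (induction rule: pairing.induct)
  case (ins a b \<xi> c)
  from supported_ins[OF ins.IH] show ?case by simp
qed (simp add: supported_def)

lemma finite_pairings: "finite {\<xi> :: 'n list \<Rightarrow> real. pairing w \<xi>}"
proof (induction w rule: length_induct)
  case (1 w)
  have "{\<xi> :: 'n list \<Rightarrow> real. pairing w \<xi>} \<subseteq> {\<lambda>I. if I = [] then 1 else 0} \<union>
     (\<Union>n\<in>{n. n + 2 \<le> length w}. ins n ` {\<xi>. pairing (take n w @ drop (n + 2) w) \<xi>})" (is "_ \<subseteq> ?R")
  proof
    fix \<xi> :: "'n list \<Rightarrow> real"
    assume "\<xi> \<in> {\<xi>. pairing w \<xi>}"
    then have "pairing w \<xi>" by simp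
    then show "\<xi> \<in> ?R"
    proof cases
      case (ins a b \<xi>' c)
      have "\<xi>' \<in> {\<xi>. pairing (take (length a) w @ drop (length a + 2) w) \<xi>}"
        using ins by simp
      then have "\<xi> \<in> ins (length a) ` {\<xi>. pairing (take (length a) w @ drop (length a + 2) w) \<xi>}"
        using ins(2) by blast
      moreover have "length a + 2 \<le> length w" using ins(1) by simp
      ultimately show ?thesis by blast
    qed simp
  qed
  moreover have "finite {n. n + 2 \<le> length w}"
    by (rule finite_subset[of _ "{..length w}"]) auto
  ultimately show ?case
    using 1 by (elim finite_subset) (intro finite_UnI finite_UN_I finite_imageI, auto)
qed

section \<open>Spans of functions and orthogonal projections onto them\<close>

inductive_set fspan :: "('x \<Rightarrow> real) set \<Rightarrow> ('x \<Rightarrow> real) set" for S where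
  zero: "(\<lambda>_. 0) \<in> fspan S"
| add: "f \<in> fspan S \<Longrightarrow> g \<in> S \<Longrightarrow> (\<lambda>x. f x + c * g x) \<in> fspan S"

lemma fspan_base: "g \<in> S \<Longrightarrow> g \<in> fspan S"
  using fspan.add[OF fspan.zero, of g S 1] by simp

lemma fspan_add:
  assumes "f \<in> fspan S" "g \<in> fspan S"
  shows "(\<lambda>x. f x + c * g x) \<in> fspan S"
  using assms(2)
proof (induction rule: fspan.induct)
  case (add g h d)
  from fspan.add[OF add.IH add.hyps(2), of "c * d"] show ?case by (simp add: algebra_simps)
qed (simp add: assms)

lemma fspan_sum:
  "(\<And>i. i \<in> A \<Longrightarrow> f i \<in> fspan S) \<Longrightarrow> (\<lambda>x. \<Sum>i\<in>A. c i * f i x) \<in> fspan S"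
proof (induction A rule: infinite_finite_induct)
  case (insert i A)
  then have "(\<lambda>x. (\<Sum>i\<in>A. c i * f i x) + c i * f i x) \<in> fspan S" by (intro fspan_add) auto
  with insert show ?case by (simp add: add.commute)
qed (simp_all add: fspan.zero)

lemma fspan_mono: "f \<in> fspan S \<Longrightarrow> S \<subseteq> T \<Longrightarrow> f \<in> fspan T"
  by (induction rule: fspan.induct) (auto intro: fspan.intros)

text \<open>Gram--Schmidt orthogonalisation: \<open>Q\<close> is the kernel of the orthogonal projection onto the
  span of \<open>G\<close>.\<close>

lemma projection_kernel_exists:
  fixes G :: "('x \<Rightarrow> real) set"
  assumes "finite X" "finite G" "\<And>g x. g \<in> G \<Longrightarrow> x \<notin> X \<Longrightarrow> g x = 0"
  shows "\<exists>Q. (\<forall>x y. Q x y = Q y x) \<and> (\<forall>y. (\<lambda>x. Q x y) \<in> fspan G) \<and>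
    (\<forall>g\<in>G. \<forall>x. (\<Sum>y\<in>X. Q x y * g y) = g x)"
  using assms(2,3)
proof (induction G)
  case empty
  show ?case by (intro exI[of _ "\<lambda>_ _. 0"]) (auto intro: fspan.zero)
next
  case (insert g G)
  then have "\<exists>Q. (\<forall>x y. Q x y = Q y x) \<and> (\<forall>y. (\<lambda>x. Q x y) \<in> fspan G) \<and>
    (\<forall>g\<in>G. \<forall>x. (\<Sum>y\<in>X. Q x y * g y) = g x)"
    by (intro insert.IH) auto
  then obtain Q where Q: "(\<forall>x y. Q x y = Q y x) \<and> (\<forall>y. (\<lambda>x. Q x y) \<in> fspan G) \<and>
    (\<forall>g\<in>G. \<forall>x. (\<Sum>y\<in>X. Q x y * g y) = g x)"
    by blast
  then have sym: "Q x y = Q y x" and col: "(\<lambda>x. Q x y) \<in> fspan G"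
    and rep: "f \<in> G \<Longrightarrow> (\<Sum>y\<in>X. Q x y * f y) = f x" for x y f
    by blast+
  \<comment> \<open>The component of \<open>g\<close> orthogonal to the span of \<open>G\<close>. If
    it vanishes, the old kernel already reproduces \<open>g\<close>.\<close>
  define r where "r x = g x + (-1) * (\<Sum>y\<in>X. g y * Q x y)" for x
  have proj: "(\<lambda>x. \<Sum>y\<in>X. g y * Q x y) \<in> fspan G" by (intro fspan_sum col)
  have r: "r \<in> fspan (insert g G)"
    unfolding r_def by (rule fspan_add[OF fspan_base fspan_mono[OF proj]]) auto
  have supp: "f x = 0" if "f \<in> fspan (insert g G)" "x \<notin> X" for f x
    using that by (induction rule: fspan.induct) (auto simp: insert.prems)
  have orth: "(\<Sum>x\<in>X. r x * f x) = 0" if "f \<in> fspan G" for f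
    using that
  proof (induction rule: fspan.induct)
    case zero
    show ?case by simp
  next
    case (add e f c)
    have "(\<Sum>x\<in>X. (\<Sum>y\<in>X. g y * Q x y) * f x) = (\<Sum>y\<in>X. g y * (\<Sum>x\<in>X. Q y x * f x))"
      by (simp add: sum_distrib_right sum_distrib_left, subst sum.swap) (simp add: sym mult.assoc)
    also have "\<dots> = (\<Sum>y\<in>X. g y * f y)" by (simp add: rep add.hyps)
    finally have "(\<Sum>x\<in>X. r x * f x) = 0"
      by (simp add: r_def algebra_simps sum_subtractf)
    then have "(\<Sum>x\<in>X. c * (r x * f x)) = 0" by (metis sum_distrib_left mult_zero_right)
    then show ?case using add.IH by (simp add: algebra_simps sum.distrib)
  qed
  show ?case
  proof (cases "\<forall>x. r x = 0")
    case True
    then have "(\<Sum>y\<in>X. Q x y * g y) = g x" for x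
      using r_def[of x] by (simp only: True mult.commute[of "Q x _"])
    with rep have "\<forall>f\<in>insert g G. \<forall>x. (\<Sum>y\<in>X. Q x y * f y) = f x"
      by blast
    moreover have "(\<lambda>x. Q x y) \<in> fspan (insert g G)" for y
      by (rule fspan_mono[OF col]) auto
    ultimately show ?thesis using sym by blast
  next
    case False
    define s where "s = (\<Sum>x\<in>X. r x * r x)"
    have "s \<noteq> 0"
    proof
      assume "s = 0"
      then have "\<forall>x\<in>X. r x = 0"
        unfolding s_def using assms(1) by (subst (asm) sum_nonneg_eq_0_iff) auto
      with False supp[OF r] show False by blast
    qed
    have "(\<Sum>x\<in>X. r x * g x) = (\<Sum>x\<in>X. r x * r x) + (\<Sum>x\<in>X. r x * (\<Sum>y\<in>X. g y * Q x y))"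
      unfolding sum.distrib[symmetric] by (rule sum.cong) (auto simp: r_def algebra_simps)
    then have rg: "(\<Sum>x\<in>X. r x * g x) = s" using orth[OF proj] by (simp add: s_def)
    \<comment> \<open>Adds the rank-one projection onto \<open>r\<close>, whose squared norm is
      \<open>s\<close>; the orthogonality of \<open>r\<close> to \<open>G\<close> keeps the old
      functions fixed.\<close>
    define R where "R x y = Q x y + r y / s * r x" for x y
    have "(\<Sum>y\<in>X. R x y * f y) = f x" if "f \<in> insert g G" for f x
    proof -
      have "(\<Sum>y\<in>X. R x y * f y) = (\<Sum>y\<in>X. Q x y * f y) + r x / s * (\<Sum>y\<in>X. r y * f y)"
        by (simp add: R_def algebra_simps sum.distrib sum_distrib_left)
      also have "\<dots> = f x"
      proof (cases "f = g")
        case True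
        then show ?thesis
          using rg r_def[of x] \<open>s \<noteq> 0\<close> by (simp add: mult.commute[of "Q x _"])
      next
        case False
        with that have "f \<in> G" by auto
        then show ?thesis using orth[of f] by (simp add: rep fspan_base)
      qed
      finally show ?thesis .
    qed
    moreover have "R x y = R y x" for x y by (simp add: R_def sym[of x y])
    moreover have "(\<lambda>x. R x y) \<in> fspan (insert g G)" for y
      unfolding R_def by (rule fspan_add[OF fspan_mono[OF col] r]) auto
    ultimately show ?thesis by blast
  qed
qed

section \<open>Stability of the noncrossing spans, and their projections\<close>

definition NC :: "letter list \<Rightarrow> ('n list \<Rightarrow> real) set" where
  "NC w = fspan {\<xi>. pairing w \<xi>}"

lemma ins_NC: "\<xi> \<in> NC (a @ b) \<Longrightarrow> ins (length a) \<xi> \<in> NC (a @ c # flip c # b)"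
  unfolding NC_def
proof (induction rule: fspan.induct)
  case zero
  show ?case by (simp add: fspan.zero)
next
  case (add f g c)
  then show ?case by (auto simp: ins_linear intro!: fspan.add pairing.ins)
qed

text \<open>Compare the cap with the pair inserted last. In the same place they form a loop; with
  one common letter they straighten; otherwise they commute, and the cap acts on the smaller
  pairing.\<close>

lemma cap_pairing:
  assumes "pairing w \<xi>" "w = a @ c # flip c # b"
  shows "cap (length a) \<xi> \<in> NC (a @ b)"
  using assms
proof (induction arbitrary: a b c rule: pairing.induct)
  case (ins a' b' \<xi> c')
  note supp = supported_pairing[OF ins.hyps]
  have \<xi>: "\<xi> \<in> NC (a' @ b')" unfolding NC_def using ins.hyps by (simp add: fspan_base)
  from ins.prems obtain us where "a' = a @ us \<and> us @ c' # flip c' # b' = c # flip c # b \<or>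
      a' @ us = a \<and> c' # flip c' # b' = us @ c # flip c # b"
    using append_eq_append_conv2 by blast
  then consider "a' = a @ us" "us @ c' # flip c' # b' = c # flip c # b"
    | "a' @ us = a" "us \<noteq> []" "c' # flip c' # b' = us @ c # flip c # b"
    by (cases "us = []") auto
  then show ?case
  proof cases
    \<comment> \<open>The cap starts at or before the inserted pair, and \<open>us\<close> lies
      between the two starts. One common letter (\<open>us = [c]\<close>) forces
      \<open>c' = flip c\<close>, so the remaining words agree.\<close>
    case 1
    from 1(2) consider "us = []" "b' = b" | "us = [c]" "b = c # b'" |
      vs where "us = c # flip c # vs" "b = vs @ c' # flip c' # b'"
      by (cases us; cases "tl us") auto
    then show ?thesis
    proof cases
      case 1
      then show ?thesis using \<xi> \<open>a' = a @ us\<close> fspan_add[OF fspan.zero, of \<xi> "{\<xi>. pairing (a @ b) \<xi>}"]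
        by (simp add: cap_ins_same[OF supp] NC_def)
    next
      case 2
      then show ?thesis using \<xi> \<open>a' = a @ us\<close> by (simp add: cap_ins_right[OF supp])
    next
      case (3 vs)
      have "cap (length a) \<xi> \<in> NC (a @ vs @ b')"
        by (rule ins.IH[where c = c]) (simp add: 3 \<open>a' = a @ us\<close>)
      then have "ins (length (a @ vs)) (cap (length a) \<xi>) \<in> NC ((a @ vs) @ c' # flip c' # b')"
        by (intro ins_NC) simp
      then show ?thesis
        using cap_ins_far_right[OF supp, of "length a" "length vs"] 3 \<open>a' = a @ us\<close> by simp
    qed
  next
    case 2
    from 2(2,3) consider "us = [c']" "b' = c' # b" |
      vs where "us = c' # flip c' # vs" "b' = vs @ c # flip c # b"
      by (cases us; cases "tl us") auto
    then show ?thesis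
    proof cases
      case 1
      then show ?thesis using \<xi> 2(1) by (auto simp: cap_ins_left[OF supp])
    next
      case (2 vs)
      have "cap (length (a' @ vs)) \<xi> \<in> NC ((a' @ vs) @ b)"
        by (rule ins.IH[where c = c]) (simp add: 2)
      then have "ins (length a') (cap (length (a' @ vs)) \<xi>) \<in> NC (a' @ c' # flip c' # vs @ b)"
        by (intro ins_NC) simp
      then show ?thesis
        using cap_ins_far_left[OF supp, of "length a'" "length vs"] 2 \<open>a' @ us = a\<close> by auto
    qed
  qed
qed simp

lemma cap_NC: "\<xi> \<in> NC (a @ c # flip c # b) \<Longrightarrow> cap (length a) \<xi> \<in> NC (a @ b)"
  unfolding NC_def[of "a @ c # flip c # b"]
proof (induction rule: fspan.induct)
  case zero
  show ?case by (simp add: NC_def fspan.zero)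
next
  case (add f g d)
  then have "cap (length a) g \<in> NC (a @ b)" using cap_pairing[OF _ HOL.refl] by auto
  with add.IH show ?case by (simp add: cap_linear NC_def fspan_add)
qed

text \<open>The matrix of the orthogonal projection onto \<open>NC w\<close>: on indices of the
  right length the three properties determine it.\<close>

definition ker :: "letter list \<Rightarrow> 'n::finite list \<Rightarrow> 'n list \<Rightarrow> real" where
  "ker w = (SOME Q. (\<forall>x y. Q x y = Q y x) \<and> (\<forall>y. (\<lambda>x. Q x y) \<in> NC w) \<and>
    (\<forall>g. pairing w g \<longrightarrow> (\<forall>x. (\<Sum>y\<in>idx (length w). Q x y * g y) = g x)))"

lemma ker: "(\<forall>x y :: 'n::finite list. ker w x y = ker w y x) \<and>
    (\<forall>y :: 'n list. (\<lambda>x. ker w x y) \<in> NC w) \<and>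
    (\<forall>g :: 'n list \<Rightarrow> real. pairing w g \<longrightarrow> (\<forall>x. (\<Sum>y\<in>idx (length w). ker w x y * g y) = g x))"
proof -
  have "\<exists>Q. (\<forall>x y. Q x y = Q y x) \<and> (\<forall>y. (\<lambda>x. Q x y) \<in> NC w) \<and>
    (\<forall>g :: 'n list \<Rightarrow> real. pairing w g \<longrightarrow> (\<forall>x. (\<Sum>y\<in>idx (length w). Q x y * g y) = g x))"
    using projection_kernel_exists[OF finite_idx finite_pairings, of w "length w"] supported_pairing
    unfolding NC_def supported_def by auto
  from someI_ex[OF this] show ?thesis unfolding ker_def .
qed

lemma ker_sym: "ker w x y = ker w y x"
  using ker[of w] by blast

lemma ker_NC: "(\<lambda>x. ker w x y) \<in> NC w"
  using ker[of w] by blast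

lemma ker_pairing: "pairing w \<xi> \<Longrightarrow> (\<Sum>y\<in>idx (length w). ker w x y * \<xi> y) = \<xi> x"
  using ker[of w] by blast

lemma ker_fix: "\<xi> \<in> NC w \<Longrightarrow> (\<Sum>y\<in>idx (length w). ker w x y * \<xi> y) = \<xi> x"
  unfolding NC_def
proof (induction rule: fspan.induct)
  case (add f g c)
  then have "c * (\<Sum>y\<in>idx (length w). ker w x y * g y) = c * g x" by (simp add: ker_pairing)
  then show ?case using add.IH by (simp add: algebra_simps sum.distrib sum_distrib_left)
qed simp

lemma sum_idx_insert:
  "(\<Sum>I\<in>idx (length (a @ c # c' # b)). f I) =
    (\<Sum>K\<in>idx (length a). \<Sum>k\<in>UNIV. \<Sum>l\<in>UNIV. \<Sum>L\<in>idx (length b). f (K @ k # l # L))"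
  for f :: "'n::finite list \<Rightarrow> 'b::comm_monoid_add"
proof -
  have "length (a @ c # c' # b) = length a + Suc (Suc (length b))" by simp
  then show ?thesis by (simp only: sum_idx_add sum_idx_Suc)
qed

text \<open>With \<open>T\<close> the insertion of a pair, this says that the projections satisfy
  \<open>ker W T = T (ker w)\<close>; indeed \<open>T\<close> and its adjoint preserve the spaces \<open>NC\<close>.\<close>

lemma ker_contract:
  fixes I J1 J2 :: "'n::finite list"
  assumes "length J1 = length a" "length J2 = length b"
  shows "(\<Sum>k\<in>UNIV. ker (a @ c # flip c # b) I (J1 @ k # k # J2)) =
    ins (length a) (\<lambda>I. ker (a @ b) I (J1 @ J2)) I"
proof -
  let ?W = "a @ c # flip c # b" and ?n = "length a"
  have "(\<Sum>k\<in>UNIV. ker ?W I (J1 @ k # k # J2)) = cap ?n (\<lambda>x. ker ?W x I) (J1 @ J2)"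
    by (simp add: cap_append assms ker_sym[of _ I])
  \<comment> \<open>The adjoint of the insertion maps the columns of \<open>ker ?W\<close> into
    \<open>NC (a @ b)\<close>, where the smaller projection acts as the identity.\<close>
  also have "\<dots> = (\<Sum>L\<in>idx (length (a @ b)). ker (a @ b) (J1 @ J2) L * cap ?n (\<lambda>x. ker ?W x I) L)"
    by (rule ker_fix[symmetric], rule cap_NC, rule ker_NC)
  also have "\<dots> = (\<Sum>L1\<in>idx (length a). \<Sum>L2\<in>idx (length b). \<Sum>k\<in>UNIV.
      ker (a @ b) (J1 @ J2) (L1 @ L2) * ker ?W (L1 @ k # k # L2) I)"
    by (simp add: sum_idx_add cap_append sum_distrib_left)
  \<comment> \<open>The adjoint is moved back to the other factor as an insertion; the inserted
    column lies in \<open>NC ?W\<close>, where the larger projection is the identity.\<close>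
  also have "\<dots> = (\<Sum>M\<in>idx (length ?W). ker ?W I M * ins ?n (\<lambda>I. ker (a @ b) I (J1 @ J2)) M)"
  proof -
    have "(\<Sum>L2\<in>idx (length b). \<Sum>k\<in>UNIV.
        ker (a @ b) (J1 @ J2) (L1 @ L2) * ker ?W (L1 @ k # k # L2) I) =
      (\<Sum>k\<in>UNIV. \<Sum>l\<in>UNIV. \<Sum>L\<in>idx (length b).
        ker ?W I (L1 @ k # l # L) * ins ?n (\<lambda>I. ker (a @ b) I (J1 @ J2)) (L1 @ k # l # L))"
      if "length L1 = length a" for L1
    proof -
      have "(\<Sum>l\<in>UNIV. \<Sum>L\<in>idx (length b).
        ker ?W I (L1 @ k # l # L) * ins ?n (\<lambda>I. ker (a @ b) I (J1 @ J2)) (L1 @ k # l # L)) =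
        (\<Sum>L\<in>idx (length b). ker ?W I (L1 @ k # k # L) * ker (a @ b) (L1 @ L) (J1 @ J2))" for k
        by (subst sum.swap) (simp add: ins_append that if_distrib[of "\<lambda>x. _ * x"] cong: if_cong)
      then show ?thesis
        by (subst sum.swap) (simp add: ker_sym[of _ I] ker_sym[of _ "J1 @ J2"] mult.commute)
    qed
    then show ?thesis unfolding sum_idx_insert by simp
  qed
  also have "\<dots> = ins ?n (\<lambda>I. ker (a @ b) I (J1 @ J2)) I"
    by (rule ker_fix, rule ins_NC, rule ker_NC)
  finally show ?thesis .
qed

section \<open>The functional given by the projections\<close>

definition ker_functional :: "'n::finite free_unitary \<Rightarrow> complex" where
  "ker_functional = extend (\<lambda>m. of_real (ker (map fst m) (map (fst \<circ> snd) m) (map (snd \<circ> snd) m)))"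

text \<open>\<open>ker_contract\<close> treats a contraction in the second index; the one in the
  first index follows by the symmetry of \<open>ker\<close>.\<close>

lemma admissible_ker:
  "admissible (\<lambda>m. of_real (ker (map fst m) (map (fst \<circ> snd) m) (map (snd \<circ> snd) m)) :: complex)"
proof (rule admissibleI, goal_cases)
  case (1 c i j a b)
  show ?case
    using ker_contract[of "map (snd \<circ> snd) a" "map fst a" "map (snd \<circ> snd) b" "map fst b" c
        "map (fst \<circ> snd) a @ i # j # map (fst \<circ> snd) b"]
    by (simp add: of_real_sum[symmetric] ins_append del: of_real_sum)
next
  case (2 c i j a b)
  show ?case
    using ker_contract[of "map (fst \<circ> snd) a" "map fst a" "map (fst \<circ> snd) b" "map fst b" c
        "map (snd \<circ> snd) a @ i # j # map (snd \<circ> snd) b"]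
    by (simp add: of_real_sum[symmetric] ins_append
        ker_sym[of _ "map (snd \<circ> snd) a @ i # j # map (snd \<circ> snd) b"]
        ker_sym[of _ "map (snd \<circ> snd) a @ map (snd \<circ> snd) b"] del: of_real_sum)
qed

lemma clinear_ker_functional: "clinear ker_functional"
  unfolding ker_functional_def by (rule clinear_extend[OF admissible_ker])

lemma zip3_um:
  assumes "length I = length w" "length J = length w"
  shows "map fst (zip w (zip I J)) = w" "map (fst \<circ> snd) (zip w (zip I J)) = I"
    "map (snd \<circ> snd) (zip w (zip I J)) = J"
  using assms by (induction rule: length_induct3) auto

lemma ker_functional_um:
  assumes "length I = length w" "length J = length w"
  shows "ker_functional (um w I J) = of_real (ker w I J)"
  unfolding ker_functional_def um_def by (subst extend_gmon[OF admissible_ker]) (simp add: zip3_um assms)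

lemma ker_functional_one: "ker_functional (1 :: 'n::finite free_unitary) = 1"
proof -
  have "ker [] [] ([] :: 'n list) = 1"
    using ker_pairing[OF pairing.Nil, of "[] :: 'n list"] by simp
  then show ?thesis using ker_functional_um[of "[]" "[]" "[] :: 'n list"] by simp
qed

text \<open>An inserted pair is fixed by u (x) conj(u), or by the two in the other order, because of
  \<open>ug_cols\<close>; removing it leaves the claim for the smaller pairing.\<close>

lemma NC_fixed:
  fixes \<xi> :: "'n::finite list \<Rightarrow> real"
  assumes "\<xi> \<in> NC w" "length I = length w"
  shows "(\<Sum>J\<in>idx (length w). complex_of_real (\<xi> J) *\<^sub>C um w I J) = complex_of_real (\<xi> I) *\<^sub>C 1"
proof -
  have pairing: "(\<Sum>J\<in>idx (length w). complex_of_real (\<xi> J) *\<^sub>C um w I J) = complex_of_real (\<xi> I) *\<^sub>C 1"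
    if "pairing w \<xi>" "length I = length w" for w I and \<xi> :: "'n list \<Rightarrow> real"
    using that
  proof (induction arbitrary: I rule: pairing.induct)
    case Nil
    then show ?case by simp
  next
    case (ins a b \<xi> c)
    from ins.prems obtain I1 I' where 1: "I = I1 @ I'" "length I1 = length a" "length I' = 2 + length b"
      using length_split[of I "length a" "2 + length b"] by auto
    then obtain i j I2 where I: "I = I1 @ i # j # I2" "length I1 = length a" "length I2 = length b"
      by (auto simp: length_Suc_conv)
    have "(\<Sum>J\<in>idx (length (a @ c # flip c # b)).
        complex_of_real (ins (length a) \<xi> J) *\<^sub>C um (a @ c # flip c # b) I J) =
      (\<Sum>K\<in>idx (length a). \<Sum>k\<in>UNIV. \<Sum>l\<in>UNIV. \<Sum>L\<in>idx (length b). (if k = l then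
         complex_of_real (\<xi> (K @ L)) *\<^sub>C (um a I1 K * (ug c i k * ug (flip c) j l) * um b I2 L) else 0))"
      unfolding sum_idx_insert
      by (intro sum.cong HOL.refl) (auto simp: ins_append I um_append mult.assoc)
    also have "\<dots> = (\<Sum>K\<in>idx (length a). \<Sum>L\<in>idx (length b).
         complex_of_real (\<xi> (K @ L)) *\<^sub>C (um a I1 K * (\<Sum>k\<in>UNIV. ug c i k * ug (flip c) j k) * um b I2 L))"
    proof (rule sum.cong[OF HOL.refl])
      fix K
      have "(\<Sum>l\<in>UNIV. \<Sum>L\<in>idx (length b). (if k = l then
         complex_of_real (\<xi> (K @ L)) *\<^sub>C (um a I1 K * (ug c i k * ug (flip c) j l) * um b I2 L) else 0)) =
         (\<Sum>L\<in>idx (length b).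
         complex_of_real (\<xi> (K @ L)) *\<^sub>C (um a I1 K * (ug c i k * ug (flip c) j k) * um b I2 L))" for k
        by (subst sum.swap) simp
      then show "(\<Sum>k\<in>UNIV. \<Sum>l\<in>UNIV. \<Sum>L\<in>idx (length b). (if k = l then
         complex_of_real (\<xi> (K @ L)) *\<^sub>C (um a I1 K * (ug c i k * ug (flip c) j l) * um b I2 L) else 0)) =
        (\<Sum>L\<in>idx (length b). complex_of_real (\<xi> (K @ L)) *\<^sub>C
          (um a I1 K * (\<Sum>k\<in>UNIV. ug c i k * ug (flip c) j k) * um b I2 L))"
        by simp (subst sum.swap, simp add: sum_distrib_left sum_distrib_right cvec.scale_sum_right)
    qed
    also have "\<dots> = (if i = j then (\<Sum>J\<in>idx (length (a @ b)). complex_of_real (\<xi> J) *\<^sub>C um (a @ b) (I1 @ I2) J) else 0)"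
      by (simp add: ug_cols sum_idx_add um_append I)
    also have "\<dots> = complex_of_real (ins (length a) \<xi> I) *\<^sub>C 1"
      using ins.IH[of "I1 @ I2"] by (simp add: I ins_append)
    finally show ?case .
  qed
  from assms(1) show ?thesis
    unfolding NC_def
  proof (induction rule: fspan.induct)
    case (add f g c)
    have "(\<Sum>J\<in>idx (length w). complex_of_real c *\<^sub>C (complex_of_real (g J) *\<^sub>C um w I J)) =
        complex_of_real c *\<^sub>C (complex_of_real (g I) *\<^sub>C 1)"
      using pairing[of w g I] add.hyps(2) assms(2) by (simp only: cvec.scale_sum_right[symmetric] mem_Collect_eq)
    with add.IH show ?case by (simp add: scaleC_add_left sum.distrib scaleC_scaleC)
  qed simp
qed

section \<open>The Haar state\<close>

text \<open>Polarization: the values at 1 + x and at 1 + i x are real, and these two facts are the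
  imaginary and the real part of the claim.\<close>

lemma positive_functional_hermitian:
  fixes f :: "'a::complex_star_algebra \<Rightarrow> complex"
  assumes "clinear f" "\<And>x. f (star x * x) \<ge> 0"
  shows "f (star x) = cnj (f x)"
proof -
  note lin = clinear_simps[OF assms(1)]
  have "Im (f (star (1 + c *\<^sub>C x) * (1 + c *\<^sub>C x))) = 0" "Im (f (star x * x)) = 0" "Im (f (star 1 * 1)) = 0"
    for c
    using assms(2)[of "1 + c *\<^sub>C x"] assms(2)[of x] assms(2)[of 1] by (simp_all add: less_eq_complex_def)
  from this(1)[of 1] this(1)[of \<i>] this(2,3)
  have "Im (f x) + Im (f (star x)) = 0" "Re (f x) = Re (f (star x))"
    by (simp_all add: star_add star_scaleC star_one distrib_left distrib_right left_diff_distrib lin scaleC_complex_def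
        mult_scaleC_left mult_scaleC_right scaleC_scaleC)
  then show ?thesis by (simp add: complex_eq_iff)
qed

text \<open>A fixed vector of a word with an additional letter \<open>c\<close>, read as a matrix,
  intertwines \<open>w\<close> with the conjugate of \<open>c\<close>. Multiplying by the conjugate
  letter and summing gives the same intertwining equation whether \<open>c\<close> stands first or
  last.\<close>

lemma fixed_vector_half:
  fixes w :: "letter list" and \<xi> :: "'n::finite list \<Rightarrow> complex"
  assumes "length I = length w"
    and "(\<forall>p. (\<Sum>q\<in>UNIV. \<Sum>J\<in>idx (length w). \<xi> (q # J) *\<^sub>C (ug c p q * um w I J)) = \<xi> (p # I) *\<^sub>C 1) \<or>
      (\<forall>p. (\<Sum>q\<in>UNIV. \<Sum>J\<in>idx (length w). \<xi> (q # J) *\<^sub>C (um w I J * ug c p q)) = \<xi> (p # I) *\<^sub>C 1)"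
  shows "(\<Sum>J\<in>idx (length w). \<xi> (r # J) *\<^sub>C um w I J) = (\<Sum>p\<in>UNIV. \<xi> (p # I) *\<^sub>C ug (flip c) p r)"
  using assms(2)
proof
  assume *: "\<forall>p. (\<Sum>q\<in>UNIV. \<Sum>J\<in>idx (length w). \<xi> (q # J) *\<^sub>C (ug c p q * um w I J)) = \<xi> (p # I) *\<^sub>C 1"
  have "(\<Sum>p\<in>UNIV. \<xi> (p # I) *\<^sub>C ug (flip c) p r) = (\<Sum>p\<in>UNIV. ug (flip c) p r *
      (\<Sum>q\<in>UNIV. \<Sum>J\<in>idx (length w). \<xi> (q # J) *\<^sub>C (ug c p q * um w I J)))"
    by (simp add: * mult_scaleC_right)
  also have "\<dots> = (\<Sum>q\<in>UNIV. \<Sum>J\<in>idx (length w). \<xi> (q # J) *\<^sub>C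
      ((\<Sum>p\<in>UNIV. ug (flip c) p r * ug (flip (flip c)) p q) * um w I J))"
    by (simp add: sum_distrib_left sum_distrib_right cvec.scale_sum_right mult_scaleC_right mult.assoc)
      (subst sum.swap, rule sum.cong, rule HOL.refl, subst sum.swap, rule HOL.refl)
  also have "\<dots> = (\<Sum>J\<in>idx (length w). \<xi> (r # J) *\<^sub>C um w I J)"
    unfolding ug_rows by (subst sum.swap) (simp add: if_distrib[of "\<lambda>x. x * _"] if_distrib[of "scaleC _"] cong: if_cong)
  finally show ?thesis ..
next
  assume *: "\<forall>p. (\<Sum>q\<in>UNIV. \<Sum>J\<in>idx (length w). \<xi> (q # J) *\<^sub>C (um w I J * ug c p q)) = \<xi> (p # I) *\<^sub>C 1"
  have "(\<Sum>p\<in>UNIV. \<xi> (p # I) *\<^sub>C ug (flip c) p r) = (\<Sum>p\<in>UNIV.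
      (\<Sum>q\<in>UNIV. \<Sum>J\<in>idx (length w). \<xi> (q # J) *\<^sub>C (um w I J * ug c p q)) * ug (flip c) p r)"
    by (simp add: * mult_scaleC_left)
  also have "\<dots> = (\<Sum>q\<in>UNIV. \<Sum>J\<in>idx (length w). \<xi> (q # J) *\<^sub>C
      (um w I J * (\<Sum>p\<in>UNIV. ug c p q * ug (flip c) p r)))"
    by (simp add: sum_distrib_left sum_distrib_right cvec.scale_sum_right mult_scaleC_left mult.assoc)
      (subst sum.swap, rule sum.cong, rule HOL.refl, subst sum.swap, rule HOL.refl)
  also have "\<dots> = (\<Sum>J\<in>idx (length w). \<xi> (r # J) *\<^sub>C um w I J)"
    unfolding ug_rows by (subst sum.swap) (simp add: if_distrib[of "\<lambda>x. _ * x"] if_distrib[of "scaleC _"] cong: if_cong)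
  finally show ?thesis ..
qed

text \<open>Fixed vectors survive the cyclic rotation of the word. This combines the unitarity of u
  with that of its conjugate and is the source of the trace property.\<close>

lemma fixed_vector_rotate_left:
  fixes w :: "letter list" and \<xi> :: "'n::finite list \<Rightarrow> complex"
  assumes "length I = length w"
    and "\<And>p. (\<Sum>q\<in>UNIV. \<Sum>J\<in>idx (length w). \<xi> (q # J) *\<^sub>C (ug c p q * um w I J)) = \<xi> (p # I) *\<^sub>C 1"
  shows "(\<Sum>q\<in>UNIV. \<Sum>J\<in>idx (length w). \<xi> (q # J) *\<^sub>C (um w I J * ug c p q)) = \<xi> (p # I) *\<^sub>C 1"
proof -
  note half = fixed_vector_half[OF assms(1) disjI1, of \<xi> c]
  have "(\<Sum>q\<in>UNIV. \<Sum>J\<in>idx (length w). \<xi> (q # J) *\<^sub>C (um w I J * ug c p q)) =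
      (\<Sum>q\<in>UNIV. (\<Sum>J\<in>idx (length w). \<xi> (q # J) *\<^sub>C um w I J) * ug c p q)"
    by (simp add: sum_distrib_right mult_scaleC_left)
  also have "\<dots> = (\<Sum>s\<in>UNIV. \<xi> (s # I) *\<^sub>C (\<Sum>q\<in>UNIV. ug (flip c) s q * ug (flip (flip c)) p q))"
    using assms(2) by (subst half)
      (simp_all add: sum_distrib_right mult_scaleC_left cvec.scale_sum_right, rule sum.swap)
  also have "\<dots> = \<xi> (p # I) *\<^sub>C 1"
    unfolding ug_cols by (simp add: if_distrib[of "scaleC _"] cong: if_cong)
  finally show ?thesis .
qed

lemma fixed_vector_rotate_right:
  fixes w :: "letter list" and \<xi> :: "'n::finite list \<Rightarrow> complex"
  assumes "length I = length w"
    and "\<And>p. (\<Sum>q\<in>UNIV. \<Sum>J\<in>idx (length w). \<xi> (q # J) *\<^sub>C (um w I J * ug c p q)) = \<xi> (p # I) *\<^sub>C 1"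
  shows "(\<Sum>q\<in>UNIV. \<Sum>J\<in>idx (length w). \<xi> (q # J) *\<^sub>C (ug c p q * um w I J)) = \<xi> (p # I) *\<^sub>C 1"
proof -
  note half = fixed_vector_half[OF assms(1) disjI2, of \<xi> c]
  have "(\<Sum>q\<in>UNIV. \<Sum>J\<in>idx (length w). \<xi> (q # J) *\<^sub>C (ug c p q * um w I J)) =
      (\<Sum>q\<in>UNIV. ug c p q * (\<Sum>J\<in>idx (length w). \<xi> (q # J) *\<^sub>C um w I J))"
    by (simp add: sum_distrib_left mult_scaleC_right)
  also have "\<dots> = (\<Sum>s\<in>UNIV. \<xi> (s # I) *\<^sub>C (\<Sum>q\<in>UNIV. ug c p q * ug (flip c) s q))"
    using assms(2) by (subst half)
      (simp_all add: sum_distrib_left mult_scaleC_right cvec.scale_sum_right, rule sum.swap)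
  also have "\<dots> = \<xi> (p # I) *\<^sub>C 1"
    unfolding ug_cols by (simp add: if_distrib[of "scaleC _"] cong: if_cong)
  finally show ?thesis .
qed

locale haar =
  fixes h :: "'n::finite free_unitary \<Rightarrow> complex"
  assumes haar: "haar_state h"
begin

lemma h_clinear: "clinear h"
  using haar by (simp add: haar_state_def)

lemmas h_simps = clinear_simps[OF h_clinear, unfolded scaleC_complex_def] clinear_sum[OF h_clinear]

lemma h_one: "h 1 = 1"
  using haar by (simp add: haar_state_def)

lemma h_pos: "h (star x * x) \<ge> 0"
  using haar by (simp add: haar_state_def)

lemma h_star: "h (star x) = cnj (h x)"
  by (rule positive_functional_hermitian[OF h_clinear h_pos])

lemma left_invariant:
  assumes "length I = length w" "length J = length w"
  shows "(\<Sum>K\<in>idx (length w). h (um w I K) *\<^sub>C um w K J) = h (um w I J) *\<^sub>C 1"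
proof -
  have "slice_left h (coproduct (um w I J)) = h (um w I J) *\<^sub>C 1"
    using haar by (simp add: haar_state_def)
  then show ?thesis by (simp add: coproduct_um[OF assms] slice_left_sum[OF h_clinear])
qed

lemma right_invariant:
  assumes "length I = length w" "length J = length w"
  shows "(\<Sum>K\<in>idx (length w). h (um w K J) *\<^sub>C um w I K) = h (um w I J) *\<^sub>C 1"
proof -
  have "slice_right h (coproduct (um w I J)) = h (um w I J) *\<^sub>C 1"
    using haar by (simp add: haar_state_def)
  then show ?thesis by (simp add: coproduct_um[OF assms] slice_right_sum[OF h_clinear])
qed

text \<open>Let H and K be the matrices of \<open>h\<close> and of \<open>ker\<close> on
  \<open>w\<close>. The functional of K, applied to left invariance, gives H K = H; applying
  \<open>h\<close> to the fixed columns of K gives H K = K.\<close>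

lemma h_um:
  assumes "length I = length w" "length J = length w"
  shows "h (um w I J) = of_real (ker w I J)"
proof -
  note f = clinear_simps[OF clinear_ker_functional] clinear_sum[OF clinear_ker_functional]
  have "ker_functional (\<Sum>K\<in>idx (length w). h (um w I K) *\<^sub>C um w K J) = h (um w I J)"
    by (simp only: left_invariant[OF assms] f ker_functional_one) (simp add: scaleC_complex_def)
  then have "(\<Sum>K\<in>idx (length w). h (um w I K) * of_real (ker w K J)) = h (um w I J)"
    by (simp add: f ker_functional_um assms scaleC_complex_def)
  moreover have "h (\<Sum>K\<in>idx (length w). complex_of_real (ker w K J) *\<^sub>C um w I K) = of_real (ker w I J)"
    using NC_fixed[OF ker_NC assms(1)] by (simp only: h_simps h_one) simp
  then have "(\<Sum>K\<in>idx (length w). of_real (ker w K J) * h (um w I K)) = of_real (ker w I J)"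
    by (simp add: h_simps)
  ultimately show ?thesis by (simp add: mult.commute)
qed

lemma h_um_sym:
  assumes "length I = length w" "length J = length w"
  shows "h (um w I J) = h (um w J I)"
  by (simp add: h_um assms ker_sym[of w I])

lemma h_um_real:
  assumes "length I = length w" "length J = length w"
  shows "cnj (h (um w I J)) = h (um w I J)"
  by (simp add: h_um assms)

lemma h_idempotent:
  assumes "length I = length w" "length J = length w"
  shows "(\<Sum>K\<in>idx (length w). h (um w I K) * h (um w K J)) = h (um w I J)"
  using arg_cong[OF left_invariant[OF assms], of h] by (simp add: h_simps h_one)

text \<open>\<open>A\<close> and \<open>B\<close> are the matrices of \<open>h\<close> on
  \<open>c # w\<close> and on \<open>w @ [c]\<close>. Their columns are fixed vectors, which
  correspond under rotation, so B A = A and A B = B. Both are symmetric, and transposing the first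
  equation gives A = A B = B.\<close>

lemma trace_ug_um:
  assumes "length I = length w" "length J = length w"
  shows "h (ug c p q * um w I J) = h (um w I J * ug c p q)"
proof -
  define A where "A p I q J = h (ug c p q * um w I J)" for p I q J
  define B where "B p I q J = h (um w I J * ug c p q)" for p I q J
  have A: "A p I q J = h (um (c # w) (p # I) (q # J))" for p I q J
    by (simp add: A_def)
  have B: "B p I q J = h (um (w @ [c]) (I @ [p]) (J @ [q]))"
    if "length I = length w" "length J = length w" for p I q J
    by (simp add: B_def um_append that)
  have A_sym: "A p I q J = A q J p I" if "length I = length w" "length J = length w" for p I q J
    unfolding A by (rule h_um_sym) (use that in auto)
  have B_sym: "B p I q J = B q J p I" if "length I = length w" "length J = length w" for p I q J
    unfolding B[OF that] B[OF that(2,1)] by (rule h_um_sym) (use that in auto)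
  have AB: "(\<Sum>q\<in>UNIV. \<Sum>J\<in>idx (length w). A q J r K * B p I q J) = A p I r K"
    if "length I = length w" "length K = length w" for p I r K
  proof -
    define \<xi> where "\<xi> L = h (um (c # w) L (r # K))" for L
    have "(\<Sum>q\<in>UNIV. \<Sum>J\<in>idx (length w). \<xi> (q # J) *\<^sub>C (ug c p q * um w I J)) = \<xi> (p # I) *\<^sub>C 1" for p
      using right_invariant[of "p # I" "c # w" "r # K"] that by (simp add: sum_idx_Suc \<xi>_def)
    from arg_cong[OF fixed_vector_rotate_left[OF that(1) this, of p], of h]
    show ?thesis by (simp add: h_simps h_one A_def B_def \<xi>_def)
  qed
  have BA: "(\<Sum>q\<in>UNIV. \<Sum>J\<in>idx (length w). B q J r K * A p I q J) = B p I r K"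
    if "length I = length w" "length K = length w" for p I r K
  proof -
    \<comment> \<open>The first entry of \<open>L\<close> belongs to the letter \<open>c\<close>,
      which stands last in \<open>w @ [c]\<close>; hence the rotation by \<open>tl\<close> and
      \<open>hd\<close>.\<close>
    define \<xi> where "\<xi> L = h (um (w @ [c]) (tl L @ [hd L]) (K @ [r]))" for L
    have "(\<Sum>q\<in>UNIV. \<Sum>J\<in>idx (length w). \<xi> (q # J) *\<^sub>C (um w I J * ug c p q)) = \<xi> (p # I) *\<^sub>C 1" for p
    proof -
      have "(\<Sum>q\<in>UNIV. \<Sum>J\<in>idx (length w). \<xi> (q # J) *\<^sub>C (um w I J * ug c p q)) =
          (\<Sum>L\<in>idx (length (w @ [c])). h (um (w @ [c]) L (K @ [r])) *\<^sub>C um (w @ [c]) (I @ [p]) L)"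
        using that unfolding sum_idx_snoc by (subst sum.swap) (simp add: um_append \<xi>_def)
      also have "\<dots> = \<xi> (p # I) *\<^sub>C 1"
        using that by (subst right_invariant) (auto simp: \<xi>_def)
      finally show ?thesis .
    qed
    from arg_cong[OF fixed_vector_rotate_right[OF that(1) this, of p], of h]
    show ?thesis using that by (simp add: h_simps h_one A_def B \<xi>_def)
  qed
  have "A p I q J = A q J p I" by (rule A_sym[OF assms])
  also have "\<dots> = (\<Sum>r\<in>UNIV. \<Sum>K\<in>idx (length w). A r K p I * B q J r K)"
    using AB[of J I p q] assms by simp
  also have "\<dots> = (\<Sum>r\<in>UNIV. \<Sum>K\<in>idx (length w). B r K q J * A p I r K)"
    using assms by (intro sum.cong HOL.refl) (simp add: A_sym[of I _ p] B_sym[of J _ q] mult.commute)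
  also have "\<dots> = B p I q J" using BA[of I J q p] assms by simp
  finally show ?thesis by (simp add: A_def B_def)
qed

lemma trace_ug: "h (ug c p q * x) = h (x * ug c p q)"
  by (induction x rule: free_unitary_induct)
    (simp_all add: trace_ug_um distrib_left distrib_right h_simps mult_scaleC_left mult_scaleC_right)

lemma trace: "h (x * y) = h (y * x)"
proof (induction x arbitrary: y rule: free_unitary_induct)
  case (um w I J)
  then show ?case
  proof (induction arbitrary: y rule: length_induct3)
    case (Cons c w i I j J)
    have "h (um (c # w) (i # I) (j # J) * y) = h (um w I J * (y * ug c i j))"
      by (simp add: mult.assoc trace_ug)
    also have "\<dots> = h (y * um (c # w) (i # I) (j # J))"
      by (simp add: Cons.IH mult.assoc)
    finally show ?case .
  qed simp
qed (simp_all add: distrib_left distrib_right h_simps mult_scaleC_left mult_scaleC_right)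

end

section \<open>The central algebra\<close>

definition tensor_lift :: "('a \<Rightarrow> 'b \<Rightarrow> 'c::ab_group_add) \<Rightarrow>
    ('a::complex_star_algebra, 'b::complex_star_algebra) tensor \<Rightarrow> 'c" where
  "tensor_lift F t = (\<Sum>(a, b)\<in>#rep_tensor t. F a b)"

text \<open>The condition for \<open>F\<close> to respect the congruence that defines tensors.
  Scalars are only moved across, so the target may be any abelian group.\<close>

definition balanced :: "('a::complex_star_algebra \<Rightarrow> 'b::complex_star_algebra \<Rightarrow> 'c::ab_group_add) \<Rightarrow> bool" where
  "balanced F \<longleftrightarrow> (\<forall>a a' b. F (a + a') b = F a b + F a' b) \<and>
    (\<forall>a b b'. F a (b + b') = F a b + F a b') \<and> (\<forall>c a b. F (c *\<^sub>C a) b = F a (c *\<^sub>C b))"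

lemma tensor_lift_abs:
  assumes "balanced F"
  shows "tensor_lift F (abs_tensor s) = (\<Sum>(a, b)\<in>#s. F a b)"
proof -
  have F0: "F 0 b = 0" for b using assms unfolding balanced_def by (metis add_cancel_right_left)
  have eq: "(\<Sum>(a, b)\<in>#s. F a b) = (\<Sum>(a, b)\<in>#t. F a b)" if "tensor_eq s t" for s t
    using that assms by induction (simp_all add: F0 balanced_def)
  show ?thesis unfolding tensor_lift_def
    by (rule eq) (metis Quotient3_rep_abs Quotient3_tensor tensor_eq.refl)
qed

lemma tensor_lift_add:
  "balanced F \<Longrightarrow> tensor_lift F (s + t) = tensor_lift F s + tensor_lift F t"
  by (induction s; induction t) (simp add: plus_tensor.abs_eq tensor_lift_abs)

lemma tensor_lift_pure: "balanced F \<Longrightarrow> tensor_lift F (a \<otimes> b) = F a b"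
  by (simp add: pure_tensor.abs_eq tensor_lift_abs)

lemma tensor_lift_sum:
  assumes "balanced F"
  shows "tensor_lift F (\<Sum>i\<in>A. f i) = (\<Sum>i\<in>A. tensor_lift F (f i))"
proof -
  have "tensor_lift F 0 = 0" by (simp add: zero_tensor_def tensor_lift_abs[OF assms])
  then show ?thesis
    by (induction A rule: infinite_finite_induct) (simp_all add: tensor_lift_add[OF assms])
qed

lemma tensor_lift_scaleC:
  fixes F :: "_ \<Rightarrow> _ \<Rightarrow> 'c::complex_star_algebra"
  assumes "balanced F" "\<And>c a b. F (c *\<^sub>C a) b = c *\<^sub>C F a b"
  shows "tensor_lift F (c *\<^sub>C t) = c *\<^sub>C tensor_lift F t"
proof (induction t)
  case (1 s)
  have "(\<Sum>(a, b)\<in>#s. c *\<^sub>C F a b) = c *\<^sub>C (\<Sum>(a, b)\<in>#s. F a b)"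
    by (induction s) (auto simp: scaleC_add_right)
  then show ?case
    by (simp add: scaleC_tensor.abs_eq tensor_lift_abs[OF assms(1)] multiset.map_comp comp_def
        case_prod_unfold assms(2))
qed

lemma slice_right_eq_tensor_lift: "slice_right f t = tensor_lift (\<lambda>a b. f b *\<^sub>C a) t"
  by (simp add: slice_right_def tensor_lift_def)

lemma balanced_slice_right: "clinear f \<Longrightarrow> balanced (\<lambda>a b. f b *\<^sub>C a)"
  by (simp add: balanced_def clinear_simps scaleC_add_left scaleC_add_right scaleC_scaleC
      scaleC_complex_def mult.commute)

section \<open>The span of the products of characters\<close>

abbreviation chi_span :: "'n::finite free_unitary set" where
  "chi_span \<equiv> cvec.span (range chi)"

lemma chi_simps [simp]: "chi [] = 1" "chi (c # w) = chi_letter c * chi w" "chi (w @ w') = chi w * chi w'"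
  by (simp_all add: chi_def)

lemma chi_letter_eq: "chi_letter c = (\<Sum>i\<in>UNIV. ug c i i)"
  by (cases c) simp_all

lemma chi_eq_um: "chi w = (\<Sum>M\<in>idx (length w). um w M M)"
  by (induction w) (simp_all add: chi_letter_eq sum_idx_Suc sum_product)

lemma chi_span_chi: "chi w \<in> chi_span"
  by (intro cvec.span_base) auto

lemma chi_span_mult:
  assumes "x \<in> chi_span" "y \<in> chi_span"
  shows "x * y \<in> chi_span"
  using assms(1)
proof (induction rule: cvec.span_induct_alt)
  case base
  show ?case by (simp add: cvec.span_zero)
next
  case (step c x' x)
  then obtain w where w: "x' = chi w" by auto
  have "chi w * y \<in> chi_span"
    using assms(2)
  proof (induction rule: cvec.span_induct_alt)
    case base
    show ?case by (simp add: cvec.span_zero)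
  next
    case (step d y' y)
    then obtain v where v: "y' = chi v" by auto
    have "chi w * y' \<in> chi_span" using chi_span_chi[of "w @ v"] by (simp add: v)
    with step show ?case by (simp add: distrib_left mult_scaleC_right cvec.span_add cvec.span_scale)
  qed
  with step w show ?case by (simp add: distrib_right mult_scaleC_left cvec.span_add cvec.span_scale)
qed

lemma star_chi: "star (chi w) = chi (bar w)"
proof (induction w)
  case (Cons c w)
  have "star (chi_letter c :: 'a free_unitary) = chi_letter (flip c)"
    by (simp add: chi_letter_eq star_sum star_ug)
  with Cons show ?case by (simp add: star_mult)
qed (simp add: star_one)

lemma chi_span_star:
  assumes "x \<in> chi_span"
  shows "star x \<in> chi_span"
  using assms
proof (induction rule: cvec.span_induct_alt)
  case base
  show ?case by (simp add: cvec.span_zero)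
next
  case (step c x' x)
  then show ?case
    by (auto simp: star_add star_scaleC star_chi intro!: cvec.span_add cvec.span_scale chi_span_chi)
qed

lemma chi_central: "(chi w :: 'n::finite free_unitary) \<in> central_algebra"
proof (induction w)
  case Nil
  have "representation 1 (\<lambda>_ _. 1 :: 'n free_unitary)"
    by (simp add: representation_def pure_tensor_one star_hom_simps[OF star_hom_coproduct]
        star_hom_simps[OF star_hom_counit])
  from central_algebra.character[OF this] show ?case by simp
next
  case (Cons c w)
  \<comment> \<open>\<open>representation\<close> indexes matrices by natural numbers, so the index
    type has to be enumerated.\<close>
  obtain e :: "nat \<Rightarrow> 'n" where e: "bij_betw e {..<CARD('n)} UNIV"
    using ex_bij_betw_nat_finite[of "UNIV :: 'n set"] by (auto simp: atLeast0LessThan)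
  have "representation CARD('n) (\<lambda>i j. ug c (e i) (e j))"
    using e by (auto simp: representation_def coproduct_ug counit_ug sum.reindex_bij_betw[OF e, symmetric] bij_betw_def inj_on_def)
  from central_algebra.character[OF this] have "chi_letter c \<in> (central_algebra :: 'n free_unitary set)"
    by (simp add: chi_letter_eq sum.reindex_bij_betw[OF e, of "\<lambda>k. ug c k k"])
  with Cons show ?case by (simp add: central_algebra.mult)
qed

lemma chi_span_subset_central: "chi_span \<subseteq> central_algebra"
proof
  fix x :: "'n::finite free_unitary"
  assume "x \<in> chi_span"
  then show "x \<in> central_algebra"
  proof (induction rule: cvec.span_induct_alt)
    case base
    show ?case using central_algebra.scaleC[OF chi_central[of "[]"], of 0] by simp
  qed (auto intro: central_algebra.add central_algebra.scaleC chi_central)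
qed

text \<open>Pairs a tensor over the word \<open>w @ bar w\<close> with the coefficients of
  \<open>w\<close>. The column index is reversed because the star reverses it in
  \<open>star_um\<close>.\<close>

definition contract :: "letter list \<Rightarrow> ('n list \<Rightarrow> real) \<Rightarrow> 'n::finite free_unitary" where
  "contract w \<xi> = (\<Sum>K\<in>idx (length w). \<Sum>L\<in>idx (length w). complex_of_real (\<xi> (K @ rev L)) *\<^sub>C um w K L)"

lemma contract_linear:
  "contract w (\<lambda>x. f x + c * g x) = contract w f + complex_of_real c *\<^sub>C contract w g"
  by (simp add: contract_def scaleC_add_left sum.distrib cvec.scale_sum_right scaleC_scaleC)

lemma sum_swap_out:
  "(\<Sum>k\<in>A. \<Sum>l\<in>B. \<Sum>x\<in>C. g k l x) = (\<Sum>x\<in>C. \<Sum>k\<in>A. \<Sum>l\<in>B. g k l x)"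
  by (subst sum.swap[of _ C]) (subst sum.swap[of _ C], rule HOL.refl)

lemma sum_idx_insert2:
  fixes f :: "'n::finite list \<Rightarrow> 'n list \<Rightarrow> 'b::comm_monoid_add" and a b :: "letter list"
  shows "(\<Sum>K\<in>idx (length (a @ c # c' # b)). \<Sum>L\<in>idx (length (a @ c # c' # b)). f K L) =
    (\<Sum>K1\<in>idx (length a). \<Sum>K2\<in>idx (length b). \<Sum>L1\<in>idx (length a). \<Sum>L2\<in>idx (length b).
      \<Sum>k\<in>UNIV. \<Sum>k'\<in>UNIV. \<Sum>l\<in>UNIV. \<Sum>l'\<in>UNIV. f (K1 @ k # k' # K2) (L1 @ l # l' # L2))"
proof -
  have 1: "(\<Sum>K\<in>idx (length (a @ c # c' # b)). g K) =
    (\<Sum>K1\<in>idx (length a). \<Sum>K2\<in>idx (length b). \<Sum>k\<in>UNIV. \<Sum>k'\<in>UNIV. g (K1 @ k # k' # K2))"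
    for g :: "'n list \<Rightarrow> 'b"
    unfolding sum_idx_insert by (rule sum.cong[OF HOL.refl]) (rule sum_swap_out)
  show ?thesis
    unfolding 1
  proof (intro sum.cong HOL.refl)
    fix K1 K2
    show "(\<Sum>k\<in>UNIV. \<Sum>k'\<in>UNIV. \<Sum>L1\<in>idx (length a). \<Sum>L2\<in>idx (length b). \<Sum>l\<in>UNIV. \<Sum>l'\<in>UNIV.
        f (K1 @ k # k' # K2) (L1 @ l # l' # L2)) =
      (\<Sum>L1\<in>idx (length a). \<Sum>L2\<in>idx (length b). \<Sum>k\<in>UNIV. \<Sum>k'\<in>UNIV. \<Sum>l\<in>UNIV. \<Sum>l'\<in>UNIV.
        f (K1 @ k # k' # K2) (L1 @ l # l' # L2))"
      by (subst sum_swap_out) (rule sum.cong[OF HOL.refl], rule sum_swap_out)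
  qed
qed

lemma sum_contract_rows:
  "(\<Sum>k\<in>UNIV. \<Sum>k'\<in>UNIV. \<Sum>l\<in>UNIV. \<Sum>l'\<in>UNIV. (if k = k' then x l l' else 0) *\<^sub>C
      (a * (ug c k l * ug (flip c) k' l') * b)) = (\<Sum>l\<in>UNIV. x l l) *\<^sub>C (a * b)"
proof -
  have "(\<Sum>k'\<in>UNIV. \<Sum>l\<in>UNIV. \<Sum>l'\<in>UNIV. (if k = k' then x l l' else 0) *\<^sub>C
      (a * (ug c k l * ug (flip c) k' l') * b)) =
      (\<Sum>l\<in>UNIV. \<Sum>l'\<in>UNIV. x l l' *\<^sub>C (a * (ug c k l * ug (flip c) k l') * b))" for k
    by (subst sum_swap_out[symmetric]) (simp add: if_distrib[of "\<lambda>x. x *\<^sub>C _"] cong: if_cong)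
  then have "(\<Sum>k\<in>UNIV. \<Sum>k'\<in>UNIV. \<Sum>l\<in>UNIV. \<Sum>l'\<in>UNIV. (if k = k' then x l l' else 0) *\<^sub>C
      (a * (ug c k l * ug (flip c) k' l') * b)) =
      (\<Sum>k\<in>UNIV. \<Sum>l\<in>UNIV. \<Sum>l'\<in>UNIV. x l l' *\<^sub>C (a * (ug c k l * ug (flip c) k l') * b))"
    by simp
  also have "\<dots> = (\<Sum>l\<in>UNIV. \<Sum>l'\<in>UNIV. x l l' *\<^sub>C (a * (\<Sum>k\<in>UNIV. ug c k l * ug (flip c) k l') * b))"
    by (subst sum_swap_out[symmetric]) (simp add: sum_distrib_left sum_distrib_right cvec.scale_sum_right)
  also have "\<dots> = (\<Sum>l\<in>UNIV. x l l *\<^sub>C (a * b))"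
    unfolding ug_rows by (simp add: if_distrib[of "\<lambda>x. _ *\<^sub>C x"] if_distrib[of "\<lambda>x. x * _"]
        if_distrib[of "\<lambda>x. _ * x"] cong: if_cong)
  finally show ?thesis by (simp add: cvec.scale_sum_left)
qed

lemma sum_contract_cols:
  "(\<Sum>k\<in>UNIV. \<Sum>k'\<in>UNIV. \<Sum>l\<in>UNIV. \<Sum>l'\<in>UNIV. (if l' = l then x k k' else 0) *\<^sub>C
      (a * (ug c k l * ug (flip c) k' l') * b)) = (\<Sum>k\<in>UNIV. x k k) *\<^sub>C (a * b)"
proof -
  have "(\<Sum>k\<in>UNIV. \<Sum>k'\<in>UNIV. \<Sum>l\<in>UNIV. \<Sum>l'\<in>UNIV. (if l' = l then x k k' else 0) *\<^sub>C
      (a * (ug c k l * ug (flip c) k' l') * b)) =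
      (\<Sum>k\<in>UNIV. \<Sum>k'\<in>UNIV. x k k' *\<^sub>C (a * (\<Sum>l\<in>UNIV. ug c k l * ug (flip c) k' l) * b))"
    by (simp add: if_distrib[of "\<lambda>x. x *\<^sub>C _"] sum_distrib_left sum_distrib_right
        cvec.scale_sum_right cong: if_cong)
  also have "\<dots> = (\<Sum>k\<in>UNIV. x k k *\<^sub>C (a * b))"
    unfolding ug_cols by (simp add: if_distrib[of "\<lambda>x. _ *\<^sub>C x"] if_distrib[of "\<lambda>x. x * _"]
        if_distrib[of "\<lambda>x. _ * x"] cong: if_cong)
  finally show ?thesis by (simp add: cvec.scale_sum_left)
qed

text \<open>A pair within the row half equates two neighbouring row indices. Summing over them
  produces \<open>ug_rows\<close>, which equates the column indices: a cap in the column half of the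
  smaller tensor.\<close>

lemma contract_ins_left:
  fixes \<xi> :: "'n::finite list \<Rightarrow> real"
  shows "contract (a @ c # flip c # b) (ins (length a) \<xi>) =
    contract (a @ b) (cap (length a + length b + length b) \<xi>)"
proof -
  have "complex_of_real (ins (length a) \<xi> ((K1 @ k # k' # K2) @ rev (L1 @ l # l' # L2))) *\<^sub>C
      um (a @ c # flip c # b) (K1 @ k # k' # K2) (L1 @ l # l' # L2) =
    (if k = k' then complex_of_real (\<xi> (K1 @ K2 @ rev L2 @ l' # l # rev L1)) else 0) *\<^sub>C
      (um a K1 L1 * (ug c k l * ug (flip c) k' l') * um b K2 L2)"
    if "length K1 = length a" "length L1 = length a" for K1 K2 L1 L2 k k' l l'
    by (simp add: ins_append um_append that mult.assoc)
  moreover have "cap (length a + length b + length b) \<xi> (K1 @ K2 @ rev L2 @ rev L1) =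
     (\<Sum>l\<in>UNIV. \<xi> (K1 @ K2 @ rev L2 @ l # l # rev L1))"
    if "length K1 = length a" "length K2 = length b" "length L2 = length b" for K1 K2 L1 L2
    using cap_append[of "K1 @ K2 @ rev L2" "length a + length b + length b" \<xi> "rev L1"] that by simp
  ultimately show ?thesis
    unfolding contract_def sum_idx_insert2
    by (simp add: sum_contract_rows sum_idx_add um_append cong: sum.cong_simp)
qed

text \<open>The mirror image: a pair within the column half becomes, by \<open>ug_cols\<close>, a
  cap in the row half.\<close>

lemma contract_ins_right:
  fixes \<xi> :: "'n::finite list \<Rightarrow> real"
  shows "contract (a @ c # flip c # b) (ins (length a + 2 + length b + length b) \<xi>) =
    contract (a @ b) (cap (length a) \<xi>)"
proof -
  have "complex_of_real (ins (length a + 2 + length b + length b) \<xi> ((K1 @ k # k' # K2) @ rev (L1 @ l # l' # L2))) *\<^sub>C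
      um (a @ c # flip c # b) (K1 @ k # k' # K2) (L1 @ l # l' # L2) =
    (if l' = l then complex_of_real (\<xi> (K1 @ k # k' # K2 @ rev L2 @ rev L1)) else 0) *\<^sub>C
      (um a K1 L1 * (ug c k l * ug (flip c) k' l') * um b K2 L2)"
    if "length K1 = length a" "length L1 = length a" "length K2 = length b" "length L2 = length b"
    for K1 K2 L1 L2 k k' l l'
    using ins_append[of "K1 @ k # k' # K2 @ rev L2" "length a + 2 + length b + length b" \<xi> l' l "rev L1"]
    by (simp add: um_append that mult.assoc)
  then show ?thesis
    unfolding contract_def sum_idx_insert2
    by (simp add: sum_contract_cols sum_idx_add um_append cap_append cong: sum.cong_simp)
qed

text \<open>A pair across the centre joins the last row index to the last column index, which takes
  the trace of the last letter.\<close>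

lemma contract_ins_middle:
  "contract (a @ [c]) (ins (length a) \<xi>) = contract a \<xi> * chi_letter c"
proof -
  have "complex_of_real (ins (length a) \<xi> ((K @ [k]) @ rev (L @ [l]))) *\<^sub>C um (a @ [c]) (K @ [k]) (L @ [l]) =
    (if k = l then complex_of_real (\<xi> (K @ rev L)) *\<^sub>C (um a K L * ug c k l) else 0)"
    if "length K = length a" "length L = length a" for K L k l
    by (simp add: ins_append um_append that)
  then have "contract (a @ [c]) (ins (length a) \<xi>) =
    (\<Sum>K\<in>idx (length a). \<Sum>k\<in>UNIV. \<Sum>L\<in>idx (length a). complex_of_real (\<xi> (K @ rev L)) *\<^sub>C (um a K L * ug c k k))"
    unfolding contract_def sum_idx_snoc by (simp cong: sum.cong_simp)
  also have "\<dots> = contract a \<xi> * chi_letter c"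
    by (simp add: contract_def chi_letter_eq sum_distrib_left sum_distrib_right mult_scaleC_left)
      (rule sum.swap)
  finally show ?thesis .
qed

text \<open>The pair inserted last lies in the row half, in the column half, or across the centre.
  In each case it can be removed, at the price of a cap or of a factor \<open>chi_letter c\<close>,
  and the word becomes shorter.\<close>

lemma contract_in_chi_span:
  fixes \<xi> :: "'n::finite list \<Rightarrow> real"
  assumes "\<xi> \<in> NC (w @ bar w)"
  shows "contract w \<xi> \<in> chi_span"
  using assms
proof (induction "length w" arbitrary: w \<xi> rule: less_induct)
  case less
  have pairing: "contract w \<xi> \<in> chi_span" if "pairing (w @ bar w) \<xi>" for \<xi> :: "'n list \<Rightarrow> real"
    using that
  proof cases
    case Nil
    then show ?thesis using chi_span_chi[of "[]"] by (simp add: contract_def scaleC_one)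
  next
    case (ins a b \<xi>' c)
    have \<xi>': "\<xi>' \<in> NC (a @ b)" using ins(3) by (auto simp: NC_def intro: fspan_base)
    obtain us where "a @ us = w \<and> c # flip c # b = us @ bar w \<or> a = w @ us \<and> us @ c # flip c # b = bar w"
      using ins(1)[symmetric] append_eq_append_conv2[of a "c # flip c # b" w "bar w"] by blast
    \<comment> \<open>In the first two cases \<open>us\<close> is the rest of \<open>w\<close> from
      the start of the pair: two letters or more put the pair inside \<open>w\<close>, one letter
      puts it across the centre.\<close>
    then consider "a @ us = w" "c # flip c # b = us @ bar w" "us \<noteq> []" "tl us \<noteq> []"
      | "a @ us = w" "c # flip c # b = us @ bar w" "us \<noteq> []" "tl us = []"
      | "a = w @ us" "us @ c # flip c # b = bar w"
      by (cases "us = []"; cases "tl us = []") auto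
    then show ?thesis
    proof cases
      case 1
      then obtain w2 where w: "w = a @ c # flip c # w2" and b: "b = w2 @ bar w"
        by (cases us; cases "tl us") auto
      have "contract (a @ w2) (cap (length (a @ w2 @ bar w2)) \<xi>') \<in> chi_span"
        using cap_NC[of \<xi>' "a @ w2 @ bar w2" c "bar a"] \<xi>' by (intro less.hyps) (auto simp: w b)
      then show ?thesis by (simp add: w ins(2) contract_ins_left add.assoc)
    next
      case 2
      then have w: "w = a @ [c]" and b: "b = bar a" by (cases us; auto)+
      have "contract a \<xi>' \<in> chi_span"
        using \<xi>' by (intro less.hyps) (auto simp: w b)
      moreover have "(chi_letter c :: 'n free_unitary) \<in> chi_span" using chi_span_chi[of "[c]"] by simp
      ultimately show ?thesis by (simp add: w ins(2) contract_ins_middle chi_span_mult)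
    next
      case 3
      define v where "v = bar us"
      have us: "us = bar v" by (simp add: v_def)
      have "w = bar (us @ c # flip c # b)" using 3 by simp
      then have w: "w = bar b @ c # flip c # v" by (simp add: us)
      have "contract (bar b @ v) (cap (length (bar b)) \<xi>') \<in> chi_span"
        using cap_NC[of \<xi>' "bar b" c "v @ bar v @ b"] \<xi>' by (intro less.hyps) (auto simp: w 3 us)
      then show ?thesis
        using contract_ins_right[of "bar b" c v \<xi>'] by (simp add: w ins(2) 3(1) us add.assoc)
    qed
  qed
  from less.prems show ?case
    unfolding NC_def
  proof (induction rule: fspan.induct)
    case zero
    show ?case by (simp add: contract_def cvec.span_zero)
  next
    case (add f g c)
    then show ?case by (simp add: contract_linear cvec.span_add cvec.span_scale pairing)
  qed
qed

context haar
begin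

text \<open>This is \<open>h (a S(z))\<close>, with \<open>S\<close> the antipode.\<close>

definition antipode_pairing :: "'n free_unitary \<Rightarrow> 'n free_unitary \<Rightarrow> complex" where
  "antipode_pairing a = extend (\<lambda>m. h (a * star (gmon (map (\<lambda>(c, i, j). (c, j, i)) m))))"

lemma admissible_antipode_pairing:
  "admissible (\<lambda>m. h (a * star (gmon (map (\<lambda>(c, i, j). (c, j, i)) m))))"
proof (rule admissibleI, goal_cases)
  case (1 c i j m m')
  let ?t = "\<lambda>m. star (gmon (map (\<lambda>(c, i, j). (c, j, i)) m)) :: 'n free_unitary"
  have "(\<Sum>k\<in>UNIV. a * (?t m' * (ug c k j * ug (flip c) k i) * ?t m)) =
      a * (?t m' * (\<Sum>k\<in>UNIV. ug c k j * ug (flip c) k i) * ?t m)"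
    by (simp add: sum_distrib_left sum_distrib_right)
  from arg_cong[OF this, of h] show ?case
    by (simp add: h_simps star_mult star_ug mult.assoc ug_rows)
next
  case (2 c i j m m')
  let ?t = "\<lambda>m. star (gmon (map (\<lambda>(c, i, j). (c, j, i)) m)) :: 'n free_unitary"
  have "(\<Sum>k\<in>UNIV. a * (?t m' * (ug c j k * ug (flip c) i k) * ?t m)) =
      a * (?t m' * (\<Sum>k\<in>UNIV. ug c j k * ug (flip c) i k) * ?t m)"
    by (simp add: sum_distrib_left sum_distrib_right)
  from arg_cong[OF this, of h] show ?case
    by (simp add: h_simps star_mult star_ug mult.assoc ug_cols)
qed

lemma clinear_antipode_pairing: "clinear (antipode_pairing a)"
  unfolding antipode_pairing_def by (rule clinear_extend[OF admissible_antipode_pairing])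

lemma antipode_pairing_um:
  assumes "length I = length w" "length J = length w"
  shows "antipode_pairing a (um w I J) = h (a * star (um w J I))"
proof -
  have "map (\<lambda>(c, i, j). (c, j, i)) (zip w (zip I J)) = zip w (zip J I)"
    using assms by (induction rule: length_induct3) auto
  then show ?thesis
    unfolding antipode_pairing_def um_def by (simp add: extend_gmon[OF admissible_antipode_pairing])
qed

lemma clinear_antipode_pairing_left: "clinear (\<lambda>a. antipode_pairing a z)"
  by (rule clinearI) (simp_all add: antipode_pairing_def extend_def sem_plus sem_scale distrib_right
      mult_scaleC_left h_simps scaleC_complex_def)

text \<open>In Sweedler notation h(x_1 S(x_3)) x_2, the average over the adjoint action, for x =
  \<open>um w I J\<close>.\<close>

definition average :: "letter list \<Rightarrow> 'n list \<Rightarrow> 'n list \<Rightarrow> 'n free_unitary" where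
  "average w I J = (\<Sum>K\<in>idx (length w). \<Sum>L\<in>idx (length w).
     h (um w I K * star (um w J L)) *\<^sub>C um w K L)"

text \<open>The coefficients are values of \<open>h\<close> on \<open>w @ bar w\<close>, so the
  average is the contraction of a column of \<open>ker (w @ bar w)\<close>.\<close>

lemma average_in_chi_span:
  assumes "length I = length w" "length J = length w"
  shows "average w I J \<in> chi_span"
proof -
  have "h (um w I K * star (um w J L)) = complex_of_real (ker (w @ bar w) (K @ rev L) (I @ rev J))"
    if "length K = length w" "length L = length w" for K L
    using that assms h_um[of "I @ rev J" "w @ bar w" "K @ rev L"]
    by (simp add: um_append star_um ker_sym[of _ "K @ rev L"])
  then have "average w I J = contract w (\<lambda>Z. ker (w @ bar w) Z (I @ rev J))"
    by (simp add: average_def contract_def cong: sum.cong_simp)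
  then show ?thesis using contract_in_chi_span[OF ker_NC] by simp
qed

text \<open>In Sweedler notation h(a S(b_2)) b_1. Applied to the two legs of the coproduct of x it
  yields the average of x.\<close>

definition adjoint_form :: "'n free_unitary \<Rightarrow> 'n free_unitary \<Rightarrow> 'n free_unitary" where
  "adjoint_form a b = slice_right (antipode_pairing a) (coproduct b)"

lemma adjoint_form_add_left: "adjoint_form (a + a') b = adjoint_form a b + adjoint_form a' b"
proof -
  have "(\<Sum>(x, y)\<in>#s. antipode_pairing (a + a') y *\<^sub>C x) =
      (\<Sum>(x, y)\<in>#s. antipode_pairing a y *\<^sub>C x) + (\<Sum>(x, y)\<in>#s. antipode_pairing a' y *\<^sub>C x)"
    for s :: "('n free_unitary \<times> 'n free_unitary) multiset"
    by (induction s) (auto simp: clinear_simps[OF clinear_antipode_pairing_left] scaleC_add_left)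
  then show ?thesis by (simp add: adjoint_form_def slice_right_def)
qed

lemma adjoint_form_scaleC_left: "adjoint_form (c *\<^sub>C a) b = c *\<^sub>C adjoint_form a b"
proof -
  have "(\<Sum>(x, y)\<in>#s. antipode_pairing (c *\<^sub>C a) y *\<^sub>C x) = c *\<^sub>C (\<Sum>(x, y)\<in>#s. antipode_pairing a y *\<^sub>C x)"
    for s :: "('n free_unitary \<times> 'n free_unitary) multiset"
    by (induction s) (auto simp: clinear_simps[OF clinear_antipode_pairing_left] scaleC_add_right
        scaleC_scaleC scaleC_complex_def)
  then show ?thesis by (simp add: adjoint_form_def slice_right_def)
qed

lemma adjoint_form_add_right: "adjoint_form a (b + b') = adjoint_form a b + adjoint_form a b'"
  by (simp add: adjoint_form_def slice_right_eq_tensor_lift clinear_simps[OF star_hom_linear[OF star_hom_coproduct]]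
      tensor_lift_add[OF balanced_slice_right[OF clinear_antipode_pairing]])

lemma adjoint_form_scaleC_right: "adjoint_form a (c *\<^sub>C b) = c *\<^sub>C adjoint_form a b"
  unfolding adjoint_form_def slice_right_eq_tensor_lift clinear_simps[OF star_hom_linear[OF star_hom_coproduct]]
  by (rule tensor_lift_scaleC[OF balanced_slice_right[OF clinear_antipode_pairing]])
    (simp add: scaleC_scaleC mult.commute)

lemma balanced_adjoint_form: "balanced adjoint_form" "balanced (\<lambda>a b. adjoint_form b a)"
  by (simp_all add: balanced_def adjoint_form_add_left adjoint_form_add_right
      adjoint_form_scaleC_left adjoint_form_scaleC_right)

lemma adjoint_form_um:
  assumes "length I = length w" "length J = length w"
  shows "adjoint_form a (um w I J) = (\<Sum>L\<in>idx (length w). h (a * star (um w J L)) *\<^sub>C um w I L)"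
  unfolding adjoint_form_def coproduct_um[OF assms] slice_right_sum[OF clinear_antipode_pairing]
  by (intro sum.cong HOL.refl) (simp add: antipode_pairing_um assms)

lemma adjoint_form_in_chi_span: "tensor_lift adjoint_form (coproduct x) \<in> chi_span"
proof (induction x rule: free_unitary_induct)
  case (um w I J)
  have "tensor_lift adjoint_form (coproduct (um w I J)) = average w I J"
    by (simp add: coproduct_um um tensor_lift_sum[OF balanced_adjoint_form(1)]
        tensor_lift_pure[OF balanced_adjoint_form(1)] adjoint_form_um average_def cong: sum.cong_simp)
  then show ?case by (simp add: average_in_chi_span um)
qed (simp_all add: clinear_simps[OF star_hom_linear[OF star_hom_coproduct]]
    tensor_lift_add[OF balanced_adjoint_form(1)] tensor_lift_scaleC[OF balanced_adjoint_form(1)]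
    adjoint_form_scaleC_left cvec.span_add cvec.span_scale)

text \<open>With the legs exchanged the form yields h(x_3 S(x_2)) x_1, in which x_3 S(x_2) collapses
  to the counit by \<open>um_rows\<close>.\<close>

lemma adjoint_form_flip: "tensor_lift (\<lambda>a b. adjoint_form b a) (coproduct x) = x"
proof (induction x rule: free_unitary_induct)
  case (um w I J)
  have "tensor_lift (\<lambda>a b. adjoint_form b a) (coproduct (um w I J)) =
      (\<Sum>K\<in>idx (length w). \<Sum>L\<in>idx (length w). h (um w K J * star (um w K L)) *\<^sub>C um w I L)"
    by (simp add: coproduct_um um tensor_lift_sum[OF balanced_adjoint_form(2)]
        tensor_lift_pure[OF balanced_adjoint_form(2)] adjoint_form_um cong: sum.cong_simp)
  also have "\<dots> = (\<Sum>L\<in>idx (length w). h (\<Sum>K\<in>idx (length w). um w K J * star (um w K L)) *\<^sub>C um w I L)"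
    by (subst sum.swap) (simp add: h_simps cvec.scale_sum_left)
  also have "\<dots> = (\<Sum>L\<in>idx (length w). if J = L then um w I L else 0)"
    by (intro sum.cong HOL.refl) (simp add: um_rows um h_simps h_one scaleC_one)
  also have "\<dots> = um w I J" by (simp add: um)
  finally show ?case .
qed (simp_all add: clinear_simps[OF star_hom_linear[OF star_hom_coproduct]]
    tensor_lift_add[OF balanced_adjoint_form(2)] tensor_lift_scaleC[OF balanced_adjoint_form(2)]
    adjoint_form_scaleC_right)

text \<open>The coproduct of a character is invariant under the flip of the two tensor factors.\<close>

lemma character_in_chi_span:
  fixes v :: "nat \<Rightarrow> nat \<Rightarrow> 'n free_unitary"
  assumes "representation d v"
  shows "(\<Sum>i<d. v i i) \<in> chi_span"
proof -
  have coprod: "coproduct (\<Sum>i<d. v i i) = (\<Sum>i<d. \<Sum>k<d. v i k \<otimes> v k i)"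
    using assms by (simp add: representation_def clinear_sum[OF star_hom_linear[OF star_hom_coproduct]])
  have "(\<Sum>i<d. v i i) = tensor_lift (\<lambda>a b. adjoint_form b a) (coproduct (\<Sum>i<d. v i i))"
    by (simp add: adjoint_form_flip)
  also have "\<dots> = (\<Sum>i<d. \<Sum>k<d. adjoint_form (v k i) (v i k))"
    unfolding coprod by (simp add: tensor_lift_sum[OF balanced_adjoint_form(2)]
        tensor_lift_pure[OF balanced_adjoint_form(2)])
  also have "\<dots> = tensor_lift adjoint_form (coproduct (\<Sum>i<d. v i i))"
    unfolding coprod by (subst sum.swap) (simp add: tensor_lift_sum[OF balanced_adjoint_form(1)]
        tensor_lift_pure[OF balanced_adjoint_form(1)])
  \<comment> \<open>By the symmetry of its coproduct the character equals its own average over the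
    adjoint action.\<close>
  finally have eq: "(\<Sum>i<d. v i i) = tensor_lift adjoint_form (coproduct (\<Sum>i<d. v i i))" .
  show ?thesis
    using adjoint_form_in_chi_span[of "\<Sum>i<d. v i i"] unfolding eq[symmetric] .
qed

lemma central_algebra_eq: "(central_algebra :: 'n free_unitary set) = chi_span"
proof (rule antisym[OF subsetI chi_span_subset_central])
  fix x :: "'n free_unitary"
  assume "x \<in> central_algebra"
  then show "x \<in> chi_span"
    by induction (auto intro: character_in_chi_span cvec.span_add cvec.span_scale chi_span_mult)
qed

end

section \<open>Faithfulness and the conditional expectation\<close>

context haar
begin

text \<open>The degenerate case of the Cauchy-Schwarz inequality: positivity at b* + c z is affine
  in c and its conjugate, so the coefficient of c vanishes.\<close>

lemma null_vector:
  assumes "h (star z * z) = 0"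
  shows "h (z * b) = 0"
proof -
  define t where "t = h (b * z)"
  have t': "h (star z * star b) = cnj t"
    using h_star[of "b * z"] by (simp add: t_def star_mult)
  have "0 \<le> Re (h (b * star b)) + 2 * Re (c * t)" for c
  proof -
    have "0 \<le> h (star (star b + c *\<^sub>C z) * (star b + c *\<^sub>C z))" by (rule h_pos)
    also have "\<dots> = h (b * star b) + c * t + cnj (c * t)"
      using assms t' by (simp add: star_add star_scaleC star_star distrib_left distrib_right
          mult_scaleC_left mult_scaleC_right h_simps t_def)
    finally show ?thesis by (simp add: less_eq_complex_def)
  qed
  note bound = this
  have pos: "0 \<le> Re (h (b * star b))"
    using h_pos[of "star b"] by (simp add: less_eq_complex_def star_star)
  have "t = 0"
  proof (rule ccontr)
    assume "t \<noteq> 0"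
    then have "- of_real (Re (h (b * star b)) + 1) / t * t = - of_real (Re (h (b * star b)) + 1)"
      by simp
    with bound[of "- of_real (Re (h (b * star b)) + 1) / t"]
    have "0 \<le> Re (h (b * star b)) + 2 * - (Re (h (b * star b)) + 1)"
      by (simp only: uminus_complex.sel Re_complex_of_real)
    with pos show False by simp
  qed
  then show ?thesis by (simp add: t_def trace)
qed

lemma sum_SIGMA:
  assumes "finite A" "\<And>r. finite (B r)"
  shows "(\<Sum>p\<in>(SIGMA r:A. B r). f p) = (\<Sum>r\<in>A. \<Sum>K\<in>B r. f (r, K))"
  using sum.Sigma[of A B "\<lambda>r K. f (r, K)"] assms by simp

text \<open>Elimination of linear dependencies among the \<open>b r\<close>; it replaces the choice of a basis.\<close>

lemma null_tensor:
  fixes G :: "'n free_unitary \<Rightarrow> 'n free_unitary \<Rightarrow> 'b::complex_star_algebra"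
  assumes "finite R" "\<And>b. clinear (\<lambda>a. G a b)" "\<And>a. clinear (G a)"
    and null: "\<And>x b. (\<And>a. h (x * a) = 0) \<Longrightarrow> G x b = 0"
    and "\<And>a. (\<Sum>r\<in>R. h (x r * a) *\<^sub>C b r) = 0"
  shows "(\<Sum>r\<in>R. G (x r) (b r)) = 0"
  using assms(1,5)
proof (induction R arbitrary: x)
  case (insert r R)
  note left = clinear_simps[OF assms(2)] and right = clinear_simps[OF assms(3)] clinear_sum[OF assms(3)]
  show ?case
  proof (cases "\<forall>a. h (x r * a) = 0")
    case True
    have "(\<Sum>r\<in>R. G (x r) (b r)) = 0"
    proof (rule insert.IH)
      show "(\<Sum>r\<in>R. h (x r * a) *\<^sub>C b r) = 0" for a
        using insert.prems[of a] insert.hyps True by simp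
    qed
    with True null[of "x r" "b r"] insert.hyps show ?thesis by simp
  next
    case False
    \<comment> \<open>The relation at \<open>a0\<close> expresses \<open>b r\<close> through the
      other \<open>b s\<close>; substituting it changes each \<open>x s\<close> by a multiple of
      \<open>x r\<close>.\<close>
    then obtain a0 where a0: "h (x r * a0) \<noteq> 0" by auto
    define l where "l s = h (x s * a0) / h (x r * a0)" for s
    have "(1 / h (x r * a0)) *\<^sub>C (h (x r * a0) *\<^sub>C b r + (\<Sum>s\<in>R. h (x s * a0) *\<^sub>C b s)) = 0"
      using insert.prems[of a0] insert.hyps by simp
    then have "b r + (\<Sum>s\<in>R. l s *\<^sub>C b s) = 0"
      using a0 by (simp add: scaleC_add_right scaleC_scaleC cvec.scale_sum_right l_def scaleC_one)
    then have br: "b r = - (\<Sum>s\<in>R. l s *\<^sub>C b s)" by (simp add: eq_neg_iff_add_eq_0)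
    have "(\<Sum>s\<in>R. G (x s - l s *\<^sub>C x r) (b s)) = 0"
    proof (rule insert.IH)
      fix a
      have "(\<Sum>s\<in>R. h ((x s - l s *\<^sub>C x r) * a) *\<^sub>C b s) =
          (\<Sum>s\<in>R. h (x s * a) *\<^sub>C b s) - h (x r * a) *\<^sub>C (\<Sum>s\<in>R. l s *\<^sub>C b s)"
        by (simp add: left_diff_distrib h_simps mult_scaleC_left cvec.scale_left_diff_distrib
            sum_subtractf cvec.scale_sum_right scaleC_scaleC mult.commute)
      also have "\<dots> = (\<Sum>s\<in>insert r R. h (x s * a) *\<^sub>C b s)"
        using insert.hyps by (simp add: br)
      also have "\<dots> = 0" by (rule insert.prems)
      finally show "(\<Sum>s\<in>R. h ((x s - l s *\<^sub>C x r) * a) *\<^sub>C b s) = 0" .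
    qed
    then have "(\<Sum>s\<in>R. G (x s) (b s)) = G (x r) (\<Sum>s\<in>R. l s *\<^sub>C b s)"
      by (simp add: left right sum_subtractf)
    then show ?thesis using insert.hyps by (simp add: br right)
  qed
qed simp

text \<open>Strong left invariance h(x_1 y) x_2 = h(x y_1) S(y_2): apply left invariance to x y_1
  and multiply by S(y_2) from the right.\<close>

lemma left_invariant_pair:
  assumes "length I = length w" "length J = length w" "length M = length v" "length T = length v"
  shows "(\<Sum>K\<in>idx (length w). h (um w I K * um v M T) *\<^sub>C um w K J) =
    (\<Sum>N\<in>idx (length v). h (um w I J * um v M N) *\<^sub>C star (um v T N))"
proof -
  have inv: "(\<Sum>K\<in>idx (length w). \<Sum>S\<in>idx (length v). h (um w I K * um v M S) *\<^sub>C (um w K J * um v S N)) =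
      h (um w I J * um v M N) *\<^sub>C 1" if "length N = length v" for N
    using left_invariant[of "I @ M" "w @ v" "J @ N"] assms that
    by (simp add: sum_idx_add um_append cong: sum.cong_simp)
  have "(\<Sum>N\<in>idx (length v). h (um w I J * um v M N) *\<^sub>C star (um v T N)) =
     (\<Sum>N\<in>idx (length v). (h (um w I J * um v M N) *\<^sub>C 1) * star (um v T N))"
    by (simp add: mult_scaleC_left)
  also have "\<dots> = (\<Sum>N\<in>idx (length v). \<Sum>K\<in>idx (length w). \<Sum>S\<in>idx (length v).
      h (um w I K * um v M S) *\<^sub>C (um w K J * (um v S N * star (um v T N))))"
    by (simp add: inv[symmetric] sum_distrib_right mult_scaleC_left mult.assoc cong: sum.cong_simp)
  also have "\<dots> = (\<Sum>K\<in>idx (length w). \<Sum>S\<in>idx (length v).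
      h (um w I K * um v M S) *\<^sub>C (um w K J * (\<Sum>N\<in>idx (length v). um v S N * star (um v T N))))"
    by (subst sum_swap_out[symmetric]) (simp add: sum_distrib_left cvec.scale_sum_right)
  also have "\<dots> = (\<Sum>K\<in>idx (length w). h (um w I K * um v M T) *\<^sub>C um w K J)"
    by (simp add: um_cols assms if_distrib[of "\<lambda>x. _ *\<^sub>C x"] if_distrib[of "\<lambda>x. _ * x"]
        cong: if_cong sum.cong_simp)
  finally show ?thesis ..
qed

text \<open>Strong right invariance h(x_2 y) x_1 = h(x y_2) S(y_1), by the same argument.\<close>

lemma right_invariant_pair:
  assumes "length I = length w" "length L = length w" "length T = length v" "length N = length v"
  shows "(\<Sum>K\<in>idx (length w). h (um w K L * um v T N) *\<^sub>C um w I K) =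
    (\<Sum>M\<in>idx (length v). h (um w I L * um v M N) *\<^sub>C star (um v M T))"
proof -
  have inv: "(\<Sum>K\<in>idx (length w). \<Sum>S\<in>idx (length v). h (um w K L * um v S N) *\<^sub>C (um w I K * um v M S)) =
      h (um w I L * um v M N) *\<^sub>C 1" if "length M = length v" for M
    using right_invariant[of "I @ M" "w @ v" "L @ N"] assms that
    by (simp add: sum_idx_add um_append cong: sum.cong_simp)
  have "(\<Sum>M\<in>idx (length v). h (um w I L * um v M N) *\<^sub>C star (um v M T)) =
     (\<Sum>M\<in>idx (length v). (h (um w I L * um v M N) *\<^sub>C 1) * star (um v M T))"
    by (simp add: mult_scaleC_left)
  also have "\<dots> = (\<Sum>M\<in>idx (length v). \<Sum>K\<in>idx (length w). \<Sum>S\<in>idx (length v).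
      h (um w K L * um v S N) *\<^sub>C (um w I K * (um v M S * star (um v M T))))"
    by (simp add: inv[symmetric] sum_distrib_right mult_scaleC_left mult.assoc cong: sum.cong_simp)
  also have "\<dots> = (\<Sum>K\<in>idx (length w). \<Sum>S\<in>idx (length v).
      h (um w K L * um v S N) *\<^sub>C (um w I K * (\<Sum>M\<in>idx (length v). um v M S * star (um v M T))))"
    by (subst sum_swap_out[symmetric]) (simp add: sum_distrib_left cvec.scale_sum_right)
  also have "\<dots> = (\<Sum>K\<in>idx (length w). h (um w K L * um v T N) *\<^sub>C um w I K)"
    by (simp add: um_rows assms if_distrib[of "\<lambda>x. _ *\<^sub>C x"] if_distrib[of "\<lambda>x. _ * x"]
        cong: if_cong sum.cong_simp)
  finally show ?thesis ..
qed

lemma balanced_bilinear: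
  fixes G :: "'c::complex_star_algebra \<Rightarrow> 'd::complex_star_algebra \<Rightarrow> 'e::complex_star_algebra"
  assumes "\<And>b. clinear (\<lambda>a. G a b)" "\<And>a. clinear (G a)"
  shows "balanced G"
  using clinear_simps[OF assms(1)] clinear_simps[OF assms(2)] by (simp add: balanced_def)

text \<open>Let M be the space of all x with h(x a) = 0 for every a. Strong invariance shows that
  the coproduct maps M into M (x) A, with A the whole algebra; the form \<open>G\<close> vanishes on
  M (x) A.\<close>

lemma null_coproduct:
  fixes G :: "'n free_unitary \<Rightarrow> 'n free_unitary \<Rightarrow> 'b::complex_star_algebra"
  assumes x: "\<And>a. h (x * a) = 0"
    and G: "\<And>b. clinear (\<lambda>a. G a b)" "\<And>a. clinear (G a)"
    and null: "\<And>x b. (\<And>a. h (x * a) = 0) \<Longrightarrow> G x b = 0"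
  shows "tensor_lift G (coproduct x) = 0"
proof -
  obtain n :: nat and c w I J where exp: "x = (\<Sum>r<n. c r *\<^sub>C um (w r) (I r) (J r))"
    and len: "\<And>r. length (I r) = length (w r)" "\<And>r. length (J r) = length (w r)"
    by (rule free_unitary_expansion[of x], rule that)
  define R where "R = (SIGMA r:{..<n}. (idx (length (w r)) :: 'n list set))"
  define X where "X = (\<lambda>(r, K). c r *\<^sub>C um (w r) (I r) K)"
  define B where "B = (\<lambda>(r, K). um (w r) K (J r))"
  note bal = balanced_bilinear[OF G]
  have fin: "finite R" by (simp add: R_def)
  \<comment> \<open>The left side is h(x_1 a) x_2, which equals h(x a_1) S(a_2) and hence 0.\<close>
  have rel: "(\<Sum>r\<in>R. h (X r * a) *\<^sub>C B r) = 0" for a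
  proof (induction a rule: free_unitary_induct)
    case (um v M T)
    have "(\<Sum>r\<in>R. h (X r * um v M T) *\<^sub>C B r) = (\<Sum>r<n. c r *\<^sub>C
        (\<Sum>K\<in>idx (length (w r)). h (um (w r) (I r) K * um v M T) *\<^sub>C um (w r) K (J r)))"
      by (simp add: R_def X_def B_def sum_SIGMA mult_scaleC_left h_simps
          cvec.scale_sum_right scaleC_scaleC)
    also have "\<dots> = (\<Sum>N\<in>idx (length v). h (x * um v M N) *\<^sub>C star (um v T N))"
      by (simp add: left_invariant_pair len um exp sum_distrib_right h_simps cvec.scale_sum_right
          cvec.scale_sum_left mult_scaleC_left scaleC_scaleC) (rule sum.swap)
    also have "\<dots> = 0" by (simp add: x)
    finally show ?case .
  next
    case (add a b)
    then show ?case by (simp add: distrib_left h_simps scaleC_add_left sum.distrib)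
  next
    case (scaleC d a)
    then show ?case
      by (simp add: mult_scaleC_right h_simps scaleC_scaleC[symmetric] cvec.scale_sum_right[symmetric]
          del: cvec.scale_scale)
  qed
  have "tensor_lift G (coproduct x) = (\<Sum>r\<in>R. G (X r) (B r))"
    by (simp add: exp clinear_sum[OF star_hom_linear[OF star_hom_coproduct]]
        clinear_simps[OF star_hom_linear[OF star_hom_coproduct]] coproduct_um len
        tensor_lift_sum[OF bal] tensor_lift_pure[OF bal] tensor_lift_scaleC[OF bal]
        clinear_simps[OF G(1)] R_def X_def B_def sum_SIGMA cvec.scale_sum_right)
  also have "\<dots> = 0" by (rule null_tensor[OF fin G null rel])
  finally show ?thesis .
qed

text \<open>The law x_1 S(x_2) = counit(x) seen through \<open>h\<close>; it presents the counit as
  a form on the coproduct that vanishes when its left argument is null.\<close>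

lemma antipode_law: "tensor_lift antipode_pairing (coproduct x) = counit x"
proof -
  note bal = balanced_bilinear[OF clinear_antipode_pairing_left clinear_antipode_pairing]
  show ?thesis
  proof (induction x rule: free_unitary_induct)
    case (um w I J)
    have "tensor_lift antipode_pairing (coproduct (um w I J)) =
        h (\<Sum>K\<in>idx (length w). um w I K * star (um w J K))"
      using um by (simp add: coproduct_um tensor_lift_sum[OF bal] tensor_lift_pure[OF bal]
          antipode_pairing_um h_simps cong: sum.cong_simp)
    then show ?case using um by (simp add: um_cols counit_um h_simps h_one)
  qed (simp_all add: clinear_simps[OF star_hom_linear[OF star_hom_coproduct]]
      clinear_simps[OF star_hom_linear[OF star_hom_counit]] tensor_lift_add[OF bal]
      tensor_lift_scaleC[OF bal] clinear_simps[OF clinear_antipode_pairing_left])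
qed

lemma clinear_counit_scaleC:
  fixes a b :: "'n free_unitary"
  shows "clinear (\<lambda>b :: 'n free_unitary. counit a *\<^sub>C b)" "clinear (\<lambda>a :: 'n free_unitary. counit a *\<^sub>C b)"
  by (rule clinearI; simp add: scaleC_add_right scaleC_add_left scaleC_scaleC mult.commute
      clinear_simps[OF star_hom_linear[OF star_hom_counit]] scaleC_complex_def)+

lemma counit_law: "tensor_lift (\<lambda>a b. counit a *\<^sub>C b) (coproduct x) = x" for x :: "'n free_unitary"
proof -
  note bal = balanced_bilinear[OF clinear_counit_scaleC(2,1)]
  show ?thesis
  proof (induction x rule: free_unitary_induct)
    case (um w I J)
    then have "tensor_lift (\<lambda>a b. counit a *\<^sub>C b) (coproduct (um w I J)) =
        (\<Sum>K\<in>idx (length w). if I = K then um w K J else 0)"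
      by (simp add: coproduct_um tensor_lift_sum[OF bal] tensor_lift_pure[OF bal] counit_um
          if_distrib[of "\<lambda>x. x *\<^sub>C _"] scaleC_one cong: if_cong sum.cong_simp)
    then show ?case using um by simp
  qed (simp_all add: clinear_simps[OF star_hom_linear[OF star_hom_coproduct]]
      clinear_simps[OF star_hom_linear[OF star_hom_counit]] tensor_lift_add[OF bal]
      tensor_lift_scaleC[OF bal] scaleC_scaleC scaleC_complex_def)
qed

text \<open>If z is null, so is the left leg of its coproduct, whence counit(z) = h(z_1 S(z_2)) = 0.
  Then x = counit(x_1) x_2 vanishes as well.\<close>

lemma h_nondegenerate:
  assumes "\<And>a. h (x * a) = 0"
  shows "x = 0"
proof -
  have "antipode_pairing z b = 0" if "\<And>a. h (z * a) = 0" for z b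
    by (induction b rule: free_unitary_induct)
      (simp_all add: antipode_pairing_um that clinear_simps[OF clinear_antipode_pairing] scaleC_complex_def)
  then have counit: "counit z = 0" if "\<And>a. h (z * a) = 0" for z
    using null_coproduct[OF that clinear_antipode_pairing_left clinear_antipode_pairing]
    by (simp add: antipode_law)
  have "tensor_lift (\<lambda>a b. counit a *\<^sub>C b) (coproduct x) = 0"
    by (rule null_coproduct[OF assms clinear_counit_scaleC(2,1)]) (simp add: counit)
  then show ?thesis by (simp add: counit_law)
qed

lemma h_faithful: "h (z * star z) = 0 \<Longrightarrow> z = 0"
  by (rule h_nondegenerate, rule null_vector) (simp add: trace)

text \<open>Strong right invariance and the symmetry and reality of \<open>h\<close> on monomials
  turn the left side into a sum of entries of H H, with H the matrix of \<open>h\<close> on the word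
  \<open>w @ v\<close>; and H H = H.\<close>

lemma h_average_chi:
  assumes "length I = length w" "length J = length w"
  shows "h (average w I J * chi v) = h (um w I J * chi v)"
proof -
  have half: "(\<Sum>K\<in>idx (length w). h (um w I K * star (um w J L)) * h (um w K L * um v T T)) =
     (\<Sum>M\<in>idx (length v). h (um w I L * um v M T) * h (um w L J * um v T M))"
    if "length L = length w" "length T = length v" for L T
  proof -
    have "(\<Sum>K\<in>idx (length w). h (um w I K * star (um w J L)) * h (um w K L * um v T T)) =
        h ((\<Sum>K\<in>idx (length w). h (um w K L * um v T T) *\<^sub>C um w I K) * star (um w J L))"
      by (simp add: sum_distrib_right h_simps mult_scaleC_left mult.commute)
    also have "\<dots> = (\<Sum>M\<in>idx (length v). h (um w I L * um v M T) * h (star (um w J L * um v M T)))"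
      using that assms by (simp add: right_invariant_pair sum_distrib_right h_simps mult_scaleC_left star_mult)
    also have "\<dots> = (\<Sum>M\<in>idx (length v). h (um w I L * um v M T) * h (um w L J * um v T M))"
    proof (intro sum.cong HOL.refl)
      fix M :: "'n list"
      assume "M \<in> idx (length v)"
      then have "h (star (um w J L * um v M T)) = h (um w L J * um v T M)"
        using h_um_real[of "J @ M" "w @ v" "L @ T"] h_um_sym[of "J @ M" "w @ v" "L @ T"] that assms
        by (simp add: um_append h_star)
      then show "h (um w I L * um v M T) * h (star (um w J L * um v M T)) =
          h (um w I L * um v M T) * h (um w L J * um v T M)" by simp
    qed
    finally show ?thesis .
  qed
  have "h (average w I J * chi v) = (\<Sum>K\<in>idx (length w). \<Sum>L\<in>idx (length w). \<Sum>T\<in>idx (length v).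
      h (um w I K * star (um w J L)) * h (um w K L * um v T T))"
    by (simp add: average_def chi_eq_um sum_distrib_left sum_distrib_right h_simps mult_scaleC_left)
      (rule sum_swap_out[symmetric])
  also have "\<dots> = (\<Sum>L\<in>idx (length w). \<Sum>T\<in>idx (length v). \<Sum>K\<in>idx (length w).
      h (um w I K * star (um w J L)) * h (um w K L * um v T T))"
    by (rule sum_swap_out[symmetric])
  also have "\<dots> = (\<Sum>L\<in>idx (length w). \<Sum>T\<in>idx (length v). \<Sum>M\<in>idx (length v).
      h (um w I L * um v M T) * h (um w L J * um v T M))"
    by (simp add: half cong: sum.cong_simp)
  also have "\<dots> = (\<Sum>M\<in>idx (length v). \<Sum>L\<in>idx (length w). \<Sum>T\<in>idx (length v).
      h (um w I L * um v M T) * h (um w L J * um v T M))"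
    by (rule sum_swap_out)
  also have "\<dots> = (\<Sum>M\<in>idx (length v). h (um w I J * um v M M))"
  proof (intro sum.cong HOL.refl)
    fix M :: "'n list"
    assume "M \<in> idx (length v)"
    then show "(\<Sum>L\<in>idx (length w). \<Sum>T\<in>idx (length v). h (um w I L * um v M T) * h (um w L J * um v T M)) =
        h (um w I J * um v M M)"
      using h_idempotent[of "I @ M" "w @ v" "J @ M"] assms
      by (simp add: sum_idx_add um_append cong: sum.cong_simp)
  qed
  also have "\<dots> = h (um w I J * chi v)"
    by (simp add: chi_eq_um sum_distrib_left h_simps)
  finally show ?thesis .
qed

end

locale haar_expectation = haar h for h :: "'n::finite free_unitary \<Rightarrow> complex" +
  fixes E :: "'n free_unitary \<Rightarrow> 'n free_unitary"
  assumes expectation: "central_expectation h E"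
begin

lemma E_clinear: "clinear E"
  using expectation by (simp add: central_expectation_def)

lemmas E_simps = clinear_simps[OF E_clinear] clinear_sum[OF E_clinear]

lemma E_in_chi_span: "E x \<in> chi_span"
  using expectation unfolding central_expectation_def central_algebra_eq by blast

lemma E_chi: "E (chi w) = chi w"
  using expectation chi_central unfolding central_expectation_def by blast

text \<open>Both sides lie in the span of the \<open>chi v\<close> and have the same inner products
  with it; their difference is orthogonal to itself, so faithfulness applies.\<close>

lemma E_um:
  assumes "length I = length w" "length J = length w"
  shows "E (um w I J) = average w I J"
proof -
  define z where "z = E (um w I J) - average w I J"
  have z: "z \<in> chi_span"
    unfolding z_def by (intro cvec.span_diff E_in_chi_span average_in_chi_span assms)
  have "h ((um w I J - average w I J) * y) = 0" if "y \<in> chi_span" for y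
    using that
  proof (induction rule: cvec.span_induct_alt)
    case base
    show ?case by (simp add: h_simps)
  next
    case (step c y' y)
    then obtain v where "y' = chi v" by auto
    then have "h ((um w I J - average w I J) * y') = 0"
      using h_average_chi[OF assms, of v] by (simp add: left_diff_distrib h_simps)
    then show ?case
      using step by (simp add: distrib_left mult_scaleC_right h_simps)
  qed
  moreover have "h ((um w I J - E (um w I J)) * star y) = 0" if "y \<in> chi_span" for y
    using expectation that unfolding central_expectation_def central_algebra_eq by blast
  ultimately have "h (z * star z) = 0"
    using z chi_span_star[OF z] by (force simp: z_def left_diff_distrib h_simps)
  then have "z = 0" by (rule h_faithful)
  then show ?thesis by (simp add: z_def)
qed

text \<open>The trace property lets the star pass through the inner product, so the star of
  \<open>E x\<close> is also the projection of the star of x.\<close>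

lemma E_star: "E (star x) = star (E x)"
proof -
  define z where "z = E (star x) - star (E x)"
  have z: "z \<in> chi_span"
    unfolding z_def by (intro cvec.span_diff E_in_chi_span chi_span_star)
  have orth: "h ((x - E x) * star y) = 0" if "y \<in> chi_span" for x y
    using expectation that unfolding central_expectation_def central_algebra_eq by blast
  have "h ((star x - star (E x)) * star z) = cnj (h ((x - E x) * z))"
    by (simp add: star_mult h_star[symmetric] star_diff trace)
  also have "h ((x - E x) * z) = 0"
    using orth[OF chi_span_star[OF z], of x] by (simp add: star_star)
  finally have "h (z * star z) = 0"
    using orth[OF z, of "star x"] by (simp add: z_def left_diff_distrib h_simps)
  then have "z = 0" by (rule h_faithful)
  then show ?thesis by (simp add: z_def)
qed

text \<open>Putting the counit on the middle leg of the average leaves h(x_1 S(x_2)) = counit(x).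
  This supplies the zero at time 0 of the curve used for positivity.\<close>

lemma counit_E: "counit (E x) = counit x"
proof (induction x rule: free_unitary_induct)
  case (um w I J)
  have "counit (E (um w I J)) = (\<Sum>K\<in>idx (length w). \<Sum>L\<in>idx (length w).
      if K = L then h (um w I K * star (um w J L)) else 0)"
    using um by (simp add: E_um average_def clinear_simps[OF star_hom_linear[OF star_hom_counit]]
        clinear_sum[OF star_hom_linear[OF star_hom_counit]] counit_um scaleC_complex_def
        if_distrib[of "\<lambda>x. _ * x"] cong: if_cong sum.cong_simp)
  also have "\<dots> = h (\<Sum>K\<in>idx (length w). um w I K * star (um w J K))"
    by (simp add: h_simps)
  also have "\<dots> = counit (um w I J)"
    using um by (simp add: um_cols h_simps h_one counit_um)
  finally show ?case .
qed (simp_all add: E_simps clinear_simps[OF star_hom_linear[OF star_hom_counit]])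

text \<open>In Sweedler notation, \<open>twist \<phi>\<close> maps \<open>x\<close> to \<open>\<phi> (x\<^sub>2) x\<^sub>1 S(x\<^sub>3)\<close>. Since \<open>h\<close> is a trace,
  \<open>\<phi> (E (x\<^sup>* y)) = h ((twist \<phi> x)\<^sup>* (twist \<phi> y))\<close> for every character \<open>\<phi>\<close>.\<close>

definition twist :: "('n free_unitary \<Rightarrow> complex) \<Rightarrow> letter list \<Rightarrow> 'n list \<Rightarrow> 'n list \<Rightarrow> 'n free_unitary" where
  "twist \<phi> w I J = (\<Sum>K\<in>idx (length w). \<Sum>L\<in>idx (length w). \<phi> (um w K L) *\<^sub>C (um w I K * star (um w J L)))"

lemma character_E_um:
  assumes "star_hom \<phi>" "length I = length w" "length J = length w"
  shows "\<phi> (E (um w I J)) = h (twist \<phi> w I J)"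
  using assms by (simp add: E_um average_def twist_def h_simps scaleC_complex_def mult.commute
      clinear_simps[OF star_hom_linear] clinear_sum[OF star_hom_linear])

lemma character_E_star_um_um:
  fixes \<phi> :: "'n free_unitary \<Rightarrow> complex"
  assumes \<phi>: "star_hom \<phi>" and len: "length I = length w" "length J = length w"
    "length I' = length w'" "length J' = length w'"
  shows "\<phi> (E (star (um w I J) * um w' I' J')) = h (star (twist \<phi> w I J) * twist \<phi> w' I' J')"
proof -
  \<comment> \<open>The antipode reverses products and so leaves the second pair in the wrong order;
    cyclicity of \<open>h\<close> carries \<open>b\<close> around to the front.\<close>
  have pull: "h (star a * a' * star (star b * b')) = h (star (a * star b) * (a' * star b'))" for a a' b b'
  proof -
    have "h (star a * a' * star (star b * b')) = h ((star a * a' * star b') * b)"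
      by (simp add: star_mult star_star mult.assoc)
    also have "\<dots> = h (b * (star a * a' * star b'))" by (rule trace)
    finally show ?thesis by (simp add: star_mult star_star mult.assoc)
  qed
  have rev: "(\<Sum>K\<in>idx (length w). g K) = (\<Sum>K\<in>idx (length w). g (rev K))"
    for g :: "'n list \<Rightarrow> complex"
    by (rule sum_idx_rev[symmetric])
  have "\<phi> (E (star (um w I J) * um w' I' J')) = h (twist \<phi> (bar w @ w') (rev I @ I') (rev J @ J'))"
    using len by (subst character_E_um[OF \<phi>, symmetric]) (simp_all add: um_append star_um)
  also have "\<dots> = (\<Sum>K\<in>idx (length w). \<Sum>K'\<in>idx (length w'). \<Sum>L\<in>idx (length w). \<Sum>L'\<in>idx (length w').
      \<phi> (um (bar w @ w') (K @ K') (L @ L')) *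
        h (um (bar w @ w') (rev I @ I') (K @ K') * star (um (bar w @ w') (rev J @ J') (L @ L'))))"
    by (simp add: twist_def h_simps sum_idx_add)
  also have "\<dots> = (\<Sum>K\<in>idx (length w). \<Sum>K'\<in>idx (length w'). \<Sum>L\<in>idx (length w). \<Sum>L'\<in>idx (length w').
      \<phi> (um (bar w @ w') (rev K @ K') (rev L @ L')) *
        h (um (bar w @ w') (rev I @ I') (rev K @ K') * star (um (bar w @ w') (rev J @ J') (rev L @ L'))))"
    by (subst rev, subst (2) rev, rule HOL.refl)
  also have "\<dots> = (\<Sum>K\<in>idx (length w). \<Sum>K'\<in>idx (length w'). \<Sum>L\<in>idx (length w). \<Sum>L'\<in>idx (length w').
      cnj (\<phi> (um w K L)) * \<phi> (um w' K' L') *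
        h (star (um w I K * star (um w J L)) * (um w' I' K' * star (um w' J' L'))))"
    using len by (simp add: um_append star_um[symmetric] star_hom_simps[OF \<phi>] star_complex_def pull
        cong: sum.cong_simp)
  also have "\<dots> = (\<Sum>K\<in>idx (length w). \<Sum>L\<in>idx (length w). \<Sum>K'\<in>idx (length w'). \<Sum>L'\<in>idx (length w').
      cnj (\<phi> (um w K L)) * \<phi> (um w' K' L') *
        h (star (um w I K * star (um w J L)) * (um w' I' K' * star (um w' J' L'))))"
    by (rule sum.cong[OF HOL.refl]) (rule sum.swap)
  also have "\<dots> = (\<Sum>K'\<in>idx (length w'). \<Sum>L'\<in>idx (length w'). \<Sum>K\<in>idx (length w). \<Sum>L\<in>idx (length w).
      cnj (\<phi> (um w K L)) * \<phi> (um w' K' L') *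
        h (star (um w I K * star (um w J L)) * (um w' I' K' * star (um w' J' L'))))"
    by (subst sum_swap_out) (rule sum.cong[OF HOL.refl], rule sum_swap_out)
  also have "\<dots> = h (star (twist \<phi> w I J) * twist \<phi> w' I' J')"
    by (simp add: twist_def star_sum star_scaleC sum_distrib_left sum_distrib_right h_simps
        mult_scaleC_left mult_scaleC_right mult_ac)
  finally show ?thesis .
qed

lemma character_E_positive:
  fixes \<phi> :: "'n free_unitary \<Rightarrow> complex"
  assumes "star_hom \<phi>"
  shows "\<phi> (E (star x * x)) \<ge> 0"
proof -
  obtain n :: nat and c w I J where exp: "x = (\<Sum>r<n. c r *\<^sub>C um (w r) (I r) (J r))"
    and len: "\<And>r. length (I r) = length (w r)" "\<And>r. length (J r) = length (w r)"
    by (rule free_unitary_expansion[of x], rule that)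
  note \<phi> = clinear_simps[OF star_hom_linear[OF assms]] clinear_sum[OF star_hom_linear[OF assms]]
  let ?y = "\<Sum>r<n. c r *\<^sub>C twist \<phi> (w r) (I r) (J r)"
  have "\<phi> (E (star x * x)) = (\<Sum>r<n. \<Sum>s<n. cnj (c r) * c s *
      \<phi> (E (star (um (w r) (I r) (J r)) * um (w s) (I s) (J s))))"
    by (simp add: exp star_sum star_scaleC sum_product mult_scaleC_left mult_scaleC_right E_simps \<phi>
        scaleC_complex_def mult_ac)
  also have "\<dots> = h (star ?y * ?y)"
    by (simp add: character_E_star_um_um[OF assms] len star_sum star_scaleC sum_product
        mult_scaleC_left mult_scaleC_right h_simps mult_ac)
  finally show ?thesis using h_pos[of ?y] by simp
qed

end

section \<open>One-parameter subgroups of the unitary group\<close>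

lemma matrix_power_commute: "matrix_power A k ** A = A ** matrix_power A k"
  by (induction k) (simp_all add: matrix_mul_assoc[symmetric])

lemma matrix_power_scaleR: "matrix_power (t *\<^sub>R A) k = t ^ k *\<^sub>R matrix_power A k"
  by (induction k) (simp_all add: vec_eq_iff matrix_matrix_mult_def scaleR_sum_right mult.commute)

lemma norm_matrix_power_entry:
  "cmod (matrix_power A k $ i $ j) \<le> (\<Sum>i\<in>UNIV. \<Sum>j\<in>UNIV. cmod (A $ i $ j)) ^ k"
proof (induction k arbitrary: i j)
  case 0
  show ?case by (simp add: mat_def)
next
  case (Suc k)
  let ?M = "\<Sum>i\<in>UNIV. \<Sum>j\<in>UNIV. cmod (A $ i $ j)"
  have "cmod (matrix_power A (Suc k) $ i $ j) \<le> (\<Sum>l\<in>UNIV. cmod (A $ i $ l) * cmod (matrix_power A k $ l $ j))"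
    by (simp add: matrix_matrix_mult_def) (rule order_trans[OF norm_sum], simp add: norm_mult)
  also have "\<dots> \<le> (\<Sum>l\<in>UNIV. cmod (A $ i $ l) * ?M ^ k)"
    by (intro sum_mono mult_left_mono Suc) auto
  also have "\<dots> = (\<Sum>l\<in>UNIV. cmod (A $ i $ l)) * ?M ^ k" by (simp add: sum_distrib_right)
  also have "(\<Sum>l\<in>UNIV. cmod (A $ i $ l)) \<le> ?M"
    by (rule member_le_sum) (auto intro: sum_nonneg)
  then have "(\<Sum>l\<in>UNIV. cmod (A $ i $ l)) * ?M ^ k \<le> ?M * ?M ^ k"
    by (intro mult_right_mono zero_le_power sum_nonneg) auto
  finally show ?case by simp
qed

text \<open>Each entry of exp(tX) is a scalar power series in t with these coefficients, so that
  convergence and termwise differentiation can be argued entry by entry.\<close>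

definition exp_coeff :: "complex^'n::finite^'n \<Rightarrow> 'n \<Rightarrow> 'n \<Rightarrow> nat \<Rightarrow> complex" where
  "exp_coeff X i j k = matrix_power X k $ i $ j / fact k"

lemma summable_exp_coeff: "summable (\<lambda>k. exp_coeff X i j k * z ^ k)"
proof (rule summable_comparison_test')
  let ?M = "\<Sum>i\<in>UNIV. \<Sum>j\<in>UNIV. cmod (X $ i $ j)"
  show "summable (\<lambda>k. inverse (fact k) * (?M * cmod z) ^ k)" by (rule summable_exp)
  show "norm (exp_coeff X i j k * z ^ k) \<le> inverse (fact k) * (?M * cmod z) ^ k" if "k \<ge> 0" for k
    using norm_matrix_power_entry[of X k i j]
    by (simp add: exp_coeff_def norm_mult norm_divide norm_power power_mult_distrib divide_simps
        mult_right_mono)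
qed

lemma matrix_exp_entry:
  "matrix_exp (t *\<^sub>R X) $ i $ j = (\<Sum>k. exp_coeff X i j k * of_real t ^ k)"
proof -
  have "(\<lambda>k. (1 / fact k) *\<^sub>R matrix_power (t *\<^sub>R X) k) sums
      (\<chi> i j. \<Sum>k. exp_coeff X i j k * of_real t ^ k)"
    unfolding sums_def
  proof (intro vec_tendstoI)
    fix i j
    have entry: "((1 / fact k) *\<^sub>R matrix_power (t *\<^sub>R X) k) $ i $ j = exp_coeff X i j k * of_real t ^ k" for k
      by (simp add: exp_coeff_def matrix_power_scaleR scaleR_conv_of_real[where 'a = complex])
    have "(\<lambda>k. exp_coeff X i j k * of_real t ^ k) sums (\<Sum>k. exp_coeff X i j k * of_real t ^ k)"
      by (rule summable_sums[OF summable_exp_coeff])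
    then show "(\<lambda>n. (\<Sum>k<n. (1 / fact k) *\<^sub>R matrix_power (t *\<^sub>R X) k) $ i $ j)
        \<longlonglongrightarrow> (\<chi> i j. \<Sum>k. exp_coeff X i j k * of_real t ^ k) $ i $ j"
      unfolding sums_def sum_component entry by simp
  qed
  then show ?thesis by (simp add: matrix_exp_def sums_iff)
qed

lemma matrix_exp_zero: "matrix_exp (0 *\<^sub>R X) = mat 1"
proof -
  have "matrix_exp (0 *\<^sub>R X) $ i $ j = mat 1 $ i $ j" for i j
    unfolding matrix_exp_entry of_real_0 powser_zero by (simp add: exp_coeff_def)
  then show ?thesis by (simp add: vec_eq_iff)
qed

lemma matrix_exp_has_vector_derivative:
  "((\<lambda>t. matrix_exp (t *\<^sub>R X) $ i $ j) has_vector_derivative (matrix_exp (t *\<^sub>R X) ** X) $ i $ j) (at t)"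
proof -
  have "diffs (exp_coeff X i j) k = (\<Sum>l\<in>UNIV. exp_coeff X i l k * X $ l $ j)" for k
  proof -
    have "diffs (exp_coeff X i j) k = (matrix_power X k ** X) $ i $ j / fact k"
      by (simp add: diffs_def exp_coeff_def matrix_power_commute del: of_nat_Suc)
    then show ?thesis by (simp add: exp_coeff_def matrix_matrix_mult_def sum_divide_distrib)
  qed
  then have "(\<Sum>k. diffs (exp_coeff X i j) k * z ^ k) =
      (\<Sum>k. \<Sum>l\<in>UNIV. exp_coeff X i l k * z ^ k * X $ l $ j)" for z
    by (simp add: sum_distrib_left sum_distrib_right mult_ac)
  also have "\<And>z. (\<Sum>k. \<Sum>l\<in>UNIV. exp_coeff X i l k * z ^ k * X $ l $ j) =
      (\<Sum>l\<in>UNIV. \<Sum>k. exp_coeff X i l k * z ^ k * X $ l $ j)"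
    by (intro suminf_sum summable_mult2 summable_exp_coeff)
  also have "\<And>z. (\<Sum>l\<in>UNIV. \<Sum>k. exp_coeff X i l k * z ^ k * X $ l $ j) =
      (\<Sum>l\<in>UNIV. (\<Sum>k. exp_coeff X i l k * z ^ k) * X $ l $ j)"
    by (intro sum.cong HOL.refl suminf_mult2[symmetric] summable_exp_coeff)
  finally have "(\<Sum>k. diffs (exp_coeff X i j) k * z ^ k) =
      (\<Sum>l\<in>UNIV. (\<Sum>k. exp_coeff X i l k * z ^ k) * X $ l $ j)" for z .
  then have eq: "(\<Sum>k. diffs (exp_coeff X i j) k * of_real t ^ k) = (matrix_exp (t *\<^sub>R X) ** X) $ i $ j"
    by (simp add: matrix_matrix_mult_def matrix_exp_entry)
  show ?thesis
    unfolding matrix_exp_entry eq[symmetric]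
    by (rule has_vector_derivative_real_field, rule termdiffs_strong_converges_everywhere,
        rule summable_exp_coeff)
qed

lemma adjoint_matrix_mult: "adjoint_matrix (A ** B) = adjoint_matrix B ** adjoint_matrix A"
  by (simp add: adjoint_matrix_def matrix_matrix_mult_def vec_eq_iff mult.commute)

lemma unitary_group_mult:
  assumes "g \<in> unitary_group" "k \<in> unitary_group"
  shows "g ** k \<in> unitary_group"
proof -
  have "(g ** k) ** adjoint_matrix (g ** k) = g ** (k ** adjoint_matrix k) ** adjoint_matrix g"
    "adjoint_matrix (g ** k) ** (g ** k) = adjoint_matrix k ** (adjoint_matrix g ** g) ** k"
    by (simp_all add: adjoint_matrix_mult matrix_mul_assoc)
  then show ?thesis using assms by (simp add: unitary_group_def)
qed

lemma mat_1_unitary: "mat 1 \<in> unitary_group"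
  by (simp add: unitary_group_def adjoint_matrix_def mat_def vec_eq_iff matrix_matrix_mult_def
      if_distrib[of cnj] if_distrib[of "\<lambda>x. x * _"] eq_commute cong: if_cong)

lemma skew_entry:
  assumes "X \<in> lie_u"
  shows "X $ k $ l = - cnj (X $ l $ k)"
proof -
  have "adjoint_matrix X $ k $ l = (- X) $ k $ l" using assms by (simp only: lie_u_def mem_Collect_eq)
  then show ?thesis by (simp add: adjoint_matrix_def)
qed

lemma matrix_exp_unitary:
  fixes X :: "complex^'n::finite^'n"
  assumes "X \<in> lie_u"
  shows "matrix_exp (t *\<^sub>R X) \<in> unitary_group"
proof -
  define \<gamma> where "\<gamma> t = matrix_exp (t *\<^sub>R X)" for t
  have skew: "cnj (X $ l $ k) = - X $ k $ l" for k l
    by (subst skew_entry[OF assms, of k l]) simp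
  have deriv: "((\<lambda>t. \<Sum>k\<in>UNIV. \<gamma> t $ i $ k * cnj (\<gamma> t $ j $ k)) has_vector_derivative 0) (at t)" for i j t
  proof -
    have "(\<Sum>k\<in>UNIV. \<gamma> t $ i $ k * cnj ((\<gamma> t ** X) $ j $ k) + (\<gamma> t ** X) $ i $ k * cnj (\<gamma> t $ j $ k)) =
        (\<Sum>k\<in>UNIV. \<Sum>l\<in>UNIV. - (\<gamma> t $ i $ k * X $ k $ l * cnj (\<gamma> t $ j $ l))) +
        (\<Sum>k\<in>UNIV. \<Sum>l\<in>UNIV. \<gamma> t $ i $ l * X $ l $ k * cnj (\<gamma> t $ j $ k))"
      by (simp add: matrix_matrix_mult_def sum.distrib sum_distrib_left sum_distrib_right skew mult_ac)
    also have "\<dots> = 0"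
      by (subst sum.swap) (simp add: sum_negf)
    finally have zero: "(\<Sum>k\<in>UNIV. \<gamma> t $ i $ k * cnj ((\<gamma> t ** X) $ j $ k) + (\<gamma> t ** X) $ i $ k * cnj (\<gamma> t $ j $ k)) = 0" .
    have "((\<lambda>t. \<Sum>k\<in>UNIV. \<gamma> t $ i $ k * cnj (\<gamma> t $ j $ k)) has_vector_derivative
        (\<Sum>k\<in>UNIV. \<gamma> t $ i $ k * cnj ((\<gamma> t ** X) $ j $ k) + (\<gamma> t ** X) $ i $ k * cnj (\<gamma> t $ j $ k))) (at t)"
      unfolding \<gamma>_def
      by (intro has_vector_derivative_sum has_vector_derivative_mult has_vector_derivative_cnj
          matrix_exp_has_vector_derivative)
    then show ?thesis unfolding zero .
  qed
  have const: "(\<Sum>k\<in>UNIV. \<gamma> t $ i $ k * cnj (\<gamma> t $ j $ k)) =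
      (\<Sum>k\<in>UNIV. \<gamma> 0 $ i $ k * cnj (\<gamma> 0 $ j $ k))" for i j t
  proof -
    obtain c where "\<And>t. t \<in> UNIV \<Longrightarrow> (\<Sum>k\<in>UNIV. \<gamma> t $ i $ k * cnj (\<gamma> t $ j $ k)) = c"
      by (rule has_vector_derivative_zero_constant[OF convex_UNIV deriv[of i j]], rule that)
    then show ?thesis by simp
  qed
  have "(\<Sum>k\<in>UNIV. \<gamma> t $ i $ k * cnj (\<gamma> t $ j $ k)) = (if i = j then 1 else 0)" for i j
    unfolding const[where t = t] using matrix_exp_zero[of X]
    by (simp add: \<gamma>_def mat_def if_distrib[of cnj] if_distrib[of "\<lambda>x. x * _"] cong: if_cong)
  then have "\<gamma> t ** adjoint_matrix (\<gamma> t) = mat 1"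
    by (simp add: vec_eq_iff matrix_matrix_mult_def adjoint_matrix_def mat_def)
  then show ?thesis
    by (simp add: unitary_group_def matrix_left_right_inverse \<gamma>_def)
qed

section \<open>Evaluation at unitary matrices and left invariant derivatives\<close>

definition eval_at :: "complex^'n^'n \<Rightarrow> 'n::finite free_unitary \<Rightarrow> complex" where
  "eval_at g = ulift (\<lambda>i j. g $ i $ j)"

lemma star_hom_eval_at: "g \<in> unitary_group \<Longrightarrow> star_hom (eval_at g)"
  unfolding eval_at_def by (intro star_hom_ulift biunitary_unitary_group)

lemma eval_at_simps:
  assumes "g \<in> unitary_group"
  shows "eval_at g (ugen i j) = g $ i $ j" "eval_at g 1 = 1" "eval_at g 0 = 0"
    "eval_at g (x + y) = eval_at g x + eval_at g y" "eval_at g (x - y) = eval_at g x - eval_at g y"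
    "eval_at g (x * y) = eval_at g x * eval_at g y" "eval_at g (c *\<^sub>C x) = c * eval_at g x"
    "eval_at g (star x) = cnj (eval_at g x)" "eval_at g (\<Sum>i\<in>A. f i) = (\<Sum>i\<in>A. eval_at g (f i))"
  using star_hom_simps[OF star_hom_eval_at[OF assms]]
    clinear_simps[OF star_hom_linear[OF star_hom_eval_at[OF assms]]]
    clinear_sum[OF star_hom_linear[OF star_hom_eval_at[OF assms]]]
  by (simp_all add: star_complex_def scaleC_complex_def eval_at_def ulift_ugen biunitary_unitary_group assms)

lemma restrict_classical_eq: "g \<in> unitary_group \<Longrightarrow> restrict_classical x g = eval_at g x"
  by (simp add: restrict_classical_def eval_at_def)

lemma eval_at_one: "eval_at (mat 1) = counit"
  by (rule star_hom_unique[OF star_hom_eval_at[OF mat_1_unitary] star_hom_counit])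
    (simp add: eval_at_simps(1)[OF mat_1_unitary] counit_ugen, simp add: mat_def)

text \<open>\<open>y\<close> plays the role of \<open>X x\<close> for the left invariant vector field \<open>X\<close>.\<close>

definition left_derivative ::
    "complex^'n^'n \<Rightarrow> 'n::finite free_unitary \<Rightarrow> 'n free_unitary \<Rightarrow> bool" where
  "left_derivative X x y \<longleftrightarrow> (\<forall>\<sigma> t. (\<forall>s. \<sigma> s \<in> unitary_group) \<longrightarrow>
     (\<forall>i j. ((\<lambda>s. \<sigma> s $ i $ j) has_vector_derivative (\<sigma> t ** X) $ i $ j) (at t)) \<longrightarrow>
     ((\<lambda>s. eval_at (\<sigma> s) x) has_vector_derivative eval_at (\<sigma> t) y) (at t))"

lemma left_derivative_add:
  "left_derivative X x x' \<Longrightarrow> left_derivative X y y' \<Longrightarrow> left_derivative X (x + y) (x' + y')"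
  unfolding left_derivative_def by (auto simp: eval_at_simps intro: has_vector_derivative_add)

lemma left_derivative_mult:
  "left_derivative X x x' \<Longrightarrow> left_derivative X y y' \<Longrightarrow> left_derivative X (x * y) (x * y' + x' * y)"
  unfolding left_derivative_def by (auto simp: eval_at_simps intro: has_vector_derivative_mult)

lemma left_derivative_scaleC:
  "left_derivative X x x' \<Longrightarrow> left_derivative X (c *\<^sub>C x) (c *\<^sub>C x')"
  unfolding left_derivative_def by (auto simp: eval_at_simps intro: has_vector_derivative_mult_right)

lemma left_derivative_star:
  "left_derivative X x x' \<Longrightarrow> left_derivative X (star x) (star x')"
  unfolding left_derivative_def by (auto simp: eval_at_simps intro: has_vector_derivative_cnj)

lemma left_derivative_ugen: "left_derivative X (ugen i j) (\<Sum>k\<in>UNIV. X $ k $ j *\<^sub>C ugen i k)"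
  unfolding left_derivative_def by (auto simp: eval_at_simps matrix_matrix_mult_def mult.commute)

lemma left_derivative_one: "left_derivative X 1 0"
  unfolding left_derivative_def by (auto simp: eval_at_simps)

lemma left_derivative_exists: "\<exists>y. left_derivative X x y"
proof (induction x rule: free_unitary_induct)
  case (um w I J)
  then show ?case
  proof (induction rule: length_induct3)
    case Nil
    show ?case using left_derivative_one by auto
  next
    case (Cons c w i I j J)
    moreover have "\<exists>y. left_derivative X (ug c i j) y"
      using left_derivative_ugen left_derivative_star by (cases c) fastforce+
    ultimately show ?case using left_derivative_mult by fastforce
  qed
qed (blast intro: left_derivative_add left_derivative_scaleC)+

text \<open>The defining property determines only the values on the unitary group, since evaluations
  do not separate noncommuting monomials. Sum and product rules for this choice are therefore used
  after evaluation.\<close>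

definition lder :: "complex^'n^'n \<Rightarrow> 'n::finite free_unitary \<Rightarrow> 'n free_unitary" where
  "lder X x = (SOME y. left_derivative X x y)"

lemma left_derivative_lder: "left_derivative X x (lder X x)"
  unfolding lder_def by (rule someI_ex[OF left_derivative_exists])

lemma eval_at_exp_derivative:
  assumes "X \<in> lie_u" "left_derivative X x y"
  shows "((\<lambda>t. eval_at (matrix_exp (t *\<^sub>R X)) x) has_vector_derivative eval_at (matrix_exp (t *\<^sub>R X)) y) (at t)"
  using assms(2)[unfolded left_derivative_def, rule_format, of "\<lambda>t. matrix_exp (t *\<^sub>R X)" t]
    matrix_exp_unitary[OF assms(1)] matrix_exp_has_vector_derivative[of X]
  by blast

lemma lie_derivative_restrict:
  fixes g :: "complex^'n::finite^'n"
  assumes X: "X \<in> lie_u" and g: "g \<in> unitary_group"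
  shows "lie_derivative X (restrict_classical x) g = eval_at g (lder X x)"
proof -
  define \<sigma> where "\<sigma> t = g ** matrix_exp (t *\<^sub>R X)" for t
  have \<sigma>: "\<sigma> t \<in> unitary_group" for t
    unfolding \<sigma>_def by (intro unitary_group_mult g matrix_exp_unitary X)
  have \<sigma>0: "\<sigma> 0 = g"
    using matrix_exp_zero[of X] by (simp add: \<sigma>_def)
  have "((\<lambda>s. \<sigma> s $ i $ j) has_vector_derivative (\<sigma> 0 ** X) $ i $ j) (at 0)" for i j
  proof -
    have "((\<lambda>s. \<Sum>k\<in>UNIV. g $ i $ k * matrix_exp (s *\<^sub>R X) $ k $ j) has_vector_derivative
      (\<Sum>k\<in>UNIV. g $ i $ k * (matrix_exp (0 *\<^sub>R X) ** X) $ k $ j)) (at 0)"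
      by (intro has_vector_derivative_sum has_vector_derivative_mult_right matrix_exp_has_vector_derivative)
    then show ?thesis
      unfolding \<sigma>0 matrix_exp_zero matrix_mul_lid by (simp add: \<sigma>_def matrix_matrix_mult_def)
  qed
  then have "((\<lambda>s. eval_at (\<sigma> s) x) has_vector_derivative eval_at (\<sigma> 0) (lder X x)) (at 0)"
    using left_derivative_lder[of X x] \<sigma> unfolding left_derivative_def by blast
  moreover have "restrict_classical x (g ** matrix_exp (t *\<^sub>R X)) = eval_at (\<sigma> t) x" for t
    using restrict_classical_eq[OF \<sigma>] by (simp add: \<sigma>_def)
  ultimately show ?thesis
    unfolding lie_derivative_def by (simp add: vector_derivative_at \<sigma>0)
qed

section \<open>Second derivatives at the identity\<close>

definition second_derivative :: "complex^'n^'n \<Rightarrow> 'n::finite free_unitary \<Rightarrow> complex" where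
  "second_derivative X x = lie_derivative X (lie_derivative X (restrict_classical x)) (mat 1)"

text \<open>Any left derivatives may be used, not just the chosen ones; with those given by the sum,
  product and star rules this becomes a calculus for the second derivative.\<close>

lemma second_derivative_eq:
  assumes "X \<in> lie_u" "left_derivative X x y" "left_derivative X y z"
  shows "second_derivative X x = counit z"
proof -
  let ?\<gamma> = "\<lambda>t. matrix_exp (t *\<^sub>R X)"
  have "lie_derivative X (restrict_classical x) (mat 1 ** ?\<gamma> t) = eval_at (?\<gamma> t) y" for t
    using lie_derivative_restrict[OF assms(1) matrix_exp_unitary[OF assms(1)], of x t]
      vector_derivative_unique_at[OF eval_at_exp_derivative[OF assms(1,2)]
        eval_at_exp_derivative[OF assms(1) left_derivative_lder]] by simp
  then have "second_derivative X x = vector_derivative (\<lambda>t. eval_at (?\<gamma> t) y) (at 0)"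
    by (simp add: second_derivative_def lie_derivative_def[of X "lie_derivative X (restrict_classical x)"])
  also have "\<dots> = eval_at (?\<gamma> 0) z"
    by (rule vector_derivative_at[OF eval_at_exp_derivative[OF assms(1,3)]])
  finally show ?thesis by (simp add: matrix_exp_zero[of X, simplified] eval_at_one)
qed

lemmas counit_simps = star_hom_simps[OF star_hom_counit]
  clinear_simps[OF star_hom_linear[OF star_hom_counit]] clinear_sum[OF star_hom_linear[OF star_hom_counit]]

text \<open>With d the first derivative at the identity, L(xy) = L(x) counit(y) + 2 d(x) d(y) +
  counit(x) L(y). The Gaussian identity is algebra from here, and L(x* x) = 2 |d(x)|^2 on the kernel
  of the counit.\<close>

lemma gaussian_second_derivative:
  fixes X :: "complex^'n::finite^'n"
  assumes X: "X \<in> lie_u"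
  shows "gaussian (second_derivative X)"
proof -
  note D = left_derivative_lder[of X]
  note L = second_derivative_eq[OF X]
  let ?L = "second_derivative X" and ?d = "\<lambda>x. counit (lder X x)"
  have L': "?L x = counit (lder X (lder X x))" for x by (rule L[OF D D])
  have add: "?L (x + y) = ?L x + ?L y" for x y
    using L[OF left_derivative_add[OF D D] left_derivative_add[OF D D]] by (simp add: L' counit_simps)
  have scale: "?L (c *\<^sub>C x) = c *\<^sub>C ?L x" for c x
    using L[OF left_derivative_scaleC[OF D] left_derivative_scaleC[OF D]] by (simp add: L' counit_simps)
  have star: "?L (star x) = cnj (?L x)" for x
    using L[OF left_derivative_star[OF D] left_derivative_star[OF D]]
    by (simp add: L' counit_simps star_complex_def)
  have one: "?L 1 = 0"
  proof -
    have "left_derivative X 0 0" using left_derivative_scaleC[OF left_derivative_one, of X 0] by simp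
    from L[OF left_derivative_one this] show ?thesis by (simp add: counit_simps)
  qed
  have mult: "?L (x * y) = ?L x * counit y + 2 * (?d x * ?d y) + counit x * ?L y" for x y
    using L[OF left_derivative_mult[OF D D]
        left_derivative_add[OF left_derivative_mult[OF D D] left_derivative_mult[OF D D]]]
    by (simp add: L' counit_simps algebra_simps)
  have d_mult: "?d (x * y) = counit x * ?d y + ?d x * counit y" for x y
  proof -
    note 1 = eval_at_exp_derivative[OF X left_derivative_mult[OF D D], of x y]
    from vector_derivative_unique_at[OF eval_at_exp_derivative[OF X D] this, of 0]
    show ?thesis by (simp add: matrix_exp_zero[of X, simplified] eval_at_one counit_simps)
  qed
  have d_star: "?d (star x) = cnj (?d x)" for x
    using vector_derivative_unique_at[OF eval_at_exp_derivative[OF X D]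
        eval_at_exp_derivative[OF X left_derivative_star[OF D]], of 0]
    by (simp add: matrix_exp_zero[of X, simplified] eval_at_one counit_simps star_complex_def)
  have "?L (star x * x) \<ge> 0" if "counit x = 0" for x
    using that by (simp add: mult d_star counit_simps star_complex_def less_eq_complex_def)
  then have "generating_functional ?L"
    unfolding generating_functional_def using add scale star one by (auto intro: clinearI)
  moreover have "?L (x * y * z) = ?L (x * y) * counit z + ?L (x * z) * counit y + ?L (y * z) * counit x
       - counit (x * y) * ?L z - counit (x * z) * ?L y - counit (y * z) * ?L x" for x y z
    by (simp add: mult d_mult counit_simps algebra_simps)
  ultimately show ?thesis unfolding gaussian_def by blast
qed

text \<open>If \<open>c\<close> were negative, \<open>f'\<close> would be negative just to the right
  of \<open>a\<close>, and the mean value theorem would put \<open>f\<close> below its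
  minimum.\<close>

lemma second_derivative_at_min:
  fixes f f' :: "real \<Rightarrow> real"
  assumes f: "\<And>t. (f has_real_derivative f' t) (at t)" and f': "(f' has_real_derivative c) (at a)"
    and min: "\<And>t. f a \<le> f t"
  shows "c \<ge> 0"
proof (rule ccontr)
  assume "\<not> c \<ge> 0"
  have "f' a = 0" by (rule DERIV_local_min[OF f, of 1]) (use min in auto)
  moreover obtain d where d: "d > 0" "\<And>h. h > 0 \<Longrightarrow> h < d \<Longrightarrow> f' (a + h) < f' a"
    using DERIV_neg_dec_right[OF f'] \<open>\<not> c \<ge> 0\<close> by auto
  moreover obtain z where "z > a" "z < a + d / 2" "f (a + d / 2) - f a = (a + d / 2 - a) * f' z"
    using MVT2[of a "a + d / 2" f f'] f d by auto
  moreover from this d(2)[of "z - a"] have "f' z < f' a" using d(1) by auto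
  ultimately have "f (a + d / 2) < f a"
    using mult_pos_neg[of "d / 2" "f' z"] by auto
  with min[of "a + d / 2"] show False by simp
qed

lemma (in haar_expectation) second_derivative_E_positive:
  assumes X: "X \<in> lie_u" and x: "counit x = 0"
  shows "second_derivative X (E (star x * x)) \<ge> 0"
proof -
  define \<gamma> where "\<gamma> t = matrix_exp (t *\<^sub>R X)" for t
  define y where "y = E (star x * x)"
  define F F1 where "F t = eval_at (\<gamma> t) y" and "F1 t = eval_at (\<gamma> t) (lder X y)" for t
  have F0: "F 0 = 0"
    using matrix_exp_zero[of X] x
    by (simp add: F_def \<gamma>_def y_def eval_at_one counit_E counit_simps)
  have pos: "F t \<ge> 0" for t
    unfolding F_def y_def \<gamma>_def
    by (rule character_E_positive[OF star_hom_eval_at[OF matrix_exp_unitary[OF X]]])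
  have F: "(F has_vector_derivative F1 t) (at t)" for t
    unfolding F_def F1_def \<gamma>_def by (rule eval_at_exp_derivative[OF X left_derivative_lder])
  have F1: "(F1 has_vector_derivative second_derivative X y) (at 0)"
    using eval_at_exp_derivative[OF X left_derivative_lder[of X "lder X y"], of 0]
    unfolding F1_def \<gamma>_def by (simp add: matrix_exp_zero[of X, simplified] eval_at_one
        second_derivative_eq[OF X left_derivative_lder left_derivative_lder])
  have Re: "((\<lambda>t. Re (f t)) has_real_derivative Re f') (at t)"
    and Im: "((\<lambda>t. Im (f t)) has_real_derivative Im f') (at t)"
    if "(f has_vector_derivative f') (at t)" for f f' t
    using bounded_linear.has_vector_derivative[OF bounded_linear_Re that]
      bounded_linear.has_vector_derivative[OF bounded_linear_Im that]
    by (simp_all add: has_real_derivative_iff_has_vector_derivative)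
  have "Re (second_derivative X y) \<ge> 0"
    by (rule second_derivative_at_min[OF Re[OF F] Re[OF F1]])
      (use pos F0 in \<open>simp add: less_eq_complex_def\<close>)
  \<comment> \<open>The order on complex numbers also demands a real value: the curve is real
    throughout, hence so are both its derivatives.\<close>
  moreover have "Im (second_derivative X y) = 0"
  proof -
    have "Im (F t) = 0" for t using pos[of t] by (simp add: less_eq_complex_def)
    then have "Im (F1 t) = 0" for t
      using Im[OF F, of t] by (auto intro: DERIV_unique)
    then show ?thesis using Im[OF F1] by (auto intro: DERIV_unique)
  qed
  ultimately show ?thesis by (simp add: less_eq_complex_def y_def)
qed

section \<open>Gaussian functionals on the central algebra\<close>

lemma gaussian_sum:
  fixes L :: "'i \<Rightarrow> 'n::finite free_unitary \<Rightarrow> complex"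
  assumes "finite A" "\<And>i. i \<in> A \<Longrightarrow> gaussian (L i)"
  shows "gaussian (\<lambda>x. \<Sum>i\<in>A. L i x)"
  using assms
proof (induction A)
  case empty
  show ?case by (auto simp: gaussian_def generating_functional_def intro!: clinearI)
next
  case (insert i A)
  have add: "gaussian (\<lambda>x. f x + g x)" if "gaussian f" "gaussian g" for f g :: "'n free_unitary \<Rightarrow> complex"
  proof -
    have lin: "clinear f" "clinear g" using that by (auto simp: gaussian_def generating_functional_def)
    have "clinear (\<lambda>x. f x + g x)"
      by (rule clinearI) (simp_all add: clinear_simps[OF lin(1)] clinear_simps[OF lin(2)] scaleC_add_right)
    then show ?thesis
      using that by (simp add: gaussian_def generating_functional_def algebra_simps)
  qed
  have "gaussian (\<lambda>x. L i x + (\<Sum>i\<in>A. L i x))"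
    using insert by (intro add) auto
  with insert show ?case by simp
qed

text \<open>The character of a letter, shifted into the kernel of the counit, where Gaussian
  functionals kill triple products; \<open>reduced_entry\<close> does the same for single
  coefficients.\<close>

definition reduced_letter :: "letter \<Rightarrow> 'n::finite free_unitary" where
  "reduced_letter c = chi_letter c - of_nat CARD('n) *\<^sub>C 1"

definition reduced_entry :: "letter \<Rightarrow> 'n::finite \<Rightarrow> 'n \<Rightarrow> 'n free_unitary" where
  "reduced_entry c i j = ug c i j - (if i = j then 1 else 0)"

lemma counit_reduced_entry: "counit (reduced_entry c i j) = 0"
  by (simp add: reduced_entry_def counit_simps counit_ug)

lemma reduced_letter_eq: "(reduced_letter c :: 'n::finite free_unitary) = (\<Sum>i\<in>UNIV. reduced_entry c i i)"
proof -
  have "(\<Sum>i\<in>A. 1 :: 'n free_unitary) = of_nat (card A) *\<^sub>C 1" for A :: "'n set"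
    by (induction A rule: infinite_finite_induct) (simp_all add: scaleC_add_left scaleC_one)
  then show ?thesis
    by (simp add: reduced_letter_def reduced_entry_def chi_letter_eq sum_subtractf)
qed

lemma counit_reduced_letter: "counit (reduced_letter c) = 0"
  by (simp add: reduced_letter_eq counit_simps counit_reduced_entry)

lemma star_reduced_entry: "star (reduced_entry c i j) = reduced_entry (flip c) i j"
  by (simp add: reduced_entry_def star_diff star_ug star_one)

lemma star_reduced_letter: "star (reduced_letter c) = reduced_letter (flip c)"
  by (simp add: reduced_letter_eq star_sum star_reduced_entry)

text \<open>For v = u - 1 the relation u u* = 1 reads v + v* = - v v*; take the trace. The other
  letter is the same for the conjugate of u.\<close>

lemma reduced_letter_relation:
  "reduced_letter c + reduced_letter (flip c) = 
    - (\<Sum>i\<in>UNIV. \<Sum>k\<in>UNIV. reduced_entry c i k * reduced_entry (flip c) i (k :: 'n::finite))"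
proof -
  have "reduced_entry c i i + reduced_entry (flip c) i i +
      (\<Sum>k\<in>UNIV. reduced_entry c i k * reduced_entry (flip c) i k) = 0" for i :: 'n
  proof -
    have "(\<Sum>k\<in>UNIV. reduced_entry c i k * reduced_entry (flip c) i k) =
      (\<Sum>k\<in>UNIV. ug c i k * ug (flip c) i k) - ug c i i - ug (flip c) i i + 1"
      by (simp add: reduced_entry_def left_diff_distrib right_diff_distrib sum_subtractf
          if_distrib[of "\<lambda>x. x * _"] if_distrib[of "\<lambda>x. _ * x"] cong: if_cong)
    then show ?thesis by (simp add: ug_cols reduced_entry_def)
  qed
  then have "(\<Sum>i\<in>(UNIV :: 'n set). reduced_entry c i i + reduced_entry (flip c) i i +
      (\<Sum>k\<in>UNIV. reduced_entry c i k * reduced_entry (flip c) i k)) = 0"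
    by simp
  then show ?thesis
    by (simp add: reduced_letter_eq sum.distrib eq_neg_iff_add_eq_0)
qed

definition letter_sign :: "letter \<Rightarrow> real" where
  "letter_sign c = (case c of Lozenge \<Rightarrow> 1 | Bullet \<Rightarrow> - 1)"

definition word_sign :: "letter list \<Rightarrow> real" where
  "word_sign w = real (count_list w Lozenge) - real (count_list w Bullet)"

lemma word_sign_simps: "word_sign [] = 0" "word_sign (c # w) = letter_sign c + word_sign w"
  by (cases c; simp add: word_sign_def letter_sign_def)+

lemma letter_sign_square: "letter_sign c * letter_sign c = 1"
  by (cases c) (simp_all add: letter_sign_def)

lemma counit_chi: "counit (chi w :: 'n::finite free_unitary) = of_nat CARD('n) ^ length w"
  by (induction w) (simp_all add: counit_simps chi_letter_eq counit_ug)

context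
  fixes L :: "'n::finite free_unitary \<Rightarrow> complex"
  assumes gaussian: "gaussian L"
begin

lemma gaussian_linear: "clinear L"
  using gaussian by (simp add: gaussian_def generating_functional_def)

lemmas L_simps = clinear_simps[OF gaussian_linear] clinear_sum[OF gaussian_linear]

lemma gaussian_star: "L (star x) = cnj (L x)"
  using gaussian by (simp add: gaussian_def generating_functional_def)

lemma gaussian_one: "L 1 = 0"
  using gaussian by (simp add: gaussian_def generating_functional_def)

lemma gaussian_pos: "counit x = 0 \<Longrightarrow> L (x * star x) \<ge> 0"
proof -
  assume "counit x = 0"
  then have "counit (star x) = 0" by (simp add: counit_simps star_complex_def)
  then show ?thesis
    using gaussian unfolding gaussian_def generating_functional_def by (metis star_star)
qed

lemma gaussian_triple:
  assumes "counit x = 0" "counit y = 0" "counit z = 0"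
  shows "L (x * y * z) = 0"
  using gaussian assms unfolding gaussian_def by (simp add: counit_simps)

text \<open>By the preceding relation the sum of a reduced letter and its flip is a sum of products
  of two reduced entries; a further factor \<open>y\<close> makes them triples, so flipping a letter
  only changes the sign.\<close>

lemma gaussian_flip:
  assumes "counit y = 0"
  shows "L (y * reduced_letter (flip c)) = - L (y * reduced_letter c)"
    "L (reduced_letter (flip c) * y) = - L (reduced_letter c * y)"
proof -
  have "L (y * (reduced_letter c + reduced_letter (flip c))) = 0"
    "L ((reduced_letter c + reduced_letter (flip c)) * y) = 0"
    unfolding reduced_letter_relation
    using gaussian_triple[OF assms counit_reduced_entry counit_reduced_entry]
      gaussian_triple[OF counit_reduced_entry counit_reduced_entry assms]
    by (simp_all add: L_simps sum_distrib_left sum_distrib_right mult.assoc)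
  then show "L (y * reduced_letter (flip c)) = - L (y * reduced_letter c)"
    "L (reduced_letter (flip c) * y) = - L (reduced_letter c * y)"
    by (simp_all add: distrib_left distrib_right L_simps eq_neg_iff_add_eq_0 add.commute)
qed

context
  fixes a c :: real
  assumes a: "L (chi_letter Lozenge) = of_real a"
    and c: "L (reduced_letter Lozenge * reduced_letter Bullet) = of_real c"
begin

lemma gaussian_reduced_letter: "L (reduced_letter d) = of_real a"
proof -
  have "chi_letter Bullet = star (chi_letter Lozenge :: 'n free_unitary)"
    by (simp add: star_sum)
  then have "L (chi_letter d) = of_real a"
    using a gaussian_star[of "chi_letter Lozenge"] by (cases d) (simp_all del: chi_letter.simps)
  then show ?thesis by (simp add: reduced_letter_def L_simps gaussian_one)
qed

lemma gaussian_reduced_pair: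
  "L (reduced_letter d * reduced_letter e) = of_real (- (letter_sign d * letter_sign e * c))"
  using c gaussian_flip(1)[of "reduced_letter Lozenge" Bullet] gaussian_flip(2)[of "reduced_letter Lozenge" Lozenge]
    gaussian_flip(2)[of "reduced_letter Bullet" Lozenge]
  by (cases d; cases e) (simp_all add: letter_sign_def counit_reduced_letter)

text \<open>In the expansion of the word around N only the constant and the linear terms survive
  next to a reduced letter. The factor N keeps the exponents natural for the empty word.\<close>

lemma gaussian_reduced_chi:
  "of_nat CARD('n) * L (reduced_letter d * chi w) =
    of_real (a * real CARD('n) ^ (length w + 1) - letter_sign d * c * word_sign w * real CARD('n) ^ length w)"
proof (induction w)
  case Nil
  show ?case by (simp add: gaussian_reduced_letter word_sign_simps mult.commute)
next
  case (Cons e w)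
  let ?N = "of_nat CARD('n) :: complex"
  have split: "chi_letter e = (reduced_letter e :: 'n free_unitary) + ?N *\<^sub>C 1"
    by (simp add: reduced_letter_def)
  \<comment> \<open>Next to two reduced letters, \<open>chi w\<close> may be replaced by its counit
    N^n, since the difference lies in the kernel of the counit.\<close>
  have "L (reduced_letter d * reduced_letter e * (chi w - ?N ^ length w *\<^sub>C 1)) = 0"
    by (intro gaussian_triple counit_reduced_letter) (simp add: counit_simps counit_chi scaleC_complex_def)
  then have "L (reduced_letter d * (reduced_letter e * chi w)) =
      ?N ^ length w * of_real (- (letter_sign d * letter_sign e * c))"
    by (simp add: right_diff_distrib L_simps mult_scaleC_right gaussian_reduced_pair mult.assoc scaleC_complex_def
        eq_neg_iff_add_eq_0)
  then have "?N * L (reduced_letter d * chi (e # w)) =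
      ?N * (?N ^ length w * of_real (- (letter_sign d * letter_sign e * c)) + ?N * L (reduced_letter d * chi w))"
    by (simp add: split distrib_left distrib_right mult_scaleC_left mult_scaleC_right L_simps scaleC_complex_def
        del: chi_letter.simps)
  also have "\<dots> = ?N * (?N ^ length w * of_real (- (letter_sign d * letter_sign e * c)) +
      of_real (a * real CARD('n) ^ (length w + 1) - letter_sign d * c * word_sign w * real CARD('n) ^ length w))"
    by (simp only: Cons.IH)
  finally show ?case by (simp add: word_sign_simps algebra_simps)
qed

text \<open>The factor 2 N^2 clears the power N^(n-2) and the one half in ((p-q)^2 - n)/2, the sum
  of s_i s_j over pairs of letters.\<close>

lemma gaussian_chi_aux:
  "2 * of_nat CARD('n) ^ 2 * L (chi w) = of_real (real CARD('n) ^ length w *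
    (2 * real CARD('n) * real (length w) * a - c * ((word_sign w)\<^sup>2 - real (length w))))"
proof (induction w)
  case Nil
  show ?case by (simp add: gaussian_one word_sign_simps)
next
  case (Cons e w)
  let ?N = "of_nat CARD('n) :: complex"
  have sq: "(word_sign (e # w))\<^sup>2 = (word_sign w)\<^sup>2 + 2 * letter_sign e * word_sign w + 1"
    using letter_sign_square[of e] by (simp add: word_sign_simps power2_eq_square algebra_simps)
  have "chi (e # w) = (reduced_letter e :: 'n free_unitary) * chi w + ?N *\<^sub>C chi w"
    by (simp add: reduced_letter_def left_diff_distrib mult_scaleC_left)
  then have "2 * ?N ^ 2 * L (chi (e # w)) = 2 * ?N * (?N * L (reduced_letter e * chi w)) + ?N * (2 * ?N ^ 2 * L (chi w))"
    by (simp add: L_simps scaleC_complex_def algebra_simps power2_eq_square del: chi_simps)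
  also have "\<dots> = of_real (2 * real CARD('n) * (a * real CARD('n) ^ (length w + 1) - letter_sign e * c * word_sign w * real CARD('n) ^ length w)
      + real CARD('n) * (real CARD('n) ^ length w *
    (2 * real CARD('n) * real (length w) * a - c * ((word_sign w)\<^sup>2 - real (length w)))))"
    by (simp only: Cons.IH gaussian_reduced_chi) simp
  also have "2 * real CARD('n) * (a * real CARD('n) ^ (length w + 1) - letter_sign e * c * word_sign w * real CARD('n) ^ length w)
      + real CARD('n) * (real CARD('n) ^ length w *
      (2 * real CARD('n) * real (length w) * a - c * ((word_sign w)\<^sup>2 - real (length w)))) =
    real CARD('n) ^ length (e # w) *
      (2 * real CARD('n) * real (length (e # w)) * a - c * ((word_sign (e # w))\<^sup>2 - real (length (e # w))))"
    unfolding sq by (simp add: algebra_simps)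
  finally show ?case .
qed

lemma gaussian_chi:
  "L (chi w) = of_real (L_value CARD('n) (- a - c / (2 * real CARD('n))) (c / (2 * real CARD('n))) w)"
proof -
  let ?N = "real CARD('n)"
  have N: "?N \<noteq> 0" by simp
  have powi: "?N powi (int (length w) - 1) = ?N ^ length w / ?N"
    using N by (simp add: power_int_diff)
  have "2 * ?N ^ 2 * L_value CARD('n) (- a - c / (2 * ?N)) (c / (2 * ?N)) w =
      ?N ^ length w * (2 * ?N * real (length w) * a - c * ((word_sign w)\<^sup>2 - real (length w)))"
    unfolding L_value_def word_sign_def[symmetric] powi using N by (simp add: field_simps power2_eq_square)
  then have "2 * of_nat CARD('n) ^ 2 * L (chi w) =
      of_real (2 * ?N ^ 2 * L_value CARD('n) (- a - c / (2 * ?N)) (c / (2 * ?N)) w)"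
    by (simp only: gaussian_chi_aux)
  then show ?thesis by simp
qed

lemma gaussian_parameters_nonneg:
  "- a - c / (2 * real CARD('n)) \<ge> 0" "c / (2 * real CARD('n)) \<ge> 0"
proof -
  let ?N = "real CARD('n)" and ?x = "reduced_letter Lozenge"
  have N: "?N > 0" by simp
  have c': "L (?x * star ?x) = of_real c"
    using c by (simp add: star_reduced_letter)
  then have "c \<ge> 0" using gaussian_pos[OF counit_reduced_letter, of Lozenge] by (simp add: less_eq_complex_def)
  then show "c / (2 * ?N) \<ge> 0" by simp
  define p where "p i k = Re (L (reduced_entry Lozenge i k * star (reduced_entry Lozenge i k)))" for i k :: 'n
  have p: "p i k \<ge> 0" for i k
    using gaussian_pos[OF counit_reduced_entry, of Lozenge i k] by (simp add: p_def less_eq_complex_def)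
  have "2 * a = Re (L (reduced_letter Lozenge + reduced_letter (flip Lozenge)))"
    by (simp add: L_simps gaussian_reduced_letter)
  also have "\<dots> = - (\<Sum>i\<in>UNIV. \<Sum>k\<in>UNIV. p i k)"
    unfolding reduced_letter_relation by (simp add: L_simps p_def star_reduced_entry)
  finally have "- 2 * a = (\<Sum>i\<in>UNIV. \<Sum>k\<in>UNIV. p i k)" by simp
  also have "\<dots> \<ge> (\<Sum>i\<in>UNIV. p i i)"
    by (intro sum_mono member_le_sum) (auto simp: p)
  finally have 1: "- 2 * a \<ge> (\<Sum>i\<in>UNIV. p i i)" .
  \<comment> \<open>The diagonal entries minus their mean: the sum of d_i d_i* is the sum of v_ii
    v_ii* minus (1/N) x x*, where x is the sum of the v_ii.\<close>
  define d where "d i = reduced_entry Lozenge i i - of_real (1 / ?N) *\<^sub>C ?x" for i :: 'n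
  have "0 \<le> L (\<Sum>i\<in>UNIV. d i * star (d i))"
    unfolding L_simps
    by (intro sum_nonneg gaussian_pos) (simp add: d_def counit_simps counit_reduced_entry counit_reduced_letter)
  also have "(\<Sum>i\<in>UNIV. d i * star (d i)) =
      (\<Sum>i\<in>UNIV. reduced_entry Lozenge i i * star (reduced_entry Lozenge i i)) - of_real (1 / ?N) *\<^sub>C (?x * star ?x)"
  proof -
    have "(\<Sum>i\<in>UNIV. d i * star (d i)) =
        (\<Sum>i\<in>UNIV. reduced_entry Lozenge i i * star (reduced_entry Lozenge i i))
        - of_real (1 / ?N) *\<^sub>C ((\<Sum>i\<in>UNIV. reduced_entry Lozenge i i) * star ?x)
        - of_real (1 / ?N) *\<^sub>C (?x * star (\<Sum>i\<in>UNIV. reduced_entry Lozenge i i))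
        + (\<Sum>i\<in>(UNIV :: 'n set). of_real (1 / ?N) *\<^sub>C of_real (1 / ?N) *\<^sub>C (?x * star ?x))"
      by (simp add: d_def star_diff star_scaleC star_sum left_diff_distrib right_diff_distrib sum_subtractf
          mult_scaleC_left mult_scaleC_right sum_distrib_left sum_distrib_right cvec.scale_sum_right
          cvec.scale_right_diff_distrib sum.distrib)
    also have "(\<Sum>i\<in>(UNIV :: 'n set). of_real (1 / ?N) *\<^sub>C of_real (1 / ?N) *\<^sub>C (?x * star ?x)) =
        of_real (1 / ?N) *\<^sub>C (?x * star ?x)"
    proof -
      have "(\<Sum>i\<in>(UNIV :: 'n set). of_real (1 / ?N) *\<^sub>C of_real (1 / ?N) *\<^sub>C (?x * star ?x)) =
          (\<Sum>i\<in>(UNIV :: 'n set). of_real (1 / ?N) * of_real (1 / ?N)) *\<^sub>C (?x * star ?x)"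
        by (simp add: cvec.scale_sum_left scaleC_scaleC del: sum_constant)
      then show ?thesis by simp
    qed
    finally show ?thesis by (simp add: reduced_letter_eq[symmetric])
  qed
  finally have "0 \<le> (\<Sum>i\<in>UNIV. p i i) - c / ?N"
    by (simp add: L_simps c' p_def less_eq_complex_def scaleC_complex_def)
  moreover have "c / (2 * ?N) = c / ?N / 2" by simp
  ultimately show "- a - c / (2 * ?N) \<ge> 0" using 1 by linarith
qed

end

lemma gaussian_real_form:
  assumes "L (chi_letter Lozenge) \<in> \<real>"
  obtains \<alpha> \<beta> where "\<alpha> \<ge> 0" "\<beta> \<ge> 0" "\<And>w. L (chi w) = of_real (L_value CARD('n) \<alpha> \<beta> w)"
proof -
  from assms obtain a where a: "L (chi_letter Lozenge) = of_real a" by (auto elim: Reals_cases)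
  have "L (reduced_letter Lozenge * star (reduced_letter Lozenge)) \<ge> 0"
    by (rule gaussian_pos[OF counit_reduced_letter])
  then have c: "L (reduced_letter Lozenge * reduced_letter Bullet) =
      of_real (Re (L (reduced_letter Lozenge * reduced_letter Bullet)))"
    by (simp add: star_reduced_letter less_eq_complex_def complex_eq_iff)
  show ?thesis
    by (rule that[OF gaussian_parameters_nonneg[OF a c] gaussian_chi[OF a c]])
qed

end

section \<open>The functionals \<open>L\<^sub>\<alpha>\<^sub>\<beta>\<close>\<close>

lemma left_derivative_sum:
  "(\<And>i. i \<in> A \<Longrightarrow> left_derivative X (f i) (f' i)) \<Longrightarrow> left_derivative X (\<Sum>i\<in>A. f i) (\<Sum>i\<in>A. f' i)"
proof (induction A rule: infinite_finite_induct)
  case (insert i A)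
  then show ?case by (auto intro: left_derivative_add)
qed (use left_derivative_scaleC[OF left_derivative_one, of X 0] in simp_all)

lemma second_derivative_chi:
  fixes X :: "complex^'n::finite^'n"
  assumes X: "X \<in> lie_u"
  shows "second_derivative X (chi_letter Lozenge) = (\<Sum>i\<in>UNIV. \<Sum>k\<in>UNIV. X $ k $ i * X $ i $ k)"
proof -
  have "left_derivative X (\<Sum>i\<in>UNIV. ugen i i) (\<Sum>i\<in>UNIV. \<Sum>k\<in>UNIV. X $ k $ i *\<^sub>C ugen i k)"
    by (intro left_derivative_sum left_derivative_ugen)
  moreover have "left_derivative X (\<Sum>i\<in>UNIV. \<Sum>k\<in>UNIV. X $ k $ i *\<^sub>C ugen i k)
      (\<Sum>i\<in>UNIV. \<Sum>k\<in>UNIV. X $ k $ i *\<^sub>C (\<Sum>l\<in>UNIV. X $ l $ k *\<^sub>C ugen i l))"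
    by (intro left_derivative_sum left_derivative_scaleC left_derivative_ugen)
  ultimately show ?thesis
    using second_derivative_eq[OF X]
    by (simp add: counit_simps counit_ugen scaleC_complex_def if_distrib[of "\<lambda>x. _ * x"] cong: if_cong)
qed

lemma second_derivative_reduced_pair:
  fixes X :: "complex^'n::finite^'n"
  assumes X: "X \<in> lie_u"
  shows "second_derivative X (reduced_letter Lozenge * reduced_letter Bullet) =
    of_real (2 * (cmod (\<Sum>i\<in>UNIV. X $ i $ i))\<^sup>2)"
proof -
  let ?x = "reduced_letter Lozenge :: 'n free_unitary"
  define y where "y = (\<Sum>i\<in>UNIV. \<Sum>k\<in>UNIV. X $ k $ i *\<^sub>C ugen i k)"
  have "left_derivative X ((\<Sum>i\<in>UNIV. ugen i i) + (- of_nat CARD('n)) *\<^sub>C 1) (y + (- of_nat CARD('n)) *\<^sub>C 0)"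
    unfolding y_def
    by (intro left_derivative_add left_derivative_scaleC left_derivative_sum left_derivative_ugen
        left_derivative_one)
  then have x: "left_derivative X ?x y"
    by (simp add: reduced_letter_def)
  have "second_derivative X (?x * star ?x) = 2 * (counit y * cnj (counit y))"
    using second_derivative_eq[OF X left_derivative_mult[OF x left_derivative_star[OF x]]
      left_derivative_add[OF left_derivative_mult[OF x left_derivative_lder]
        left_derivative_mult[OF left_derivative_lder left_derivative_star[OF x]]]]
    by (simp add: counit_simps star_complex_def counit_reduced_letter)
  moreover have "counit y = (\<Sum>i\<in>UNIV. X $ i $ i)"
    by (simp add: y_def counit_simps counit_ugen scaleC_complex_def if_distrib[of "\<lambda>x. _ * x"] cong: if_cong)
  ultimately show ?thesis
    by (simp only: star_reduced_letter flip.simps of_real_mult of_real_numeral complex_norm_square)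
qed

lemma second_derivative_chi_real:
  assumes "X \<in> lie_u"
  shows "second_derivative X (chi_letter Lozenge) \<in> \<real>"
proof -
  have "X $ k $ i * X $ i $ k = - of_real ((cmod (X $ i $ k))\<^sup>2)" for i k
    by (subst skew_entry[OF assms, of k i]) (simp add: complex_norm_square mult.commute del: of_real_power)
  then show ?thesis unfolding second_derivative_chi[OF assms] by (simp del: of_real_power)
qed

text \<open>The diagonal matrix with entries \<open>\<i> c\<^sub>k\<close>, where \<open>c = (s + r, s - r, s, \<dots>, s)\<close>, has parameters
  \<open>\<alpha> = 2 r\<^sup>2\<close> and \<open>\<beta> = N s\<^sup>2\<close>.\<close>

lemma exists_direction:
  assumes N: "CARD('n::finite) \<ge> 2" and "\<alpha> \<ge> 0" "\<beta> \<ge> 0"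
  shows "\<exists>X :: complex^'n^'n. X \<in> lie_u \<and>
    (\<forall>w. second_derivative X (chi w) = of_real (L_value CARD('n) \<alpha> \<beta> w))"
proof -
  let ?N = "real CARD('n)"
  \<comment> \<open>Two distinct indices allow a perturbation by r and -r that leaves the trace
    unchanged while adding 2 r^2 to the sum of squares.\<close>
  obtain p q :: 'n where pq: "p \<noteq> q"
    using N card_le_Suc0_iff_eq[of "UNIV :: 'n set"] by auto
  define s r where "s = sqrt (\<beta> / ?N)" and "r = sqrt (\<alpha> / 2)"
  define c where "c k = s + (if k = p then r else 0) - (if k = q then r else 0)" for k
  define X :: "complex^'n^'n" where "X = (\<chi> i j. if i = j then \<i> * of_real (c i) else 0)"
  have X: "X \<in> lie_u"
    by (auto simp: lie_u_def adjoint_matrix_def X_def vec_eq_iff)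
  have sum_c: "(\<Sum>k\<in>UNIV. c k) = ?N * s"
    by (simp add: c_def sum.distrib sum_subtractf)
  have "(c k)\<^sup>2 = s\<^sup>2 + (if k = p then r\<^sup>2 + 2 * s * r else 0) + (if k = q then r\<^sup>2 - 2 * s * r else 0)" for k
    using pq by (simp add: c_def power2_eq_square algebra_simps)
  then have sum_c2: "(\<Sum>k\<in>UNIV. (c k)\<^sup>2) = ?N * s\<^sup>2 + 2 * r\<^sup>2"
    by (simp add: sum.distrib)
  have "\<i> * z * (\<i> * z) = - (z * z)" for z
    by (simp add: complex_eq_iff)
  then have "(\<Sum>i\<in>UNIV. \<Sum>k\<in>UNIV. X $ k $ i * X $ i $ k) = (\<Sum>i\<in>UNIV. - of_real ((c i)\<^sup>2))"
    by (intro sum.cong HOL.refl) (simp add: X_def if_distrib[of "\<lambda>x. x * _"] power2_eq_square cong: if_cong)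
  then have a: "second_derivative X (chi_letter Lozenge) = of_real (- (?N * s\<^sup>2 + 2 * r\<^sup>2))"
    unfolding second_derivative_chi[OF X] sum_c2[symmetric] by (simp add: sum_negf)
  have "(\<Sum>i\<in>UNIV. X $ i $ i) = \<i> * of_real (?N * s)"
    unfolding sum_c[symmetric] by (simp add: X_def sum_distrib_left)
  then have "second_derivative X (reduced_letter Lozenge * reduced_letter Bullet) = of_real (2 * (?N * s)\<^sup>2)"
    by (simp add: second_derivative_reduced_pair[OF X] norm_mult power_mult_distrib)
  note chi = gaussian_chi[OF gaussian_second_derivative[OF X] a this]
  \<comment> \<open>Here a = -(N s^2 + 2 r^2) and c = 2 (N s)^2, so c/(2N) = N s^2 is beta and -a -
    c/(2N) = 2 r^2 is alpha.\<close>
  have "s\<^sup>2 = \<beta> / ?N" "r\<^sup>2 = \<alpha> / 2" using assms by (simp_all add: s_def r_def)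
  moreover have "2 * (?N * s)\<^sup>2 / (2 * ?N) = ?N * s\<^sup>2"
    by (simp add: power2_eq_square)
  ultimately have "2 * (?N * s)\<^sup>2 / (2 * ?N) = \<beta>" "- (- (?N * s\<^sup>2 + 2 * r\<^sup>2)) - 2 * (?N * s)\<^sup>2 / (2 * ?N) = \<alpha>"
    by simp_all
  with chi X show ?thesis by metis
qed

lemma clinear_eq_on_chi_span:
  assumes "clinear f" "clinear g" "\<And>w. f (chi w) = g (chi w)" "x \<in> chi_span"
  shows "f x = g x"
  using assms(4)
proof (induction rule: cvec.span_induct_alt)
  case base
  show ?case by (simp add: clinear_simps[OF assms(1)] clinear_simps[OF assms(2)])
next
  case (step c y x)
  then show ?case
    using assms(3) by (auto simp: clinear_simps[OF assms(1)] clinear_simps[OF assms(2)])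
qed

section \<open>Realization of the functionals as centralizations\<close>

context haar_expectation
begin

lemma E_idempotent: "E (E x) = E x"
  using expectation chi_span_subset_central E_in_chi_span unfolding central_expectation_def by blast

lemma clinear_comp_E: "clinear L \<Longrightarrow> clinear (L \<circ> E)" for L :: "'n free_unitary \<Rightarrow> complex"
  by (rule clinearI) (simp_all add: E_simps clinear_simps)

lemma L_spec_comp_E:
  fixes L :: "'n free_unitary \<Rightarrow> complex"
  assumes "clinear L" "\<And>w. L (chi w) = of_real (L_value CARD('n) \<alpha> \<beta> w)"
  shows "L_spec E \<alpha> \<beta> (L \<circ> E)"
  using clinear_comp_E[OF assms(1)] assms(2)
  by (simp add: L_spec_def central_functional_def fun_eq_iff E_idempotent E_chi)

text \<open>Centrality moves the comparison to \<open>E x\<close>, which lies in the span where the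
  values are prescribed.\<close>

lemma L_spec_unique:
  assumes "L_spec E \<alpha> \<beta> L" "L_spec E \<alpha> \<beta> L'"
  shows "L = L'"
proof
  fix x
  have "L (E x) = L' (E x)"
    by (rule clinear_eq_on_chi_span[OF _ _ _ E_in_chi_span]) (use assms in \<open>auto simp: L_spec_def\<close>)
  moreover have central: "L = L \<circ> E" "L' = L' \<circ> E"
    using assms by (simp_all only: L_spec_def central_functional_def)
  have "L x = L (E x)" "L' x = L' (E x)"
    using fun_cong[OF central(1), of x] fun_cong[OF central(2), of x] by (simp_all only: comp_apply)
  ultimately show "L x = L' x" by simp
qed

lemma L_functional_eq: "L_spec E \<alpha> \<beta> L \<Longrightarrow> L_functional E \<alpha> \<beta> = L"
  unfolding L_functional_def by (rule the_equality) (auto intro: L_spec_unique)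

lemma generating_functional_second_derivative_E:
  assumes X: "X \<in> lie_u"
  shows "generating_functional (second_derivative X \<circ> E)"
proof -
  note gaussian = gaussian_second_derivative[OF X]
  have "E 1 = 1" using E_chi[of "[]"] by simp
  then show ?thesis
    using second_derivative_E_positive[OF X]
    by (auto simp: generating_functional_def clinear_comp_E gaussian_linear[OF gaussian] E_star
        gaussian_star[OF gaussian] gaussian_one[OF gaussian])
qed

text \<open>One direction X serves twice: it proves that the functional exists and generates, and it
  exhibits a Gaussian functional with this centralization.\<close>

lemma L_functional_eq_second_derivative:
  assumes "CARD('n) \<ge> 2" "\<alpha> \<ge> 0" "\<beta> \<ge> 0"
  obtains X :: "complex^'n^'n" where "X \<in> lie_u" "L_spec E \<alpha> \<beta> (second_derivative X \<circ> E)"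
    "L_functional E \<alpha> \<beta> = second_derivative X \<circ> E"
proof -
  obtain X :: "complex^'n^'n" where X: "X \<in> lie_u"
    and chi: "\<And>w. second_derivative X (chi w) = of_real (L_value CARD('n) \<alpha> \<beta> w)"
    using exists_direction[OF assms] by blast
  have "L_spec E \<alpha> \<beta> (second_derivative X \<circ> E)"
    by (rule L_spec_comp_E[OF gaussian_linear[OF gaussian_second_derivative[OF X]] chi])
  from that[OF X this L_functional_eq[OF this]] show ?thesis .
qed

lemma gaussian_comp_E:
  assumes "gaussian L" "L (chi_letter Lozenge) \<in> \<real>"
  obtains \<alpha> \<beta> where "\<alpha> \<ge> 0" "\<beta> \<ge> 0" "L \<circ> E = L_functional E \<alpha> \<beta>"
proof -
  obtain \<alpha> \<beta> where "\<alpha> \<ge> 0" "\<beta> \<ge> 0" and chi: "\<And>w. L (chi w) = of_real (L_value CARD('n) \<alpha> \<beta> w)"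
    by (rule gaussian_real_form[OF assms], rule that)
  moreover have "L \<circ> E = L_functional E \<alpha> \<beta>"
    by (rule L_functional_eq[OF L_spec_comp_E[OF gaussian_linear[OF assms(1)] chi], symmetric])
  ultimately show ?thesis using that by blast
qed

text \<open>A sum of the Gaussian functionals X_i^2, with real values tr(X_i^2) on the character of
  u; this makes the Brownian motion an instance of the classification.\<close>

lemma gaussian_laplace_beltrami:
  fixes X :: "nat \<Rightarrow> complex^'n^'n"
  assumes "lie_u_basis X"
  shows "gaussian (laplace_beltrami X \<circ> restrict_classical)"
    and "(laplace_beltrami X \<circ> restrict_classical) (chi_letter Lozenge) \<in> \<real>"
proof -
  have X: "X i \<in> lie_u" if "i \<in> {1..CARD('n)\<^sup>2}" for i
    using assms that span_superset[of "X ` {1..CARD('n)\<^sup>2}"] unfolding lie_u_basis_def by blast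
  have eq: "laplace_beltrami X \<circ> restrict_classical = (\<lambda>x. \<Sum>i=1..CARD('n)\<^sup>2. second_derivative (X i) x)"
    by (simp add: fun_eq_iff laplace_beltrami_def second_derivative_def)
  show "gaussian (laplace_beltrami X \<circ> restrict_classical)"
    unfolding eq by (intro gaussian_sum gaussian_second_derivative X) auto
  show "(laplace_beltrami X \<circ> restrict_classical) (chi_letter Lozenge) \<in> \<real>"
    unfolding eq by (intro sum_in_Reals second_derivative_chi_real X)
qed

end

theorem theorem3p3:
  fixes h :: "'n::finite free_unitary \<Rightarrow> complex"
    and E :: "'n free_unitary \<Rightarrow> 'n free_unitary"
  assumes "CARD('n) \<ge> 2"
    and "haar_state h"
    and "central_expectation h E"
  shows "(\<forall>\<alpha>\<ge>0. \<forall>\<beta>\<ge>0. (\<exists>!L. L_spec E \<alpha> \<beta> L) \<and> generating_functional (L_functional E \<alpha> \<beta>))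
    \<and> {L \<circ> E | L. gaussian L \<and> (\<forall>w. (L \<circ> E) (chi w) \<in> \<real>)} =
        {L_functional E \<alpha> \<beta> | \<alpha> \<beta>. \<alpha> \<ge> 0 \<and> \<beta> \<ge> 0}
    \<and> (\<forall>X. lie_u_basis X \<longrightarrow>
        (\<exists>\<alpha>\<ge>0. \<exists>\<beta>\<ge>0. laplace_beltrami X \<circ> restrict_classical \<circ> E = L_functional E \<alpha> \<beta>))"
proof -
  interpret haar_expectation h E
    by unfold_locales (fact assms(2,3))+
  have 1: "(\<exists>!L. L_spec E \<alpha> \<beta> L) \<and> generating_functional (L_functional E \<alpha> \<beta>)" if nonneg: "\<alpha> \<ge> 0" "\<beta> \<ge> 0" for \<alpha> \<beta>
  proof -
    obtain X :: "complex^'n^'n" where "X \<in> lie_u" "L_spec E \<alpha> \<beta> (second_derivative X \<circ> E)"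
      "L_functional E \<alpha> \<beta> = second_derivative X \<circ> E"
      by (rule L_functional_eq_second_derivative[OF assms(1) nonneg], rule that)
    then show ?thesis
      using generating_functional_second_derivative_E L_spec_unique by auto
  qed
  have 2: "\<exists>\<alpha> \<beta>. L \<circ> E = L_functional E \<alpha> \<beta> \<and> \<alpha> \<ge> 0 \<and> \<beta> \<ge> 0"
    if "gaussian L" "\<forall>w. (L \<circ> E) (chi w) \<in> \<real>" for L
  proof -
    \<comment> \<open>The value on the one-letter word decides: the classification makes the values
      on all other words real.\<close>
    have "L (chi_letter Lozenge) \<in> \<real>"
      using that(2)[rule_format, of "[Lozenge]"] by (simp only: comp_apply E_chi) simp
    from gaussian_comp_E[OF that(1) this] show ?thesis by blast
  qed
  have 3: "\<exists>L. L_functional E \<alpha> \<beta> = L \<circ> E \<and> gaussian L \<and> (\<forall>w. (L \<circ> E) (chi w) \<in> \<real>)"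
    if nonneg: "\<alpha> \<ge> 0" "\<beta> \<ge> 0" for \<alpha> \<beta>
  proof -
    obtain X :: "complex^'n^'n" where X: "X \<in> lie_u" "L_spec E \<alpha> \<beta> (second_derivative X \<circ> E)"
      "L_functional E \<alpha> \<beta> = second_derivative X \<circ> E"
      by (rule L_functional_eq_second_derivative[OF assms(1) nonneg], rule that)
    moreover from X(2) have "(second_derivative X \<circ> E) (chi w) \<in> \<real>" for w
      unfolding L_spec_def by (metis Reals_of_real)
    ultimately show ?thesis using gaussian_second_derivative by blast
  qed
  have 4: "\<exists>\<alpha>\<ge>0. \<exists>\<beta>\<ge>0. laplace_beltrami X \<circ> restrict_classical \<circ> E = L_functional E \<alpha> \<beta>"
    if lie_u_basis: "lie_u_basis X" for X :: "nat \<Rightarrow> complex^'n^'n"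
  proof -
    obtain \<alpha> \<beta> where "\<alpha> \<ge> 0" "\<beta> \<ge> 0" "laplace_beltrami X \<circ> restrict_classical \<circ> E = L_functional E \<alpha> \<beta>"
      by (rule gaussian_comp_E[OF gaussian_laplace_beltrami[OF lie_u_basis]], rule that)
    then show ?thesis by blast
  qed
  have "{L \<circ> E | L. gaussian L \<and> (\<forall>w. (L \<circ> E) (chi w) \<in> \<real>)} =
      {L_functional E \<alpha> \<beta> | \<alpha> \<beta>. \<alpha> \<ge> 0 \<and> \<beta> \<ge> 0}"
  proof (rule antisym; rule subsetI)
    fix f
    assume "f \<in> {L \<circ> E | L. gaussian L \<and> (\<forall>w. (L \<circ> E) (chi w) \<in> \<real>)}"
    then obtain L where "f = L \<circ> E" "gaussian L" "\<forall>w. (L \<circ> E) (chi w) \<in> \<real>" by blast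
    with 2[of L] show "f \<in> {L_functional E \<alpha> \<beta> | \<alpha> \<beta>. \<alpha> \<ge> 0 \<and> \<beta> \<ge> 0}" by simp
  next
    fix f
    assume "f \<in> {L_functional E \<alpha> \<beta> | \<alpha> \<beta>. \<alpha> \<ge> 0 \<and> \<beta> \<ge> 0}"
    then obtain \<alpha> \<beta> where "f = L_functional E \<alpha> \<beta>" "\<alpha> \<ge> 0" "\<beta> \<ge> 0" by blast
    with 3[of \<alpha> \<beta>] show "f \<in> {L \<circ> E | L. gaussian L \<and> (\<forall>w. (L \<circ> E) (chi w) \<in> \<real>)}" by simp
  qed
  with 1 4 show ?thesis by simp
qed

end
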